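(* Assume that the kernel $k$ satisfies $k(x,U,x',U')\ge0$ and $k(x,U,x,U)>0$ for all $x,x'\in\mathbb{R}^n$ and $U,U'\in\widetilde{G}^n_d$, and that its reproducing kernel Hilbert space $W$ is continuously embedded in $C_0^1(\mathbb{R}^n\times\widetilde{G}^n_d)$. Let $\mu=\sum_{i=1}^Nr_i\delta_{(x_i,U_i)}$ be a discrete varifold ($N\in\mathbb{N}$, $r_i>0$, $x_i\in\mathbb{R}^n$, $U_i\in\widetilde{G}^n_d$) and $\mu^{tar}\in\mathcal{V}_d$. Then the relaxed problem $$\inf\left\{\frac12\int_0^1\|v_t\|_V^2\,dt+\frac\gamma2\int_0^1\int_{\mathbb{R}^n\times\widetilde{G}^n_d}\eta_t^2(x)\,J_U\varphi_t^v(x)\,d\mu(x,U)\,dt+\frac\lambda2\left\|((\tilde\alpha_1^\eta)^2\circ(\varphi_1^v)^{-1})(\varphi_1^v)_\#\mu-\mu^{tar}\right\|_{W^*}^2\right\}$$ over $v\in L^2([0,1],V)$ and $\eta\in L^2([0,1],L^2(|\mu|))$ has a solution $(v,\eta)\in L^2([0,1],V)\times L^2([0,1],L^2(|\mu|))$.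
   Context: Let $n\ge 2$, $0\le d\le n$. $\widetilde{G}^n_d$ is the oriented Grassmannian of $d$-dimensional oriented linear subspaces of $\mathbb{R}^n$. An (oriented) $d$-varifold is a nonnegative finite Radon measure on $\mathbb{R}^n\times\widetilde{G}^n_d$; $\mathcal{V}_d$ is the set of all of them. The weight $|\mu|$ of $\mu\in\mathcal{V}_d$ is the measure on $\mathbb{R}^n$ with $|\mu|(A)=\mu(A\times\widetilde{G}^n_d)$. For a $C^1$-diffeomorphism $\varphi$ of $\mathbb{R}^n$, the pushforward is defined by $(\varphi_\#\mu|\omega)=\int \omega(\varphi(x),d_x\varphi\cdot U)\,J_U\varphi(x)\,d\mu(x,U)$ for $\omega\in C_0(\mathbb{R}^n\times\widetilde{G}^n_d)$, where $d_x\varphi\cdot U$ is the oriented image of $U$ under $d_x\varphi$ and $J_U\varphi(x)=\sqrt{\det(d_x\varphi(u_i)\cdot d_x\varphi(u_j))_{i,j}}$ for any orthonormal frame $(u_1,\dots,u_d)$ of $U$. For a nonnegative function $\beta$ on $\mathbb{R}^n$, $(\beta\mu|\omega)=\int\beta(x)\omega(x,U)\,d\mu(x,U)$. $V$ is a Hilbert space of vector fields $\mathbb{R}^n\to\mathbb{R}^n$ continuously embedded in $C^2_0(\mathbb{R}^n,\mathbb{R}^n)$ ($C^2$ vector fields vanishing at infinity together with their first and second order derivatives). For $v\in L^2([0,1],V)$, $\varphi^v_t$ is the flow: $\varphi_0^v=\mathrm{Id}$, $\partial_t\varphi_t^v=v_t\circ\varphi_t^v$. For $\eta\in L^2([0,1],L^2(|\mu|))$,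 $\tilde\alpha_t^\eta(x)=1+\frac12\int_0^t\eta_s(x)\,ds$ for $x\in\mathrm{supp}(|\mu|)$. The parameters $\gamma,\lambda>0$ are fixed. The kernel is $k(x,U,x',U')=k^{pos}(x,x')k^G(U,U')$ with $k^{pos}$, $k^G$ continuous positive definite kernels on $\mathbb{R}^n$ and $\widetilde{G}^n_d$, and $k^{pos}(x,\cdot)\in C_0(\mathbb{R}^n)$ for every $x$; $W$ is its reproducing kernel Hilbert space, which is continuously embedded in $C_0(\mathbb{R}^n\times\widetilde{G}^n_d)$. Varifolds act as linear forms on $W$ by integration and $\|\mu-\mu'\|_{W^*}=\sup_{\|\omega\|_W\le1}(\mu-\mu'|\omega)$. $C_0^1(\mathbb{R}^n\times\widetilde{G}^n_d)$ is the space of $C^1$ functions vanishing at infinity together with their first derivatives. *)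

theory Defs
  imports "HOL-Analysis.Analysis" "Jordan_Normal_Form.Determinant"
begin

hide_const (open) Determinant.det

subsection \<open>Oriented linear subspaces\<close>

text \<open>
  An orientation is a class of ordered bases modulo changes of basis of positive
  determinant. The additional flag (\<open>False\<close> stands for the reversed orientation) is
  redundant in dimension at least one; in dimension zero, where the empty list is the only
  basis, it provides the usual two orientations.
\<close>

definition frame_equiv ::
  "bool \<times> 'a::euclidean_space list \<Rightarrow> bool \<times> 'a list \<Rightarrow> bool" where
  "frame_equiv = (\<lambda>(b, us) (c, vs).
     distinct us \<and> independent (set us) \<and> distinct vs \<and> independent (set vs) \<and>
     (\<exists>M. M \<in> carrier_mat (length us) (length us) \<and> Determinant.det M \<noteq> 0 \<and>
          ((b = c) \<longleftrightarrow> 0 < Determinant.det M) \<and>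
          vs = map (\<lambda>i. \<Sum>j<length us. (M $$ (i, j)) *\<^sub>R us ! j) [0..<length us]))"

lemma frame_equiv_refl:
  assumes "distinct us" "independent (set us)"
  shows "frame_equiv (b, us) (b, us)"
proof -
  let ?d = "length us"
  have "us = map (\<lambda>i. \<Sum>j<?d. (1\<^sub>m ?d $$ (i, j)) *\<^sub>R us ! j) [0..<?d]"
  proof (rule nth_equalityI)
    fix i assume i: "i < ?d"
    have "(\<Sum>j<?d. (1\<^sub>m ?d $$ (i, j)) *\<^sub>R us ! j) = (\<Sum>j<?d. if i = j then us ! j else 0)"
      using i by (intro sum.cong) auto
    then show "us ! i = map (\<lambda>i. \<Sum>j<?d. (1\<^sub>m ?d $$ (i, j)) *\<^sub>R us ! j) [0..<?d] ! i"
      using i by simp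
  qed simp
  then show ?thesis
    using assms unfolding frame_equiv_def
    by (auto intro!: exI[of _ "1\<^sub>m ?d"])
qed

lemma mat_combination_mult:
  fixes us :: "'a::real_vector list"
  assumes M: "M \<in> carrier_mat d d" and P: "P \<in> carrier_mat d d" and i: "i < d"
    and vs: "\<And>j. j < d \<Longrightarrow> vs j = (\<Sum>l<d. (M $$ (j, l)) *\<^sub>R us ! l)"
  shows "(\<Sum>j<d. (P $$ (i, j)) *\<^sub>R vs j) = (\<Sum>l<d. ((P * M) $$ (i, l)) *\<^sub>R us ! l)"
proof -
  have "(\<Sum>j<d. (P $$ (i, j)) *\<^sub>R vs j)
      = (\<Sum>j<d. \<Sum>l<d. (P $$ (i, j) * M $$ (j, l)) *\<^sub>R us ! l)"
    by (intro sum.cong) (auto simp: vs scaleR_sum_right)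
  also have "\<dots> = (\<Sum>l<d. \<Sum>j<d. (P $$ (i, j) * M $$ (j, l)) *\<^sub>R us ! l)"
    by (rule sum.swap)
  also have "\<dots> = (\<Sum>l<d. ((P * M) $$ (i, l)) *\<^sub>R us ! l)"
    using M P i
    by (intro sum.cong) (auto simp: scaleR_sum_left scalar_prod_def atLeast0LessThan)
  finally show ?thesis .
qed

lemma frame_equiv_sym:
  assumes "frame_equiv p q"
  shows "frame_equiv q p"
proof -
  obtain b us c vs where pq: "p = (b, us)" "q = (c, vs)"
    by (cases p, cases q)
  let ?d = "length us"
  from assms obtain M where ind: "distinct us" "independent (set us)" "distinct vs" "independent (set vs)"
    and M: "M \<in> carrier_mat ?d ?d" "Determinant.det M \<noteq> 0" "(b = c) \<longleftrightarrow> 0 < Determinant.det M"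
    and vs: "vs = map (\<lambda>i. \<Sum>j<?d. (M $$ (i, j)) *\<^sub>R us ! j) [0..<?d]"
    unfolding frame_equiv_def pq split_conv by blast
  have len: "length vs = ?d" by (simp add: vs)
  obtain P where P: "P \<in> carrier_mat ?d ?d" "P * M = 1\<^sub>m ?d"
    using det_non_zero_imp_unit[OF M(1,2)] unfolding Units_def ring_mat_def by auto
  have dP: "Determinant.det P * Determinant.det M = 1"
    using det_mult[OF P(1) M(1)] P(2) by simp
  have "us = map (\<lambda>i. \<Sum>j<?d. (P $$ (i, j)) *\<^sub>R vs ! j) [0..<?d]"
  proof (rule nth_equalityI)
    fix i assume i: "i < ?d"
    have "(\<Sum>j<?d. (P $$ (i, j)) *\<^sub>R vs ! j) = (\<Sum>l<?d. ((P * M) $$ (i, l)) *\<^sub>R us ! l)"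
      by (rule mat_combination_mult[OF M(1) P(1) i]) (simp add: vs)
    also have "\<dots> = (\<Sum>l<?d. if i = l then us ! l else 0)"
      using i by (intro sum.cong) (auto simp: P(2))
    finally show "us ! i = map (\<lambda>i. \<Sum>j<?d. (P $$ (i, j)) *\<^sub>R vs ! j) [0..<?d] ! i"
      using i by simp
  qed simp
  moreover have "Determinant.det P \<noteq> 0"
    using dP by auto
  moreover have "0 < Determinant.det P \<longleftrightarrow> 0 < Determinant.det M"
  proof -
    have "0 < Determinant.det P * Determinant.det M"
      using dP by simp
    then show ?thesis
      by (auto simp: zero_less_mult_iff)
  qed
  ultimately show ?thesis
    using ind M P(1) unfolding frame_equiv_def pq split_conv len by blast
qed

lemma frame_equiv_trans:
  assumes "frame_equiv p q" "frame_equiv q r"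
  shows "frame_equiv p r"
proof -
  obtain a us b vs c ws where pqr: "p = (a, us)" "q = (b, vs)" "r = (c, ws)"
    by (cases p, cases q, cases r)
  let ?d = "length us"
  from assms(1) obtain M where ind: "distinct us" "independent (set us)"
    and M: "M \<in> carrier_mat ?d ?d" "Determinant.det M \<noteq> 0" "(a = b) \<longleftrightarrow> 0 < Determinant.det M"
    and vs: "vs = map (\<lambda>i. \<Sum>j<?d. (M $$ (i, j)) *\<^sub>R us ! j) [0..<?d]"
    unfolding frame_equiv_def pqr split_conv by blast
  have len: "length vs = ?d" by (simp add: vs)
  from assms(2) obtain P where ind': "distinct ws" "independent (set ws)"
    and P: "P \<in> carrier_mat ?d ?d" "Determinant.det P \<noteq> 0" "(b = c) \<longleftrightarrow> 0 < Determinant.det P"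
    and ws: "ws = map (\<lambda>i. \<Sum>j<?d. (P $$ (i, j)) *\<^sub>R vs ! j) [0..<?d]"
    unfolding frame_equiv_def pqr split_conv len by blast
  have "ws = map (\<lambda>i. \<Sum>j<?d. ((P * M) $$ (i, j)) *\<^sub>R us ! j) [0..<?d]"
    unfolding ws
    by (intro map_cong refl mat_combination_mult[OF M(1) P(1)]) (auto simp: vs)
  moreover have "Determinant.det (P * M) = Determinant.det P * Determinant.det M"
    by (rule det_mult[OF P(1) M(1)])
  ultimately show ?thesis
    using ind ind' M P unfolding frame_equiv_def pqr split_conv
    by (intro conjI exI[of _ "P * M"]) (auto simp: zero_less_mult_iff)
qed

lemma part_equivp_frame_equiv: "part_equivp frame_equiv"
proof (rule part_equivpI)
  show "\<exists>p. frame_equiv p p"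
    using frame_equiv_refl[of "[]" True] by (simp add: independent_empty) blast
  show "symp frame_equiv"
    by (rule sympI) (rule frame_equiv_sym)
  show "transp frame_equiv"
    by (rule transpI) (rule frame_equiv_trans)
qed

quotient_type (overloaded) 'a oriented_subspace =
  "bool \<times> 'a::euclidean_space list" / partial: frame_equiv
  by (rule part_equivp_frame_equiv)

lemma frame_equiv_span_subset:
  assumes "frame_equiv (b, us) (c, vs)"
  shows "span (set vs) \<subseteq> span (set us)"
proof -
  obtain M where vs: "vs = map (\<lambda>i. \<Sum>j<length us. (M $$ (i, j)) *\<^sub>R us ! j) [0..<length us]"
    using assms unfolding frame_equiv_def split_conv by blast
  have "(\<Sum>j<length us. (M $$ (i, j)) *\<^sub>R us ! j) \<in> span (set us)" for i
    by (intro span_sum span_scale span_base) auto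
  then have "set vs \<subseteq> span (set us)"
    unfolding vs by auto
  then show ?thesis
    by (rule span_minimal) (rule subspace_span)
qed

lift_definition subspace_of :: "'a::euclidean_space oriented_subspace \<Rightarrow> 'a set"
  is "\<lambda>(b, us). span (set us)"
proof -
  fix p q :: "bool \<times> 'a list"
  assume pq: "frame_equiv p q"
  obtain b us c vs where *: "p = (b, us)" "q = (c, vs)"
    by (cases p, cases q)
  have "span (set us) = span (set vs)"
    using frame_equiv_span_subset[of b us c vs] frame_equiv_span_subset[of c vs b us]
      frame_equiv_sym[OF pq] pq unfolding * by blast
  then show "(\<lambda>(b, us). span (set us)) p = (\<lambda>(b, us). span (set us)) q"
    by (simp add: *)
qed

text \<open>The image of an oriented subspace under a linear automorphism (and the subspace
  itself for any other function).\<close>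

lift_definition oriented_image ::
  "('a::euclidean_space \<Rightarrow> 'a) \<Rightarrow> 'a oriented_subspace \<Rightarrow> 'a oriented_subspace"
  is "\<lambda>T (b, us). (b, if linear T \<and> inj T then map T us else us)"
proof -
  fix T :: "'a \<Rightarrow> 'a" and p q :: "bool \<times> 'a list"
  assume pq: "frame_equiv p q"
  obtain b us c vs where *: "p = (b, us)" "q = (c, vs)"
    by (cases p, cases q)
  have "frame_equiv (b, if linear T \<and> inj T then map T us else us)
      (c, if linear T \<and> inj T then map T vs else vs)"
  proof (cases "linear T \<and> inj T")
    case True
    then have lin: "linear T" and inj: "inj T" by auto
    obtain M where M: "distinct us" "independent (set us)" "distinct vs" "independent (set vs)"
        "M \<in> carrier_mat (length us) (length us)" "Determinant.det M \<noteq> 0"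
        "(b = c) \<longleftrightarrow> 0 < Determinant.det M"
      and vs: "vs = map (\<lambda>i. \<Sum>j<length us. (M $$ (i, j)) *\<^sub>R us ! j) [0..<length us]"
      using pq unfolding frame_equiv_def * split_conv by blast
    have "map T vs = map (\<lambda>i. \<Sum>j<length (map T us). (M $$ (i, j)) *\<^sub>R map T us ! j)
        [0..<length (map T us)]"
      unfolding vs by (simp add: linear_sum[OF lin] linear_scale[OF lin])
    moreover have "distinct (map T us)" "distinct (map T vs)"
      using M(1,3) inj_on_subset[OF inj] by (simp_all add: distinct_map)
    moreover have "independent (set (map T us))" "independent (set (map T vs))"
      using M(2,4) inj_on_subset[OF inj]
      by (simp_all add: linear_independent_injective_image[OF lin])
    ultimately have "frame_equiv (b, map T us) (c, map T vs)"
      using M(5-7) unfolding frame_equiv_def split_conv length_map by blast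
    then show ?thesis using True by simp
  next
    case False
    then show ?thesis
      using pq unfolding * by (simp only: if_False)
  qed
  then show "frame_equiv ((\<lambda>(b, us). (b, if linear T \<and> inj T then map T us else us)) p)
      ((\<lambda>(b, us). (b, if linear T \<and> inj T then map T us else us)) q)"
    by (simp add: *)
qed

definition Gr :: "nat \<Rightarrow> 'a::euclidean_space oriented_subspace set" where
  "Gr d = {U. dim (subspace_of U) = d}"

text \<open>The topology of a homogeneous space of the general linear group: the finest one for
  which all orbit maps are continuous. Each Grassmannian \<open>Gr d\<close> is open and closed.\<close>

lemma open_inj_blinfun: "open {A :: 'a::euclidean_space \<Rightarrow>\<^sub>L 'a. inj (blinfun_apply A)}"
proof (unfold open_dist, intro ballI)
  have lin: "linear (blinfun_apply A)" for A :: "'a \<Rightarrow>\<^sub>L 'a"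
    by (rule bounded_linear.linear) (rule blinfun.bounded_linear_right)
  fix A :: "'a \<Rightarrow>\<^sub>L 'a" assume "A \<in> {A. inj (blinfun_apply A)}"
  then obtain B where B: "B > 0" "\<And>x. B * norm x \<le> norm (blinfun_apply A x)"
    using linear_inj_bounded_below_pos[OF lin[of A]] by auto
  have "inj (blinfun_apply C)" if C: "dist C A < B" for C
  proof -
    have "x = 0" if "blinfun_apply C x = 0" for x
    proof (rule ccontr)
      assume "x \<noteq> 0"
      have "B * norm x \<le> norm (blinfun_apply (C - A) x)"
        using B(2)[of x] that by (simp add: blinfun.diff_left)
      also have "\<dots> \<le> norm (C - A) * norm x" by (rule norm_blinfun)
      also have "\<dots> < B * norm x"
        using C \<open>x \<noteq> 0\<close> by (simp add: dist_norm)
      finally show False by simp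
    qed
    then show ?thesis
      unfolding linear_injective_0[OF lin] by blast
  qed
  then show "\<exists>e>0. \<forall>C. dist C A < e \<longrightarrow> C \<in> {A. inj (blinfun_apply A)}"
    using B(1) by blast
qed

instantiation oriented_subspace :: (euclidean_space) topological_space
begin

definition open_oriented_subspace :: "'a oriented_subspace set \<Rightarrow> bool" where
  "open_oriented_subspace S \<longleftrightarrow>
     (\<forall>U. open {A :: 'a \<Rightarrow>\<^sub>L 'a.
        inj (blinfun_apply A) \<and> oriented_image (blinfun_apply A) U \<in> S})"

instance
proof
  show "open (UNIV :: 'a oriented_subspace set)"
    by (simp add: open_oriented_subspace_def open_inj_blinfun)
next
  fix S T :: "'a oriented_subspace set" assume "open S" "open T"
  then have "open ({A. inj (blinfun_apply A) \<and> oriented_image (blinfun_apply A) U \<in> S} \<inter>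
      {A. inj (blinfun_apply A) \<and> oriented_image (blinfun_apply A) U \<in> T})" for U
    unfolding open_oriented_subspace_def by (intro open_Int) auto
  then show "open (S \<inter> T)"
    unfolding open_oriented_subspace_def by (simp add: Collect_conj_eq Int_ac)
next
  fix K :: "'a oriented_subspace set set" assume "\<forall>S\<in>K. open S"
  then have "open (\<Union>S\<in>K. {A. inj (blinfun_apply A) \<and> oriented_image (blinfun_apply A) U \<in> S})" for U
    unfolding open_oriented_subspace_def by (intro open_UN) auto
  moreover have "{A. inj (blinfun_apply A) \<and> oriented_image (blinfun_apply A) U \<in> \<Union>K} =
      (\<Union>S\<in>K. {A. inj (blinfun_apply A) \<and> oriented_image (blinfun_apply A) U \<in> S})" for U
    by auto
  ultimately show "open (\<Union>K)"
    unfolding open_oriented_subspace_def by simp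
qed

end

subsection \<open>Function spaces\<close>

definition C0 :: "'p::topological_space set \<Rightarrow> ('p \<Rightarrow> 'b::real_normed_vector) set" where
  "C0 X = {f. continuous_on X f \<and>
     (\<forall>e>0. \<exists>K. compact K \<and> K \<subseteq> X \<and> (\<forall>p\<in>X - K. norm (f p) < e))}"

definition sup_norm :: "'p set \<Rightarrow> ('p \<Rightarrow> 'b::real_normed_vector) \<Rightarrow> real" where
  "sup_norm X f = (SUP p\<in>X. norm (f p))"

definition Deriv ::
  "('a::real_normed_vector \<Rightarrow> 'b::real_normed_vector) \<Rightarrow> 'a \<Rightarrow> 'a \<Rightarrow>\<^sub>L 'b" where
  "Deriv f x = Blinfun (frechet_derivative f (at x))"

definition C2_0 :: "('a::euclidean_space \<Rightarrow> 'a) set" where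
  "C2_0 = {f. (\<forall>x. f differentiable at x) \<and> (\<forall>x. Deriv f differentiable at x) \<and>
     f \<in> C0 UNIV \<and> Deriv f \<in> C0 UNIV \<and> Deriv (Deriv f) \<in> C0 UNIV}"

definition C2_norm :: "('a::euclidean_space \<Rightarrow> 'a) \<Rightarrow> real" where
  "C2_norm f = sup_norm UNIV f + sup_norm UNIV (Deriv f) + sup_norm UNIV (Deriv (Deriv f))"

text \<open>
  Since the orbit maps are submersions, a function \<open>f\<close> on the product of the space with the
  Grassmannian is continuously differentiable iff all its lifts \<open>(y, A) \<mapsto> f (y, A \<cdot> U)\<close> to
  the general linear group are, and by equivariance it suffices to differentiate these
  at the identity. The derivative at \<open>(x, U)\<close> is that of \<open>f\<close> composed with the surjection
  from all endomorphisms onto the tangent space of the Grassmannian at \<open>U\<close>; as the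
  orthogonal group acts transitively on each component, its norm is equivalent to the norm
  of the differential for any Riemannian metric on the compact Grassmannian.
\<close>

definition lift_GL ::
  "('a::euclidean_space \<times> 'a oriented_subspace \<Rightarrow> real) \<Rightarrow> 'a oriented_subspace \<Rightarrow>
   'a \<times> ('a \<Rightarrow>\<^sub>L 'a) \<Rightarrow> real" where
  "lift_GL f U = (\<lambda>(y, A). f (y, oriented_image (blinfun_apply A) U))"

definition Deriv_Gr ::
  "('a::euclidean_space \<times> 'a oriented_subspace \<Rightarrow> real) \<Rightarrow>
   'a \<times> 'a oriented_subspace \<Rightarrow> ('a \<times> ('a \<Rightarrow>\<^sub>L 'a)) \<Rightarrow>\<^sub>L real" where
  "Deriv_Gr f = (\<lambda>(x, U). Deriv (lift_GL f U) (x, id_blinfun))"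

definition C1_0_Gr :: "nat \<Rightarrow> ('a::euclidean_space \<times> 'a oriented_subspace \<Rightarrow> real) set" where
  "C1_0_Gr d = {f. (\<forall>x. \<forall>U\<in>Gr d. lift_GL f U differentiable at (x, id_blinfun)) \<and>
     f \<in> C0 (UNIV \<times> Gr d) \<and> Deriv_Gr f \<in> C0 (UNIV \<times> Gr d)}"

definition C1_norm_Gr ::
  "nat \<Rightarrow> ('a::euclidean_space \<times> 'a oriented_subspace \<Rightarrow> real) \<Rightarrow> real" where
  "C1_norm_Gr d f = sup_norm (UNIV \<times> Gr d) f + sup_norm (UNIV \<times> Gr d) (Deriv_Gr f)"

text \<open>A Hilbert space of functions on \<open>X\<close> is given by a Hilbert space type together with a
  map \<open>e\<close> that assigns to each vector the function it stands for.\<close>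

definition function_space ::
  "'p set \<Rightarrow> ('h::real_vector \<Rightarrow> 'p \<Rightarrow> 'b::real_vector) \<Rightarrow> bool" where
  "function_space X e \<longleftrightarrow>
     (\<forall>p\<in>X. linear (\<lambda>h. e h p)) \<and> (\<forall>h h'. (\<forall>p\<in>X. e h p = e h' p) \<longrightarrow> h = h')"

definition continuously_embedded ::
  "('h::real_normed_vector \<Rightarrow> 'f) \<Rightarrow> 'f set \<Rightarrow> ('f \<Rightarrow> real) \<Rightarrow> bool" where
  "continuously_embedded e F N \<longleftrightarrow> range e \<subseteq> F \<and> (\<exists>C. \<forall>h. N (e h) \<le> C * norm h)"

definition pos_def_kernel :: "'p set \<Rightarrow> ('p \<Rightarrow> 'p \<Rightarrow> real) \<Rightarrow> bool" where
  "pos_def_kernel X k \<longleftrightarrow> (\<forall>p\<in>X. \<forall>q\<in>X. k p q = k q p) \<and>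
     (\<forall>S c. finite S \<and> S \<subseteq> X \<longrightarrow> 0 \<le> (\<Sum>p\<in>S. \<Sum>q\<in>S. c p * c q * k p q))"

definition tensor_kernel ::
  "('p \<Rightarrow> 'p \<Rightarrow> real) \<Rightarrow> ('q \<Rightarrow> 'q \<Rightarrow> real) \<Rightarrow> 'p \<times> 'q \<Rightarrow> 'p \<times> 'q \<Rightarrow> real" where
  "tensor_kernel k l = (\<lambda>(x, U) (x', U'). k x x' * l U U')"

definition is_rkhs ::
  "'p set \<Rightarrow> ('p \<Rightarrow> 'p \<Rightarrow> real) \<Rightarrow> ('w::{real_inner, complete_space} \<Rightarrow> 'p \<Rightarrow> real) \<Rightarrow> bool" where
  "is_rkhs X k e \<longleftrightarrow> function_space X e \<and>
     (\<forall>p\<in>X. \<exists>\<kappa>. (\<forall>q\<in>X. e \<kappa> q = k p q) \<and> (\<forall>w. inner w \<kappa> = e w p))"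

text \<open>Square integrable paths in the sense of Bochner, for values in a space \<open>S\<close> with
  (semi)norm \<open>N\<close>. Paths, like the elements of \<open>L2_space\<close>, are functions and not classes
  of functions modulo null sets.\<close>

definition bochner_L2 :: "'b::minus set \<Rightarrow> ('b \<Rightarrow> real) \<Rightarrow> (real \<Rightarrow> 'b) set" where
  "bochner_L2 S N = {f. (\<forall>t\<in>{0..1}. f t \<in> S) \<and>
     (\<exists>s. (\<forall>k. simple_function (lebesgue_on {0..1}) (s k) \<and> s k ` {0..1} \<subseteq> S) \<and>
          (AE t in lebesgue_on {0..1}. (\<lambda>k. N (s k t - f t)) \<longlonglongrightarrow> 0)) \<and>
     integrable (lebesgue_on {0..1}) (\<lambda>t. (N (f t))\<^sup>2)}"

definition L2_space :: "'p measure \<Rightarrow> ('p \<Rightarrow> real) set" where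
  "L2_space M = {f. f \<in> borel_measurable M \<and> integrable M (\<lambda>x. (f x)\<^sup>2)}"

definition L2_norm :: "'p measure \<Rightarrow> ('p \<Rightarrow> real) \<Rightarrow> real" where
  "L2_norm M f = sqrt (LINT x|M. (f x)\<^sup>2)"

subsection \<open>Varifolds\<close>

definition varifold_space :: "nat \<Rightarrow> ('a::euclidean_space \<times> 'a oriented_subspace) measure" where
  "varifold_space d = restrict_space borel (UNIV \<times> Gr d)"

definition varifolds :: "nat \<Rightarrow> ('a::euclidean_space \<times> 'a oriented_subspace) measure set" where
  "varifolds d = {M. sets M = sets (varifold_space d) \<and> finite_measure M \<and>
     (\<forall>A\<in>sets M. emeasure M A = (SUP K\<in>{K. compact K \<and> K \<subseteq> A}. emeasure M K))}"

text \<open>The sum of the Dirac measures at \<open>(x i, U i)\<close>, \<open>i < N\<close>, with weights \<open>r i\<close>, as the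
  image of the weighted counting measure on the indices.\<close>

definition discrete_varifold ::
  "nat \<Rightarrow> nat \<Rightarrow> (nat \<Rightarrow> real) \<Rightarrow> (nat \<Rightarrow> 'a) \<Rightarrow> (nat \<Rightarrow> 'a oriented_subspace) \<Rightarrow>
   ('a::euclidean_space \<times> 'a oriented_subspace) measure" where
  "discrete_varifold d N r x U =
     distr (point_measure {..<N} (\<lambda>i. ennreal (r i))) (varifold_space d) (\<lambda>i. (x i, U i))"

definition weight :: "('a::euclidean_space \<times> 'a oriented_subspace) measure \<Rightarrow> 'a measure" where
  "weight M = distr M borel fst"

definition msupp :: "'a::topological_space measure \<Rightarrow> 'a set" where
  "msupp M = {x. \<forall>S. open S \<and> x \<in> S \<longrightarrow> emeasure M S > 0}"

definition orthonormal_frame :: "'a::euclidean_space oriented_subspace \<Rightarrow> 'a list \<Rightarrow> bool" where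
  "orthonormal_frame U us \<longleftrightarrow> span (set us) = subspace_of U \<and>
     (\<forall>i<length us. \<forall>j<length us. inner (us ! i) (us ! j) = (if i = j then 1 else 0))"

definition jac :: "('a::euclidean_space \<Rightarrow> 'a) \<Rightarrow> 'a \<Rightarrow> 'a oriented_subspace \<Rightarrow> real" where
  "jac \<phi> x U = (let us = (SOME us. orthonormal_frame U us); T = frechet_derivative \<phi> (at x) in
     sqrt (Determinant.det (mat (length us) (length us) (\<lambda>(i, j). inner (T (us ! i)) (T (us ! j))))))"

definition pushforward ::
  "('a::euclidean_space \<Rightarrow> 'a) \<Rightarrow> ('a \<times> 'a oriented_subspace) measure \<Rightarrow>
   ('a \<times> 'a oriented_subspace) measure" where
  "pushforward \<phi> M = distr (density M (\<lambda>(x, U). ennreal (jac \<phi> x U))) M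
     (\<lambda>(x, U). (\<phi> x, oriented_image (frechet_derivative \<phi> (at x)) U))"

definition reweight ::
  "('a::euclidean_space \<Rightarrow> real) \<Rightarrow> ('a \<times> 'a oriented_subspace) measure \<Rightarrow>
   ('a \<times> 'a oriented_subspace) measure" where
  "reweight \<beta> M = density M (\<lambda>(x, U). ennreal (\<beta> x))"

definition dual_dist ::
  "('w::real_normed_vector \<Rightarrow> 'p \<Rightarrow> real) \<Rightarrow> 'p measure \<Rightarrow> 'p measure \<Rightarrow> real" where
  "dual_dist e M M' = (SUP w\<in>{w. norm w \<le> 1}. (LINT p|M. e w p) - (LINT p|M'. e w p))"

subsection \<open>The relaxed problem\<close>

text \<open>The flow equation of a vector field that is merely square integrable in time is
  understood in the sense of Caratheodory, that is, in integrated form.\<close>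

definition integral_curve ::
  "(real \<Rightarrow> 'a::euclidean_space \<Rightarrow> 'a) \<Rightarrow> 'a \<Rightarrow> (real \<Rightarrow> 'a) \<Rightarrow> bool" where
  "integral_curve u x c \<longleftrightarrow> continuous_on {0..1} c \<and>
     integrable (lebesgue_on {0..1}) (\<lambda>s. u s (c s)) \<and>
     (\<forall>t\<in>{0..1}. c t = x + (LINT s|lebesgue_on {0..t}. u s (c s)))"

definition flow :: "(real \<Rightarrow> 'a::euclidean_space \<Rightarrow> 'a) \<Rightarrow> real \<Rightarrow> 'a \<Rightarrow> 'a" where
  "flow u t x = (SOME c. integral_curve u x c) t"

text \<open>Outside the support of \<open>m\<close> the factor is irrelevant, and set to one.\<close>

definition weight_factor ::
  "'a::euclidean_space measure \<Rightarrow> (real \<Rightarrow> 'a \<Rightarrow> real) \<Rightarrow> real \<Rightarrow> 'a \<Rightarrow> real" where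
  "weight_factor m \<eta> t x =
     (if x \<in> msupp m then 1 + 1 / 2 * (LINT s|lebesgue_on {0..t}. \<eta> s x) else 1)"

definition relaxed_energy ::
  "('v::real_normed_vector \<Rightarrow> 'a::euclidean_space \<Rightarrow> 'a) \<Rightarrow>
   ('w::real_normed_vector \<Rightarrow> 'a \<times> 'a oriented_subspace \<Rightarrow> real) \<Rightarrow> real \<Rightarrow> real \<Rightarrow>
   ('a \<times> 'a oriented_subspace) measure \<Rightarrow> ('a \<times> 'a oriented_subspace) measure \<Rightarrow>
   (real \<Rightarrow> 'v) \<Rightarrow> (real \<Rightarrow> 'a \<Rightarrow> real) \<Rightarrow> real" where
  "relaxed_energy eV eW \<gamma> \<Lambda> \<mu> \<mu>tar v \<eta> =
     (let \<phi> = flow (\<lambda>t. eV (v t)) in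
      1 / 2 * (LINT t|lebesgue_on {0..1}. (norm (v t))\<^sup>2) +
      \<gamma> / 2 * (LINT t|lebesgue_on {0..1}. LINT p|\<mu>. (\<eta> t (fst p))\<^sup>2 * jac (\<phi> t) (fst p) (snd p)) +
      \<Lambda> / 2 * (dual_dist eW
        (reweight (\<lambda>y. (weight_factor (weight \<mu>) \<eta> 1 (inv_into UNIV (\<phi> 1) y))\<^sup>2) (pushforward (\<phi> 1) \<mu>))
        \<mu>tar)\<^sup>2)"

end

theory Submission
  imports Defs "HOL-Complex_Analysis.Great_Picard"
begin

text \<open>
  For given \<open>v\<close> the energy depends on \<open>\<eta>\<close> only through the growth cost and the integrals
  \<open>a p = \<integral> \<eta> t p dt\<close> at the finitely many points \<open>p\<close> of the support. By Cauchy--Schwarz the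
  cheapest \<open>\<eta>\<close> with prescribed \<open>a\<close> is proportional in time to the reciprocal of the Jacobian,
  which eliminates \<open>\<eta>\<close> and leaves a functional of \<open>v\<close> and the finite vector \<open>a\<close>. Along a
  minimizing sequence the trajectories of the support points and the derivatives of the flow
  there are uniformly Hoelder continuous and converge uniformly by Arzela--Ascoli, while convex
  combinations of the vector fields converge strongly (Mazur). The flow equation and its
  linearization along the limiting curves are linear in \<open>v\<close>, so the strong limit generates
  exactly these curves, and its energy does not exceed the limit of the energies. As all
  remaining terms are continuous, or suprema of continuous functions, of these finitely many
  quantities, the limit is a minimizer.
\<close>

subsection \<open>Gronwall inequalities with a square integrable rate\<close>

text \<open>The fields are only square integrable in time: there is no bound uniform in time, and an
  energy bound controls them only weakly. The curves are better, since Cauchy--Schwarz turns an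
  energy bound into Hoelder exponent 1/2. The product of weakly and uniformly convergent factors in
  \<open>eV (v s) (c s)\<close> is handled by freezing the curve: with the limit curve inserted, the
  integral is a bounded linear functional of the field, and the error of the replacement is at most
  the distance of the curves times the Lipschitz constant \<open>C * norm (v s)\<close>. The second
  derivative in the embedding enters as the Lipschitz constant of \<open>Deriv (eV h)\<close>, both
  for differentiating the flow and for the same freezing step in the linearized equation. Growth is
  a function of the point and not of the subspace, so indices with the same point share one value of
  \<eta>. The Jacobian in the elimination is therefore the weighted sum over all subspaces attached
  to the point, and one real number for each point replaces \<eta>. An energy bound keeps these
  Jacobians away from zero, which keeps the numbers bounded.\<close>

text \<open>The right-hand side of the hypothesis times the integrating factor
  \<open>exp (- (B * t))\<close> is nonincreasing: the hypothesis says precisely that its derivative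
  is nonpositive.\<close>

lemma gronwall_forward:
  fixes f :: "real \<Rightarrow> real"
  assumes f: "continuous_on {0..T} f" and B: "0 \<le> B"
    and le: "\<And>t. t \<in> {0..T} \<Longrightarrow> f t \<le> A + B * integral {0..t} f"
    and t: "t \<in> {0..T}"
  shows "f t \<le> A * exp (B * t)"
proof -
  define h where "h s = exp (- (B * s)) * (A + B * integral {0..s} f)" for s
  have cF: "continuous_on {0..T} (\<lambda>s. integral {0..s} f)"
    by (rule indefinite_integral_continuous_1[OF integrable_continuous_real[OF f]])
  have "h t \<le> h 0"
  proof (rule DERIV_nonpos_imp_decreasing_open[where f = h and a = 0 and b = t])
    show "0 \<le> t" using t by simp
    show "continuous_on {0..t} h"
      unfolding h_def using t
      by (intro continuous_intros continuous_on_subset[OF cF]) auto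
    fix s assume s: "0 < s" "s < t"
    have "((\<lambda>s. integral {0..s} f) has_real_derivative f s) (at s within {0..T})"
      using s t by (intro integral_has_real_derivative f) auto
    then have D: "((\<lambda>s. integral {0..s} f) has_real_derivative f s) (at s)"
      using s t at_within_interior[of s "{0..T}"] by auto
    have "(h has_real_derivative
        exp (- (B * s)) * (B * f s) + exp (- (B * s)) * (- B) * (A + B * integral {0..s} f)) (at s)"
      unfolding h_def by (auto intro!: derivative_eq_intros D)
    moreover have "exp (- (B * s)) * (B * f s) + exp (- (B * s)) * (- B) * (A + B * integral {0..s} f)
      = - (exp (- (B * s)) * B * (A + B * integral {0..s} f - f s))"
      by (simp add: algebra_simps)
    moreover have "0 \<le> exp (- (B * s)) * B * (A + B * integral {0..s} f - f s)"
      using le[of s] s t B by (intro mult_nonneg_nonneg) auto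
    ultimately show "\<exists>y. (h has_real_derivative y) (at s) \<and> y \<le> 0"
      by (metis neg_le_0_iff_le)
  qed
  then have "exp (- (B * t)) * (A + B * integral {0..t} f) \<le> A"
    by (simp add: h_def)
  then have "A + B * integral {0..t} f \<le> A * exp (B * t)"
    by (simp add: exp_minus field_simps)
  with le[OF t] show ?thesis by linarith
qed

text \<open>Time reversed: the integrating factor is \<open>exp (B * s)\<close> and the product is
  nondecreasing. Bounding an initial value by a terminal one yields injectivity of the flow and of
  its derivative.\<close>

lemma gronwall_backward:
  fixes f :: "real \<Rightarrow> real"
  assumes f: "continuous_on {0..T} f" and B: "0 \<le> B" and T: "0 \<le> T"
    and le: "\<And>s. s \<in> {0..T} \<Longrightarrow> f s \<le> A + B * integral {s..T} f"
  shows "f 0 \<le> A * exp (B * T)"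
proof -
  define h where "h s = exp (B * s) * (A + B * (integral {0..T} f - integral {0..s} f))" for s
  have cF: "continuous_on {0..T} (\<lambda>s. integral {0..s} f)"
    by (rule indefinite_integral_continuous_1[OF integrable_continuous_real[OF f]])
  have comb: "integral {s..T} f = integral {0..T} f - integral {0..s} f" if "s \<in> {0..T}" for s
    using that Henstock_Kurzweil_Integration.integral_combine[of 0 s T f]
      integrable_continuous_real[OF f] by auto
  have "h 0 \<le> h T"
  proof (rule DERIV_nonneg_imp_increasing_open[OF T])
    show "continuous_on {0..T} h"
      unfolding h_def by (intro continuous_intros cF)
    fix s assume s: "0 < s" "s < T"
    have "((\<lambda>s. integral {0..s} f) has_real_derivative f s) (at s within {0..T})"
      using s by (intro integral_has_real_derivative f) auto
    then have D: "((\<lambda>s. integral {0..s} f) has_real_derivative f s) (at s)"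
      using s at_within_interior[of s "{0..T}"] by auto
    have "(h has_real_derivative
        exp (B * s) * (B * (- f s)) + exp (B * s) * B * (A + B * (integral {0..T} f - integral {0..s} f))) (at s)"
      unfolding h_def by (auto intro!: derivative_eq_intros D)
    moreover have "exp (B * s) * (B * (- f s)) + exp (B * s) * B * (A + B * (integral {0..T} f - integral {0..s} f))
      = exp (B * s) * B * (A + B * integral {s..T} f - f s)"
      using comb[of s] s by (simp add: right_diff_distrib ring_distribs)
    moreover have "0 \<le> exp (B * s) * B * (A + B * integral {s..T} f - f s)"
      using le[of s] s B by (intro mult_nonneg_nonneg) auto
    ultimately show "\<exists>y. (h has_real_derivative y) (at s) \<and> y \<ge> 0"
      by metis
  qed
  then have "A + B * integral {0..T} f \<le> A * exp (B * T)"
    by (simp add: h_def mult.commute)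
  with le[of 0] T show ?thesis by auto
qed

section \<open>Cauchy--Schwarz and square integrable rates\<close>

lemma quadratic_nonneg_imp_discriminant:
  fixes a b c :: real
  assumes "\<And>t. 0 \<le> a * t\<^sup>2 + 2 * b * t + c"
  shows "b\<^sup>2 \<le> a * c"
proof (cases "a = 0")
  case True
  have "b = 0"
  proof (rule ccontr)
    assume "b \<noteq> 0"
    \<comment> \<open>At this point the affine polynomial has the value -1.\<close>
    then show False using assms[of "- (c + 1) / (2 * b)"] True by simp
  qed
  then show ?thesis using True by simp
next
  case False
  have "a > 0"
  proof (rule ccontr)
    assume "\<not> a > 0"
    then have a: "a < 0" using False by simp
    \<comment> \<open>Large enough for the negative leading term to beat the other two.\<close>
    define t where "t = 1 + (2*\<bar>b\<bar> + \<bar>c\<bar> + 1) / \<bar>a\<bar>"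
    have t: "t \<ge> 1" "\<bar>a\<bar> * t \<ge> 2*\<bar>b\<bar> + \<bar>c\<bar> + 1"
      using a by (auto simp: t_def field_simps)
    have "a * t\<^sup>2 = - (\<bar>a\<bar> * t) * t" using a by (simp add: power2_eq_square)
    also have "\<dots> \<le> - (2*\<bar>b\<bar> + \<bar>c\<bar> + 1) * t"
      using t mult_right_mono[OF t(2), of t] by (simp only: mult_minus_left neg_le_iff_le)
    finally have 1: "a * t\<^sup>2 \<le> - (2*\<bar>b\<bar>*t) - \<bar>c\<bar>*t - t" by (simp add: algebra_simps)
    have "2*b*t \<le> 2*\<bar>b\<bar>*t" "c \<le> \<bar>c\<bar>*t" 
      using t mult_left_mono[OF t(1), of "\<bar>c\<bar>"] by (auto intro!: mult_right_mono)
    with 1 assms[of t] t show False by linarith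
  qed
  \<comment> \<open>For a positive leading coefficient, \<open>- b / a\<close> is the vertex of the
    parabola.\<close>
  then show ?thesis
    using assms[of "- b / a"] by (simp add: field_simps power2_eq_square)
qed

text \<open>The product is dominated by the sum of the squares. The inequality is the discriminant
  condition for the quadratic polynomial \<open>LINT x|M. (f x * t + g x)\<^sup>2\<close> in
  \<open>t\<close>.\<close>

lemma
  fixes f g :: "'x \<Rightarrow> real"
  assumes f: "f \<in> borel_measurable M" "integrable M (\<lambda>x. (f x)\<^sup>2)"
    and g: "g \<in> borel_measurable M" "integrable M (\<lambda>x. (g x)\<^sup>2)"
  shows integrable_mult_square: "integrable M (\<lambda>x. f x * g x)"
    and cauchy_schwarz_integral:
      "(LINT x|M. f x * g x)\<^sup>2 \<le> (LINT x|M. (f x)\<^sup>2) * (LINT x|M. (g x)\<^sup>2)"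
proof -
  show i: "integrable M (\<lambda>x. f x * g x)"
  proof (rule Bochner_Integration.integrable_bound)
    show "integrable M (\<lambda>x. (f x)\<^sup>2 + (g x)\<^sup>2)" using f g by simp
    show "AE x in M. norm (f x * g x) \<le> norm ((f x)\<^sup>2 + (g x)\<^sup>2)"
    proof (rule AE_I2)
      fix x
      have "0 \<le> (\<bar>f x\<bar> - \<bar>g x\<bar>)\<^sup>2" by simp
      then have "2 * (\<bar>f x\<bar> * \<bar>g x\<bar>) \<le> (f x)\<^sup>2 + (g x)\<^sup>2"
        by (simp add: power2_diff)
      moreover have "0 \<le> \<bar>f x\<bar> * \<bar>g x\<bar>" by simp
      ultimately show "norm (f x * g x) \<le> norm ((f x)\<^sup>2 + (g x)\<^sup>2)"
        unfolding real_norm_def abs_mult by linarith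
    qed
  qed (use f g in measurable)
  have "0 \<le> (LINT x|M. (f x)\<^sup>2) * t\<^sup>2 + 2 * (LINT x|M. f x * g x) * t + (LINT x|M. (g x)\<^sup>2)" for t
  proof -
    have "0 \<le> (LINT x|M. (f x * t + g x)\<^sup>2)" by simp
    also have "(\<lambda>x. (f x * t + g x)\<^sup>2) = (\<lambda>x. (f x)\<^sup>2 * t\<^sup>2 + f x * g x * (2 * t) + (g x)\<^sup>2)"
      by (auto simp: power2_eq_square algebra_simps)
    also have "(LINT x|M. (f x)\<^sup>2 * t\<^sup>2 + f x * g x * (2 * t) + (g x)\<^sup>2) =
       (LINT x|M. (f x)\<^sup>2) * t\<^sup>2 + (LINT x|M. f x * g x) * (2 * t) + (LINT x|M. (g x)\<^sup>2)"
      using f(2) g(2) i by simp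
    finally show ?thesis by (simp add: ac_simps)
  qed
  then show "(LINT x|M. f x * g x)\<^sup>2 \<le> (LINT x|M. (f x)\<^sup>2) * (LINT x|M. (g x)\<^sup>2)"
    by (rule quadratic_nonneg_imp_discriminant)
qed

text \<open>A time-dependent Lipschitz constant. The bound \<open>K\<close> on its squared L2 norm
  is kept separate, so that all later constants depend on \<open>K\<close> alone and are uniform
  over fields of bounded energy.\<close>

definition rate :: "(real \<Rightarrow> real) \<Rightarrow> real \<Rightarrow> bool" where
  "rate a K \<longleftrightarrow> a \<in> borel_measurable (lebesgue_on {0..1}) \<and> (\<forall>t. 0 \<le> a t) \<and>
     integrable (lebesgue_on {0..1}) (\<lambda>t. (a t)\<^sup>2) \<and> (LINT t|lebesgue_on {0..1}. (a t)\<^sup>2) \<le> K"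

lemma integrable_sub01:
  fixes f :: "real \<Rightarrow> 'b::euclidean_space"
  assumes "integrable (lebesgue_on {0..1}) f" "0 \<le> s" "t \<le> 1"
  shows "integrable (lebesgue_on {s..t}) f"
  by (rule integrable_subinterval[OF assms(1)]) (use assms in auto)

lemma measurable_sub01:
  fixes f :: "real \<Rightarrow> 'b::real_normed_vector"
  assumes "f \<in> borel_measurable (lebesgue_on {0..1})" "0 \<le> s" "t \<le> 1"
  shows "f \<in> borel_measurable (lebesgue_on {s..t})"
  by (rule measurable_restrict_mono[OF assms(1)]) (use assms in auto)

lemma continuous_measurable_lebesgue_on:
  fixes f :: "real \<Rightarrow> 'b::topological_space"
  assumes "continuous_on {s..t} f"
  shows "f \<in> borel_measurable (lebesgue_on {s..t})"
proof (rule measurableI)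
  fix B :: "'b set" assume "B \<in> sets borel"
  then have "f -` B \<inter> space (restrict_space borel {s..t}) \<in> sets (restrict_space borel {s..t})"
    by (rule measurable_sets[OF borel_measurable_continuous_on_restrict[OF assms]])
  then show "f -` B \<inter> space (lebesgue_on {s..t}) \<in> sets (lebesgue_on {s..t})"
    by (auto simp: sets_restrict_space)
qed simp

lemma rate_square_le:
  assumes "rate a K" "0 \<le> s" "s \<le> t" "t \<le> 1"
  shows "(LINT r|lebesgue_on {s..t}. (a r)\<^sup>2) \<le> K"
proof -
  have i: "integrable (lebesgue_on {0..1}) (\<lambda>t. (a t)\<^sup>2)" and K: "(LINT t|lebesgue_on {0..1}. (a t)\<^sup>2) \<le> K"
    using assms by (auto simp: rate_def)
  have "(LINT r|lebesgue_on {s..t}. (a r)\<^sup>2) = integral {s..t} (\<lambda>r. (a r)\<^sup>2)"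
    by (rule lebesgue_integral_eq_integral) (use integrable_sub01[OF i] assms in auto)
  also have "\<dots> \<le> integral {0..1} (\<lambda>r. (a r)\<^sup>2)"
    using integrable_on_lebesgue_on[OF i] integrable_on_lebesgue_on[OF integrable_sub01[OF i]] assms
    by (intro integral_subset_le) auto
  also have "\<dots> = (LINT t|lebesgue_on {0..1}. (a t)\<^sup>2)"
    by (rule lebesgue_integral_eq_integral[symmetric]) (use i in auto)
  finally show ?thesis using K by simp
qed

lemma rate_mult_le:
  fixes e :: "real \<Rightarrow> real"
  assumes a: "rate a K" and e: "continuous_on {0..1} e" and st: "0 \<le> s" "s \<le> t" "t \<le> 1"
  shows "integrable (lebesgue_on {s..t}) (\<lambda>r. a r * e r)"
    and "(LINT r|lebesgue_on {s..t}. a r * e r)\<^sup>2 \<le> K * integral {s..t} (\<lambda>r. (e r)\<^sup>2)"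
proof -
  have a2: "integrable (lebesgue_on {s..t}) (\<lambda>t. (a t)\<^sup>2)" 
    using assms by (auto simp: rate_def intro: integrable_sub01)
  have am: "a \<in> borel_measurable (lebesgue_on {s..t})"
    using assms by (auto simp: rate_def intro: measurable_sub01)
  have ce: "continuous_on {s..t} e" using e st by (auto intro: continuous_on_subset)
  have em: "e \<in> borel_measurable (lebesgue_on {s..t})"
    by (rule continuous_measurable_lebesgue_on[OF ce])
  have e2: "integrable (lebesgue_on {s..t}) (\<lambda>r. (e r)\<^sup>2)"
    by (intro continuous_imp_integrable_real continuous_intros ce)
  show "integrable (lebesgue_on {s..t}) (\<lambda>r. a r * e r)"
    by (rule integrable_mult_square[OF am a2 em e2])
  have "(LINT r|lebesgue_on {s..t}. a r * e r)\<^sup>2 \<le>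
     (LINT r|lebesgue_on {s..t}. (a r)\<^sup>2) * (LINT r|lebesgue_on {s..t}. (e r)\<^sup>2)"
    by (rule cauchy_schwarz_integral[OF am a2 em e2])
  also have "\<dots> \<le> K * (LINT r|lebesgue_on {s..t}. (e r)\<^sup>2)"
    by (intro mult_right_mono rate_square_le[OF a st]) simp
  also have "(LINT r|lebesgue_on {s..t}. (e r)\<^sup>2) = integral {s..t} (\<lambda>r. (e r)\<^sup>2)"
    by (rule lebesgue_integral_eq_integral) (use e2 in auto)
  finally show "(LINT r|lebesgue_on {s..t}. a r * e r)\<^sup>2 \<le> K * integral {s..t} (\<lambda>r. (e r)\<^sup>2)" .
qed

lemma rate_nonneg: "rate a K \<Longrightarrow> 0 \<le> K"
  unfolding rate_def by (meson Bochner_Integration.integral_nonneg order_trans zero_le_power2)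

lemma power2_le_two_sum:
  fixes x y z :: real
  assumes "0 \<le> x" "x \<le> y + z"
  shows "x\<^sup>2 \<le> 2 * y\<^sup>2 + 2 * z\<^sup>2"
proof -
  have "x\<^sup>2 \<le> (y + z)\<^sup>2" using assms by (intro power_mono) auto
  also have "\<dots> \<le> 2 * y\<^sup>2 + 2 * z\<^sup>2"
    using sum_squares_bound[of y z] by (simp add: power2_sum)
  finally show ?thesis .
qed

text \<open>Squaring and Cauchy--Schwarz replace the rate \<open>a\<close>, which is merely square integrable, by
  the constant \<open>2 * K\<close>, so that the classical inequality applies.\<close>

lemma gronwall_rate:
  fixes e :: "real \<Rightarrow> 'b::real_normed_vector"
  assumes a: "rate a K" and e: "continuous_on {0..1} e"
    and le: "\<And>t. t \<in> {0..1} \<Longrightarrow> norm (e t) \<le> g + (LINT r|lebesgue_on {0..t}. a r * norm (e r))"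
    and t: "t \<in> {0..1}"
  shows "(norm (e t))\<^sup>2 \<le> 2 * g\<^sup>2 * exp (2 * K)"
proof -
  have ne: "continuous_on {0..1} (\<lambda>r. norm (e r))" by (intro continuous_intros e)
  have "(norm (e t))\<^sup>2 \<le> 2 * g\<^sup>2 * exp (2 * K * t)"
  proof (rule gronwall_forward[OF _ _ _ t])
    show "continuous_on {0..1} (\<lambda>r. (norm (e r))\<^sup>2)" by (intro continuous_intros e)
    show "0 \<le> 2 * K" using rate_nonneg[OF a] by simp
    fix s :: real assume s: "s \<in> {0..1}"
    show "(norm (e s))\<^sup>2 \<le> 2 * g\<^sup>2 + 2 * K * integral {0..s} (\<lambda>r. (norm (e r))\<^sup>2)"
      using power2_le_two_sum[OF norm_ge_zero le[OF s]] rate_mult_le(2)[OF a ne, of 0 s] s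
      by simp
  qed
  also have "\<dots> \<le> 2 * g\<^sup>2 * exp (2 * K)"
    using t rate_nonneg[OF a] by (intro mult_left_mono) (auto intro!: mult_left_le)
  finally show ?thesis .
qed

lemma gronwall_rate_backward:
  fixes e :: "real \<Rightarrow> 'b::real_normed_vector"
  assumes a: "rate a K" and e: "continuous_on {0..1} e" and t: "t \<in> {0..1}"
    and le: "\<And>s. s \<in> {0..t} \<Longrightarrow> norm (e s) \<le> g + (LINT r|lebesgue_on {s..t}. a r * norm (e r))"
  shows "(norm (e 0))\<^sup>2 \<le> 2 * g\<^sup>2 * exp (2 * K)"
proof -
  have ne: "continuous_on {0..1} (\<lambda>r. norm (e r))" by (intro continuous_intros e)
  have "(norm (e 0))\<^sup>2 \<le> 2 * g\<^sup>2 * exp (2 * K * t)"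
  proof (rule gronwall_backward)
    show "continuous_on {0..t} (\<lambda>r. (norm (e r))\<^sup>2)"
      using t by (intro continuous_intros continuous_on_subset[OF e]) auto
    show "0 \<le> 2 * K" "0 \<le> t" using rate_nonneg[OF a] t by auto
    fix s :: real assume s: "s \<in> {0..t}"
    show "(norm (e s))\<^sup>2 \<le> 2 * g\<^sup>2 + 2 * K * integral {s..t} (\<lambda>r. (norm (e r))\<^sup>2)"
      using power2_le_two_sum[OF norm_ge_zero le[OF s]] rate_mult_le(2)[OF a ne, of s t] s t
      by simp
  qed
  also have "\<dots> \<le> 2 * g\<^sup>2 * exp (2 * K)"
    using t rate_nonneg[OF a] by (intro mult_left_mono) (auto intro!: mult_left_le)
  finally show ?thesis .
qed

subsection \<open>Caratheodory differential equations\<close>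

text \<open>Measurability is demanded directly along continuous curves, as only such compositions
  are ever integrated. One function \<open>a\<close> bounds both the Lipschitz constant and the
  value at 0, which gives linear growth \<open>a s * (1 + norm y)\<close>.\<close>

definition caratheodory :: "(real \<Rightarrow> 'a::euclidean_space \<Rightarrow> 'a) \<Rightarrow> (real \<Rightarrow> real) \<Rightarrow> bool" where
  "caratheodory F a \<longleftrightarrow>
     (\<forall>c. continuous_on {0..1} c \<longrightarrow> (\<lambda>s. F s (c s)) \<in> borel_measurable (lebesgue_on {0..1})) \<and>
     (\<forall>s\<in>{0..1}. \<forall>y z. norm (F s y - F s z) \<le> a s * norm (y - z)) \<and>
     (\<forall>s\<in>{0..1}. norm (F s 0) \<le> a s)"

lemma rate_integrable:
  assumes "rate a K" "0 \<le> s" "s \<le> t" "t \<le> 1"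
  shows "integrable (lebesgue_on {s..t}) a" "(LINT r|lebesgue_on {s..t}. a r)\<^sup>2 \<le> K * (t - s)"
  using rate_mult_le[OF assms(1), of "\<lambda>_. 1" s t] assms by auto

lemma norm_LINT_le:
  fixes f :: "real \<Rightarrow> 'b::euclidean_space"
  assumes "integrable (lebesgue_on {s..t}) g" "f \<in> borel_measurable (lebesgue_on {s..t})"
    and "\<And>r. r \<in> {s..t} \<Longrightarrow> norm (f r) \<le> g r"
  shows "integrable (lebesgue_on {s..t}) f"
    and "norm (LINT r|lebesgue_on {s..t}. f r) \<le> (LINT r|lebesgue_on {s..t}. g r)"
proof -
  show f: "integrable (lebesgue_on {s..t}) f"
    by (rule Bochner_Integration.integrable_bound[OF assms(1,2)]) (use assms(3) in fastforce)
  have "norm (LINT r|lebesgue_on {s..t}. f r) \<le> (LINT r|lebesgue_on {s..t}. norm (f r))"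
    by simp
  also have "\<dots> \<le> (LINT r|lebesgue_on {s..t}. g r)"
    by (rule Bochner_Integration.integral_mono) (use f assms in auto)
  finally show "norm (LINT r|lebesgue_on {s..t}. f r) \<le> (LINT r|lebesgue_on {s..t}. g r)" .
qed

lemma caratheodory_integrable:
  assumes a: "rate a K" and F: "caratheodory F a" and c: "continuous_on {0..1} c"
  shows "integrable (lebesgue_on {0..1}) (\<lambda>s. F s (c s))"
proof (rule norm_LINT_le(1))
  show "integrable (lebesgue_on {0..1}) (\<lambda>s. a s * (1 + norm (c s)))"
    using rate_mult_le(1)[OF a, of "\<lambda>s. 1 + norm (c s)" 0 1] c by (simp add: continuous_intros)
  show "(\<lambda>s. F s (c s)) \<in> borel_measurable (lebesgue_on {0..1})"
    using F c by (auto simp: caratheodory_def)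
  fix r :: real assume r: "r \<in> {0..1}"
  have "norm (F r (c r)) \<le> norm (F r (c r) - F r 0) + norm (F r 0)"
    by (metis add.commute diff_add_cancel norm_triangle_ineq)
  also have "\<dots> \<le> a r * norm (c r) + a r"
  proof (rule add_mono)
    show "norm (F r (c r) - F r 0) \<le> a r * norm (c r)"
      using F r unfolding caratheodory_def by (metis diff_zero)
    show "norm (F r 0) \<le> a r" using F r unfolding caratheodory_def by blast
  qed
  finally show "norm (F r (c r)) \<le> a r * (1 + norm (c r))" by (simp add: algebra_simps)
qed

lemma integral_curve_diff:
  assumes c: "integral_curve F x c" and st: "0 \<le> s" "s \<le> t" "t \<le> 1"
  shows "c t - c s = (LINT r|lebesgue_on {s..t}. F r (c r))"
proof -
  have "integrable (lebesgue_on {0..1}) (\<lambda>s. F s (c s))" using c by (simp add: integral_curve_def)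
  then have "integrable (lebesgue_on {0..t}) (\<lambda>s. F s (c s))"
    using st by (auto intro: integrable_sub01)
  then have "(LINT r|lebesgue_on {0..t}. F r (c r)) =
     (LINT r|lebesgue_on {0..s}. F r (c r)) + (LINT r|lebesgue_on {s..t}. F r (c r))"
    by (rule Equivalence_Measurable_On_Borel.integral_combine) (use st in auto)
  moreover have "c t = x + (LINT r|lebesgue_on {0..t}. F r (c r))"
    "c s = x + (LINT r|lebesgue_on {0..s}. F r (c r))"
    using c st by (auto simp: integral_curve_def)
  ultimately show ?thesis by simp
qed

lemma integral_curve_0: "integral_curve F x c \<Longrightarrow> c 0 = x"
proof -
  assume c: "integral_curve F x c"
  have "(LINT r|lebesgue_on {0..0::real}. F r (c r)) = 0"
    by (rule integral_eq_zero_null_sets) (auto simp: null_sets_completion_iff)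
  then show "c 0 = x" using c by (auto simp: integral_curve_def)
qed

text \<open>The division by \<open>2 * B\<close> is the gain of the exponentially weighted norm; it
  makes the Picard operator contract.\<close>

lemma integral_exp_square_le:
  fixes B t \<delta> :: real
  assumes "0 < B" "0 \<le> t"
  shows "integral {0..t} (\<lambda>r. (exp (B * r) * \<delta>)\<^sup>2) \<le> \<delta>\<^sup>2 * exp (2 * B * t) / (2 * B)"
proof -
  have "((\<lambda>r. (exp (B * r) * \<delta>)\<^sup>2) has_integral
      (\<delta>\<^sup>2 * exp (2 * B * t) / (2 * B) - \<delta>\<^sup>2 * exp (2 * B * 0) / (2 * B))) {0..t}"
  proof (rule fundamental_theorem_of_calculus[OF \<open>0 \<le> t\<close>, where f = "\<lambda>r. \<delta>\<^sup>2 * exp (2 * B * r) / (2 * B)"])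
    fix r assume "r \<in> {0..t}"
    have "((\<lambda>r. \<delta>\<^sup>2 * exp (2 * B * r) / (2 * B)) has_real_derivative (exp (B * r) * \<delta>)\<^sup>2) (at r within {0..t})"
      using assms(1) by (auto intro!: derivative_eq_intros simp: power_mult_distrib power2_eq_square exp_add[symmetric] mult.commute)
    then show "((\<lambda>r. \<delta>\<^sup>2 * exp (2 * B * r) / (2 * B)) has_vector_derivative (exp (B * r) * \<delta>)\<^sup>2) (at r within {0..t})"
      by (simp add: has_real_derivative_iff_has_vector_derivative)
  qed
  then show ?thesis using assms by (simp add: integral_unique)
qed

text \<open>Extends curves from the unit interval to the line, so that they become elements of the
  complete space of bounded continuous functions on the whole type.\<close>

definition clamp01 :: "real \<Rightarrow> real" where "clamp01 t = max 0 (min 1 t)"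

lemma clamp01: "clamp01 t \<in> {0..1}" "t \<in> {0..1} \<Longrightarrow> clamp01 t = t"
  by (auto simp: clamp01_def)

lemma bcontfun_clamp01:
  fixes h :: "real \<Rightarrow> 'b::metric_space"
  assumes h: "continuous_on {0..1} h"
  shows "(\<lambda>t. h (clamp01 t)) \<in> bcontfun"
proof -
  have "continuous_on UNIV (\<lambda>t. h (clamp01 t))"
    by (rule continuous_on_compose2[OF h])
      (use clamp01 in \<open>auto simp: clamp01_def intro!: continuous_intros\<close>)
  moreover have "range (\<lambda>t. h (clamp01 t)) \<subseteq> h ` {0..1}" using clamp01(1) by auto
  moreover have "bounded (h ` {0..1})"
    by (intro compact_imp_bounded compact_continuous_image h) simp
  ultimately show ?thesis by (auto simp: bcontfun_def intro: bounded_subset)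
qed

text \<open>The weight \<open>exp (- (B * t))\<close> turns the Picard operator into a contraction.\<close>

lemma integral_curve_exists:
  fixes F :: "real \<Rightarrow> 'a::euclidean_space \<Rightarrow> 'a"
  assumes a: "rate a K" and F: "caratheodory F a"
  shows "\<exists>c. integral_curve F x c"
proof -
  \<comment> \<open>With this choice \<open>K / (2 * B) \<le> 1/4\<close>, and the square root is
    the contraction factor 1/2.\<close>
  define B where "B = 2 * K + 1"
  have K: "0 \<le> K" using rate_nonneg[OF a] .
  then have B: "0 < B" by (simp add: B_def)
  \<comment> \<open>The unknown \<open>z\<close> is the curve times \<open>exp (- (B * t))\<close>.
    Undoing the weight inside the integral and restoring it outside makes the plain supremum norm of
    \<open>z\<close> a weighted norm of the curve.\<close>
  define \<Psi> :: "(real \<Rightarrow>\<^sub>C 'a) \<Rightarrow> real \<Rightarrow> 'a" where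
    "\<Psi> z t = exp (- (B * t)) *\<^sub>R (x + (LINT s|lebesgue_on {0..t}. F s (exp (B * s) *\<^sub>R apply_bcontfun z s)))" for z t
  have cc: "continuous_on {0..1} (\<lambda>s. exp (B * s) *\<^sub>R apply_bcontfun z s)" for z :: "real \<Rightarrow>\<^sub>C 'a"
    by (intro continuous_intros continuous_on_apply_bcontfun)
  have int: "integrable (lebesgue_on {0..1}) (\<lambda>s. F s (exp (B * s) *\<^sub>R apply_bcontfun z s))" for z
    by (rule caratheodory_integrable[OF a F cc])
  have c\<Psi>: "continuous_on {0..1} (\<Psi> z)" for z
    unfolding \<Psi>_def by (intro continuous_intros indefinite_integral_continuous_real int)
  define \<Phi> where "\<Phi> z = Bcontfun (\<lambda>t. \<Psi> z (clamp01 t))" for z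
  have \<Phi>: "apply_bcontfun (\<Phi> z) t = \<Psi> z (clamp01 t)" for z t
    unfolding \<Phi>_def by (simp add: Bcontfun_inverse bcontfun_clamp01[OF c\<Psi>])
  have contr: "dist (\<Phi> y) (\<Phi> z) \<le> (1/2) * dist y z" for y z
  proof (rule dist_bound)
    fix t0 :: real
    define t where "t = clamp01 t0"
    have t: "0 \<le> t" "t \<le> 1" using clamp01(1)[of t0] by (auto simp: t_def)
    define \<delta> where "\<delta> = dist y z"
    let ?f = "\<lambda>z s. F s (exp (B * s) *\<^sub>R apply_bcontfun z s)"
    let ?e = "\<lambda>r. exp (B * r) * \<delta>"
    have ce: "continuous_on {0..1} ?e" by (intro continuous_intros)
    have it: "integrable (lebesgue_on {0..t}) (?f z)" for z
      by (rule integrable_sub01[OF int]) (use t in auto)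
    have "norm (LINT s|lebesgue_on {0..t}. ?f y s - ?f z s) \<le> (LINT s|lebesgue_on {0..t}. a s * ?e s)"
    proof (rule norm_LINT_le(2)[OF rate_mult_le(1)[OF a ce]])
      show "(\<lambda>s. ?f y s - ?f z s) \<in> borel_measurable (lebesgue_on {0..t})"
        using it by (intro borel_measurable_diff) auto
      fix r assume r: "r \<in> {0..t}"
      have "norm (?f y r - ?f z r) \<le> a r * norm (exp (B * r) *\<^sub>R apply_bcontfun y r - exp (B * r) *\<^sub>R apply_bcontfun z r)"
        using F r t unfolding caratheodory_def by auto
      also have "norm (exp (B * r) *\<^sub>R apply_bcontfun y r - exp (B * r) *\<^sub>R apply_bcontfun z r)
          = exp (B * r) * dist (apply_bcontfun y r) (apply_bcontfun z r)"
        by (simp add: scaleR_diff_right[symmetric] dist_norm)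
      also have "a r * \<dots> \<le> a r * ?e r"
        using a by (intro mult_left_mono) (auto simp: \<delta>_def dist_bounded rate_def)
      finally show "norm (?f y r - ?f z r) \<le> a r * ?e r" .
    qed (use t in auto)
    then have "(norm (LINT s|lebesgue_on {0..t}. ?f y s - ?f z s))\<^sup>2 \<le> (LINT s|lebesgue_on {0..t}. a s * ?e s)\<^sup>2"
      by (intro power_mono) auto
    also have "\<dots> \<le> K * integral {0..t} (\<lambda>r. (?e r)\<^sup>2)"
      by (rule rate_mult_le(2)[OF a ce]) (use t in auto)
    also have "\<dots> \<le> K * (\<delta>\<^sup>2 * exp (2 * B * t) / (2 * B))"
      by (intro mult_left_mono integral_exp_square_le B t K)
    also have "\<dots> = (K / (2 * B)) * (\<delta> * exp (B * t))\<^sup>2"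
      by (simp add: power_mult_distrib exp_double[symmetric] mult.assoc)
    also have "\<dots> \<le> (1/4) * (\<delta> * exp (B * t))\<^sup>2"
      using K by (intro mult_right_mono) (auto simp: B_def field_simps)
    also have "\<dots> = (1/2 * \<delta> * exp (B * t))\<^sup>2" by (simp add: power2_eq_square)
    finally have "norm (LINT s|lebesgue_on {0..t}. ?f y s - ?f z s) \<le> 1/2 * \<delta> * exp (B * t)"
      by (rule power2_le_imp_le) (simp add: \<delta>_def)
    moreover have "\<Psi> y t - \<Psi> z t = exp (- (B * t)) *\<^sub>R (LINT s|lebesgue_on {0..t}. ?f y s - ?f z s)"
      unfolding \<Psi>_def using it by (simp add: scaleR_diff_right[symmetric])
    ultimately have "dist (\<Psi> y t) (\<Psi> z t) \<le> exp (- (B * t)) * (1/2 * \<delta> * exp (B * t))"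
      by (simp add: dist_norm)
    also have "\<dots> = 1/2 * \<delta>" by (simp add: exp_minus)
    finally show "dist (apply_bcontfun (\<Phi> y) t0) (apply_bcontfun (\<Phi> z) t0) \<le> 1/2 * dist y z"
      by (simp add: \<Phi> t_def \<delta>_def)
  qed
  obtain z where z: "\<Phi> z = z"
    using banach_fix_type[of "1/2" \<Phi>] contr by auto
  define c where "c t = exp (B * t) *\<^sub>R apply_bcontfun z t" for t
  have "c t = x + (LINT s|lebesgue_on {0..t}. F s (c s))" if "t \<in> {0..1}" for t
  proof -
    have "apply_bcontfun z t = \<Psi> z t" using \<Phi>[of z t] z clamp01(2)[OF that] by simp
    then show ?thesis by (simp add: c_def \<Psi>_def exp_minus)
  qed
  moreover have "continuous_on {0..1} c" unfolding c_def by (rule cc)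
  moreover have "integrable (lebesgue_on {0..1}) (\<lambda>s. F s (c s))" unfolding c_def by (rule int)
  ultimately show ?thesis unfolding integral_curve_def by blast
qed

text \<open>The common core of the forward estimates: \<open>e\<close> is a difference of curves or
  a remainder, \<open>b\<close> its velocity, and \<epsilon> a forcing weighted by the same rate. By
  Cauchy--Schwarz the forcing adds at most \<open>sqrt K * \<epsilon>\<close> to the initial
  error.\<close>

lemma integral_gronwall:
  fixes e b :: "real \<Rightarrow> 'a::euclidean_space"
  assumes a: "rate a K" and ce: "continuous_on {0..1} e"
    and b: "integrable (lebesgue_on {0..1}) b"
    and e: "\<And>t. t \<in> {0..1} \<Longrightarrow> e t = e0 + (LINT r|lebesgue_on {0..t}. b r)"
    and le: "\<And>r. r \<in> {0..1} \<Longrightarrow> norm (b r) \<le> a r * norm (e r) + a r * \<epsilon>"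
    and t: "t \<in> {0..1}" and \<epsilon>: "0 \<le> \<epsilon>"
  shows "norm (e t) \<le> (norm e0 + sqrt K * \<epsilon>) * sqrt (2 * exp (2 * K))"
proof -
  have K: "0 \<le> K" using rate_nonneg[OF a] .
  have cne: "continuous_on {0..1} (\<lambda>r. norm (e r))" by (intro continuous_intros ce)
  have "(norm (e t))\<^sup>2 \<le> 2 * (norm e0 + sqrt K * \<epsilon>)\<^sup>2 * exp (2 * K)"
  proof (rule gronwall_rate[OF a ce _ t])
    fix t :: real assume t: "t \<in> {0..1}"
    have i1: "integrable (lebesgue_on {0..t}) (\<lambda>r. a r * norm (e r))"
      by (rule rate_mult_le(1)[OF a cne]) (use t in auto)
    have i2: "integrable (lebesgue_on {0..t}) a"
      by (rule rate_integrable(1)[OF a]) (use t in auto)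
    have "(LINT r|lebesgue_on {0..t}. a r)\<^sup>2 \<le> K * (t - 0)"
      by (rule rate_integrable(2)[OF a]) (use t in auto)
    also have "\<dots> \<le> K" using K t by (auto intro: mult_left_le)
    finally have a1: "(LINT r|lebesgue_on {0..t}. a r) \<le> sqrt K"
      using real_le_rsqrt by blast
    have "norm (LINT r|lebesgue_on {0..t}. b r) \<le>
        (LINT r|lebesgue_on {0..t}. a r * norm (e r) + a r * \<epsilon>)"
      using t i1 i2 le by (intro norm_LINT_le(2) borel_measurable_integrable integrable_sub01[OF b]) auto
    also have "\<dots> = (LINT r|lebesgue_on {0..t}. a r * norm (e r)) + (LINT r|lebesgue_on {0..t}. a r) * \<epsilon>"
      using i1 i2 by simp
    also have "\<dots> \<le> (LINT r|lebesgue_on {0..t}. a r * norm (e r)) + sqrt K * \<epsilon>"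
      using a1 \<epsilon> by (simp add: mult_right_mono)
    finally have "norm (LINT r|lebesgue_on {0..t}. b r) \<le> \<dots>" .
    then show "norm (e t) \<le> norm e0 + sqrt K * \<epsilon> + (LINT r|lebesgue_on {0..t}. a r * norm (e r))"
      unfolding e[OF t] using norm_triangle_ineq[of e0 "LINT r|lebesgue_on {0..t}. b r"] by linarith
  qed
  also have "\<dots> = ((norm e0 + sqrt K * \<epsilon>) * sqrt (2 * exp (2 * K)))\<^sup>2"
    by (simp add: power_mult_distrib)
  finally show ?thesis
    by (rule power2_le_imp_le) (use K \<epsilon> in auto)
qed

text \<open>Forward Gronwall with zero forcing gives the first bound, and with it uniqueness.
  Backward Gronwall gives the second, a quantitative injectivity; applied to the linearized equation
  it bounds the derivative of the flow from below.\<close>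

lemma integral_curve_lipschitz:
  assumes a: "rate a K" and F: "caratheodory F a"
    and c: "integral_curve F x c" and d: "integral_curve F y d" and t: "t \<in> {0..1}"
  shows "norm (c t - d t) \<le> norm (x - y) * sqrt (2 * exp (2 * K))"
    and "norm (x - y) \<le> norm (c t - d t) * sqrt (2 * exp (2 * K))"
proof -
  have cc: "continuous_on {0..1} (\<lambda>t. c t - d t)"
    using c d by (auto simp: integral_curve_def intro: continuous_intros)
  have ic: "integrable (lebesgue_on {0..1}) (\<lambda>s. F s (c s))" and id: "integrable (lebesgue_on {0..1}) (\<lambda>s. F s (d s))"
    using c d by (auto simp: integral_curve_def)
  have K: "0 \<le> K" using rate_nonneg[OF a] .
  have bd: "norm (F r (c r) - F r (d r)) \<le> a r * norm (c r - d r)" if "r \<in> {0..1}" for r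
    using F that by (auto simp: caratheodory_def)
  have diff: "c t - d t - (c s - d s) = (LINT r|lebesgue_on {s..t}. F r (c r) - F r (d r))"
    if "0 \<le> s" "s \<le> t" "t \<le> 1" for s t
    using integral_curve_diff[OF c that] integral_curve_diff[OF d that]
      integrable_sub01[OF ic, of s t] integrable_sub01[OF id, of s t] that
    by (simp add: algebra_simps)
  have "norm (c t - d t) \<le> (norm (x - y) + sqrt K * 0) * sqrt (2 * exp (2 * K))"
  proof (rule integral_gronwall[OF a cc _ _ _ t])
    show "integrable (lebesgue_on {0..1}) (\<lambda>r. F r (c r) - F r (d r))" using ic id by simp
    fix t :: real assume "t \<in> {0..1}"
    then show "c t - d t = x - y + (LINT r|lebesgue_on {0..t}. F r (c r) - F r (d r))"
      using diff[of 0 t] integral_curve_0[OF c] integral_curve_0[OF d] by (simp add: algebra_simps)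
  qed (use bd in auto)
  then show "norm (c t - d t) \<le> norm (x - y) * sqrt (2 * exp (2 * K))" by simp
  have cne: "continuous_on {0..1} (\<lambda>r. norm (c r - d r))" by (intro continuous_intros cc)
  have "(norm (c 0 - d 0))\<^sup>2 \<le> 2 * (norm (c t - d t))\<^sup>2 * exp (2 * K)"
  proof (rule gronwall_rate_backward[OF a cc t])
    fix s assume s: "s \<in> {0..t}"
    have m: "(\<lambda>r. F r (c r) - F r (d r)) \<in> borel_measurable (lebesgue_on {s..t})"
      using integrable_sub01[OF ic, of s t] integrable_sub01[OF id, of s t] s t by auto
    have "norm (LINT r|lebesgue_on {s..t}. F r (c r) - F r (d r)) \<le> (LINT r|lebesgue_on {s..t}. a r * norm (c r - d r))"
      by (rule norm_LINT_le(2)[OF rate_mult_le(1)[OF a cne] m]) (use s t bd in auto)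
    then have "norm (c t - d t - (c s - d s)) \<le> (LINT r|lebesgue_on {s..t}. a r * norm (c r - d r))"
      using diff[of s t] s t by simp
    then show "norm (c s - d s) \<le> norm (c t - d t) + (LINT r|lebesgue_on {s..t}. a r * norm (c r - d r))"
      using norm_triangle_ineq4[of "c t - d t" "c t - d t - (c s - d s)"] by simp
  qed
  also have "\<dots> = (norm (c t - d t) * sqrt (2 * exp (2 * K)))\<^sup>2"
    by (simp add: power_mult_distrib)
  finally have "norm (c 0 - d 0) \<le> norm (c t - d t) * sqrt (2 * exp (2 * K))"
    by (rule power2_le_imp_le) simp
  then show "norm (x - y) \<le> norm (c t - d t) * sqrt (2 * exp (2 * K))"
    using integral_curve_0[OF c] integral_curve_0[OF d] by simp
qed

text \<open>The choice made by \<open>flow\<close> is legitimate by existence and immaterial by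
  \<open>flow_unique\<close>.\<close>

lemma integral_curve_flow:
  assumes "rate a K" "caratheodory F a"
  shows "integral_curve F x (\<lambda>t. flow F t x)"
  unfolding flow_def by (rule someI_ex[OF integral_curve_exists[OF assms]])

lemma flow_unique:
  assumes "rate a K" "caratheodory F a" "integral_curve F x c" "t \<in> {0..1}"
  shows "flow F t x = c t"
  using integral_curve_lipschitz(1)[OF assms(1,2) integral_curve_flow[OF assms(1,2), of x] assms(3,4)]
  by simp

subsection \<open>Differentiability of the flow\<close>

text \<open>The Gronwall factor of \<open>integral_gronwall\<close>; it serves as Lipschitz constant
  for the flow and for its inverse.\<close>

definition flow_const :: "real \<Rightarrow> real" where "flow_const K = sqrt (2 * exp (2 * K))"

lemma flow_const_pos [simp]: "0 < flow_const K" "0 \<le> flow_const K"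
  by (auto simp: flow_const_def)

lemma quadratic_remainder_has_derivative:
  fixes f :: "'b::real_normed_vector \<Rightarrow> 'c::real_normed_vector"
  assumes "bounded_linear T" "\<And>w. norm (f (x + w) - f x - T w) \<le> C * (norm w)\<^sup>2"
  shows "(f has_derivative T) (at x)"
  unfolding has_derivative_at
proof (intro conjI assms(1))
  show "(\<lambda>w. norm (f (x + w) - f x - T w) / norm w) \<midarrow>0\<rightarrow> 0"
  proof (rule tendsto_sandwich[OF always_eventually always_eventually tendsto_const])
    show "((\<lambda>w. C * norm w) \<longlongrightarrow> 0) (at (0::'b))"
      by (rule tendsto_eq_intros refl | simp)+
    show "\<forall>w. norm (f (x + w) - f x - T w) / norm w \<le> C * norm w"
    proof
      fix w show "norm (f (x + w) - f x - T w) / norm w \<le> C * norm w"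
      using assms(2)[of w] 
       by (cases "w = 0") (auto simp: divide_simps power2_eq_square mult.assoc)
    qed
  qed auto
qed

text \<open>One rate \<open>a\<close> dominates the field, its derivative and the Lipschitz constant
  of the derivative. For a path \<open>v\<close> in the Hilbert space it will be a multiple of
  \<open>norm (v s)\<close>.\<close>

locale smooth_field =
  fixes u :: "real \<Rightarrow> 'a::euclidean_space \<Rightarrow> 'a" and Du :: "real \<Rightarrow> 'a \<Rightarrow> 'a \<Rightarrow>\<^sub>L 'a"
    and a :: "real \<Rightarrow> real" and K :: real
  assumes rate: "rate a K"
    and u_meas: "continuous_on {0..1} c \<Longrightarrow> (\<lambda>s. u s (c s)) \<in> borel_measurable (lebesgue_on {0..1})"
    and Du_meas: "continuous_on {0..1} c \<Longrightarrow> continuous_on {0..1} w \<Longrightarrow>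
      (\<lambda>s. blinfun_apply (Du s (c s)) (w s)) \<in> borel_measurable (lebesgue_on {0..1})"
    and u_bound: "s \<in> {0..1} \<Longrightarrow> norm (u s y) \<le> a s"
    and Du_bound: "s \<in> {0..1} \<Longrightarrow> norm (Du s y) \<le> a s"
    and Du_lipschitz: "s \<in> {0..1} \<Longrightarrow> norm (Du s y - Du s z) \<le> a s * norm (y - z)"
    and u_derivative: "s \<in> {0..1} \<Longrightarrow> (u s has_derivative blinfun_apply (Du s y)) (at y)"
begin

text \<open>The mean value inequality on the ball of radius \<open>norm (z - y)\<close> around
  \<open>y\<close>, where \<open>Du\<close> varies by at most \<open>a s * norm (z - y)\<close>. The
  factor 1/2 of the sharp Taylor bound is given up.\<close>

lemma u_taylor:
  assumes "s \<in> {0..1}"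
  shows "norm (u s z - u s y - blinfun_apply (Du s y) (z - y)) \<le> a s * (norm (z - y))\<^sup>2"
proof -
  have "norm (u s z - u s y - blinfun_apply (Du s y) (z - y)) \<le> norm (z - y) * (a s * norm (z - y))"
  proof (rule differentiable_bound_linearization[where S = "cball y (norm (z - y))" and f' = "\<lambda>x. blinfun_apply (Du s x)"])
    fix t :: real assume "t \<in> {0..1}"
    then show "y + t *\<^sub>R (z - y) \<in> cball y (norm (z - y))"
      by (auto simp: dist_norm mult_left_le_one_le)
  next
    fix x assume "x \<in> cball y (norm (z - y))"
    then have "norm (x - y) \<le> norm (z - y)" by (simp add: dist_norm norm_minus_commute)
    then have "norm (Du s x - Du s y) \<le> a s * norm (z - y)"
      using Du_lipschitz[OF assms, of x y] rate mult_left_mono[of "norm (x - y)" "norm (z - y)" "a s"]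
      by (auto simp: rate_def)
    then show "onorm (blinfun_apply (Du s x) - blinfun_apply (Du s y)) \<le> a s * norm (z - y)"
      by (simp add: norm_blinfun.rep_eq minus_blinfun.rep_eq fun_diff_def)
  qed (use assms in \<open>auto intro: has_derivative_at_withinI[OF u_derivative]\<close>)
  then show ?thesis by (simp add: power2_eq_square ac_simps)
qed

lemma a_nonneg: "0 \<le> a s" using rate by (simp add: rate_def)

lemma K_nonneg: "0 \<le> K" by (rule rate_nonneg[OF rate])

lemma caratheodory_u: "caratheodory u a"
  unfolding caratheodory_def
proof (intro conjI allI impI ballI)
  fix s :: real and y z :: 'a assume s: "s \<in> {0..1}"
  show "norm (u s y - u s z) \<le> a s * norm (y - z)"
    by (rule differentiable_bound[where S = UNIV and f' = "\<lambda>y. blinfun_apply (Du s y)"])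
      (use u_derivative[OF s] Du_bound[OF s] in \<open>auto simp: norm_blinfun.rep_eq[symmetric]\<close>)
qed (use u_meas u_bound in auto)

abbreviation "\<phi> t x \<equiv> flow u t x"

lemma curve: "integral_curve u x (\<lambda>t. \<phi> t x)"
  by (rule integral_curve_flow[OF rate caratheodory_u])

lemma continuous_curve: "continuous_on {0..1} (\<lambda>t. \<phi> t x)"
  using curve by (simp add: integral_curve_def)

text \<open>The variational equation along the trajectory from \<open>x\<close>. It is again a
  Caratheodory field with rate \<open>a\<close>, so existence, uniqueness and both Lipschitz bounds
  apply to it as well.\<close>

definition lin :: "'a \<Rightarrow> real \<Rightarrow> 'a \<Rightarrow> 'a" where
  "lin x s w = blinfun_apply (Du s (\<phi> s x)) w"

lemma caratheodory_lin: "caratheodory (lin x) a"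
  unfolding caratheodory_def lin_def
proof (intro conjI allI impI ballI)
  fix s :: real and y z :: 'a assume s: "s \<in> {0..1}"
  have "norm (blinfun_apply (Du s (\<phi> s x)) (y - z)) \<le> norm (Du s (\<phi> s x)) * norm (y - z)"
    by (rule norm_blinfun)
  also have "\<dots> \<le> a s * norm (y - z)" by (intro mult_right_mono Du_bound s) auto
  finally show "norm (blinfun_apply (Du s (\<phi> s x)) y - blinfun_apply (Du s (\<phi> s x)) z) \<le> a s * norm (y - z)"
    by (simp add: blinfun.diff_right)
qed (use Du_meas[OF continuous_curve] a_nonneg in auto)

definition \<psi> :: "'a \<Rightarrow> real \<Rightarrow> 'a \<Rightarrow> 'a" where "\<psi> x t w = flow (lin x) t w"

lemma curve_\<psi>: "integral_curve (lin x) w (\<lambda>t. \<psi> x t w)"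
  unfolding \<psi>_def by (rule integral_curve_flow[OF rate caratheodory_lin])

lemma \<psi>_unique: "integral_curve (lin x) w c \<Longrightarrow> t \<in> {0..1} \<Longrightarrow> \<psi> x t w = c t"
  unfolding \<psi>_def by (rule flow_unique[OF rate caratheodory_lin])

text \<open>Superposition: a combination of solutions solves the equation with the combined initial
  value, and solutions are unique.\<close>

lemma linear_\<psi>:
  assumes "t \<in> {0..1}"
  shows "linear (\<psi> x t)"
proof -
  have comb: "\<psi> x t (\<alpha> *\<^sub>R w + \<beta> *\<^sub>R z) = \<alpha> *\<^sub>R \<psi> x t w + \<beta> *\<^sub>R \<psi> x t z" for \<alpha> \<beta> w z
  proof (rule \<psi>_unique[OF _ assms])
    let ?c = "\<lambda>t. \<alpha> *\<^sub>R \<psi> x t w + \<beta> *\<^sub>R \<psi> x t z"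
    have lin: "lin x s (?c s) = \<alpha> *\<^sub>R lin x s (\<psi> x s w) + \<beta> *\<^sub>R lin x s (\<psi> x s z)" for s
      by (simp add: lin_def blinfun.add_right blinfun.scaleR_right)
    have i: "integrable (lebesgue_on {0..1}) (\<lambda>s. lin x s (\<psi> x s w))" for w
      using curve_\<psi> by (auto simp: integral_curve_def)
    show "integral_curve (lin x) (\<alpha> *\<^sub>R w + \<beta> *\<^sub>R z) ?c"
      unfolding integral_curve_def lin
    proof (intro conjI ballI)
      show "integrable (lebesgue_on {0..1}) (\<lambda>s. \<alpha> *\<^sub>R lin x s (\<psi> x s w) + \<beta> *\<^sub>R lin x s (\<psi> x s z))"
        using i by simp
      show "continuous_on {0..1} ?c"
        by (intro continuous_intros) (use curve_\<psi> in \<open>auto simp: integral_curve_def\<close>)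
      fix t :: real assume t: "t \<in> {0..1}"
      have it: "integrable (lebesgue_on {0..t}) (\<lambda>s. lin x s (\<psi> x s w))" for w
        using i t by (auto intro: integrable_sub01)
      have "\<psi> x t w = w + (LINT s|lebesgue_on {0..t}. lin x s (\<psi> x s w))" for w
        using curve_\<psi> t by (auto simp: integral_curve_def)
      then have "\<alpha> *\<^sub>R \<psi> x t w = \<alpha> *\<^sub>R w + \<alpha> *\<^sub>R (LINT s|lebesgue_on {0..t}. lin x s (\<psi> x s w))" for \<alpha> w
        by (metis scaleR_add_right)
      from this[of \<alpha> w] this[of \<beta> z]
      show "?c t = \<alpha> *\<^sub>R w + \<beta> *\<^sub>R z +
          (LINT s|lebesgue_on {0..t}. \<alpha> *\<^sub>R lin x s (\<psi> x s w) + \<beta> *\<^sub>R lin x s (\<psi> x s z))"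
        using it[of w] it[of z] by (simp only: Bochner_Integration.integral_add
            integrable_scaleR_right integral_scaleR_right) (simp add: algebra_simps)
    qed
  qed
  show ?thesis
    using comb[of 1 _ 1] comb[of _ _ 0 0] by (intro linearI) simp_all
qed

section \<open>Two-sided bounds for the flow and its linearization\<close>

lemma \<phi>_lipschitz:
  assumes "t \<in> {0..1}"
  shows "norm (\<phi> t x - \<phi> t y) \<le> norm (x - y) * flow_const K"
    and "norm (x - y) \<le> norm (\<phi> t x - \<phi> t y) * flow_const K"
  using integral_curve_lipschitz[OF rate caratheodory_u curve curve assms, of x y]
  by (simp_all add: flow_const_def)

text \<open>Comparison with the solution from 0, which vanishes by linearity.\<close>

lemma \<psi>_bounds:
  assumes t: "t \<in> {0..1}"
  shows "norm (\<psi> x t w) \<le> norm w * flow_const K"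
    and "norm w \<le> norm (\<psi> x t w) * flow_const K"
  using integral_curve_lipschitz[OF rate caratheodory_lin curve_\<psi>[of x w] curve_\<psi>[of x 0] t]
    linear_0[OF linear_\<psi>[OF t]]
  by (simp_all add: flow_const_def)

text \<open>The candidate for the derivative of the flow. \<open>Blinfun\<close> is meaningful for
  \<open>t\<close> in the unit interval, where \<open>\<psi> x t\<close> is linear.\<close>

definition D :: "real \<Rightarrow> 'a \<Rightarrow> 'a \<Rightarrow>\<^sub>L 'a" where "D t x = Blinfun (\<psi> x t)"

lemma blinfun_apply_D: "t \<in> {0..1} \<Longrightarrow> blinfun_apply (D t x) = \<psi> x t"
  unfolding D_def
  by (rule bounded_linear_Blinfun_apply) (simp add: linear_\<psi> linear_conv_bounded_linear[symmetric])

lemma norm_D_le: "t \<in> {0..1} \<Longrightarrow> norm (D t x) \<le> flow_const K"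
  by (rule norm_blinfun_bound) (use \<psi>_bounds(1) in \<open>auto simp: blinfun_apply_D mult.commute\<close>)

lemma norm_D_ge: "t \<in> {0..1} \<Longrightarrow> norm w \<le> norm (blinfun_apply (D t x) w) * flow_const K"
  using \<psi>_bounds(2) by (simp add: blinfun_apply_D)

text \<open>The remainder starts at 0 and solves the variational equation up to the Taylor remainder
  of \<open>u\<close>, which is quadratic in the distance of the two trajectories. That distance
  contributes two factors \<open>flow_const K\<close>, Gronwall the third.\<close>

lemma flow_remainder:
  assumes t: "t \<in> {0..1}"
  shows "norm (\<phi> t (x + w) - \<phi> t x - \<psi> x t w) \<le> sqrt K * flow_const K ^ 3 * (norm w)\<^sup>2"
proof -
  let ?L = "flow_const K"
  let ?e = "\<lambda>t. \<phi> t (x + w) - \<phi> t x - \<psi> x t w"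
  let ?b = "\<lambda>r. u r (\<phi> r (x + w)) - u r (\<phi> r x) - lin x r (\<psi> x r w)"
  have i: "integrable (lebesgue_on {0..1}) (\<lambda>s. u s (\<phi> s x))" 
     "integrable (lebesgue_on {0..1}) (\<lambda>s. u s (\<phi> s (x + w)))"
     "integrable (lebesgue_on {0..1}) (\<lambda>s. lin x s (\<psi> x s w))"
    using curve curve_\<psi> by (auto simp: integral_curve_def)
  have "norm (?e t) \<le> (norm (0::'a) + sqrt K * (?L * norm w)\<^sup>2) * sqrt (2 * exp (2 * K))"
  proof (rule integral_gronwall[OF rate _ _ _ _ t, of ?e ?b])
    show "continuous_on {0..1} ?e"
      using curve curve_\<psi> by (auto simp: integral_curve_def intro!: continuous_intros)
    show "integrable (lebesgue_on {0..1}) ?b" using i by simp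
    show "0 \<le> (?L * norm w)\<^sup>2" by simp
  next
    fix t :: real assume t: "t \<in> {0..1}"
    have i': "integrable (lebesgue_on {0..t}) (\<lambda>s. u s (\<phi> s x))" 
     "integrable (lebesgue_on {0..t}) (\<lambda>s. u s (\<phi> s (x + w)))"
     "integrable (lebesgue_on {0..t}) (\<lambda>s. lin x s (\<psi> x s w))"
      using i t by (auto intro: integrable_sub01)
    have "\<phi> t (x + w) = x + w + (LINT s|lebesgue_on {0..t}. u s (\<phi> s (x + w)))"
      "\<phi> t x = x + (LINT s|lebesgue_on {0..t}. u s (\<phi> s x))"
      "\<psi> x t w = w + (LINT s|lebesgue_on {0..t}. lin x s (\<psi> x s w))"
      using curve[of x] curve[of "x + w"] curve_\<psi> t by (auto simp: integral_curve_def)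
    then show "?e t = 0 + (LINT r|lebesgue_on {0..t}. ?b r)"
      using i' by simp
  next
    fix r :: real assume r: "r \<in> {0..1}"
    let ?d = "\<phi> r (x + w) - \<phi> r x"
    have "?b r = (u r (\<phi> r (x + w)) - u r (\<phi> r x) - blinfun_apply (Du r (\<phi> r x)) ?d) + lin x r (?e r)"
      by (simp add: lin_def blinfun.diff_right)
    then have "norm (?b r) \<le> norm (u r (\<phi> r (x + w)) - u r (\<phi> r x) - blinfun_apply (Du r (\<phi> r x)) ?d) + norm (lin x r (?e r))"
      by (metis norm_triangle_ineq)
    also have "\<dots> \<le> a r * (norm ?d)\<^sup>2 + a r * norm (?e r)"
    proof (rule add_mono[OF u_taylor[OF r]])
      show "norm (lin x r (?e r)) \<le> a r * norm (?e r)"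
        using caratheodory_lin r unfolding caratheodory_def by (metis diff_zero lin_def blinfun.zero_right)
    qed
    also have "a r * (norm ?d)\<^sup>2 \<le> a r * (?L * norm w)\<^sup>2"
      using \<phi>_lipschitz(1)[OF r, of "x + w" x]
      by (intro mult_left_mono power_mono) (auto simp: a_nonneg mult.commute)
    finally show "norm (?b r) \<le> a r * norm (?e r) + a r * (?L * norm w)\<^sup>2" by simp
  qed
  also have "\<dots> = sqrt K * ?L ^ 3 * (norm w)\<^sup>2"
    by (simp add: flow_const_def[symmetric] power2_eq_square power3_eq_cube)
  finally show ?thesis .
qed

lemma \<phi>_has_derivative:
  assumes "t \<in> {0..1}"
  shows "(\<phi> t has_derivative blinfun_apply (D t x)) (at x)"
  by (rule quadratic_remainder_has_derivative[where C = "sqrt K * flow_const K ^ 3"])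
    (use flow_remainder[OF assms] in \<open>auto simp: blinfun_apply_D[OF assms] 
      linear_\<psi>[OF assms] linear_conv_bounded_linear[symmetric]\<close>)

lemma frechet_\<phi>: "t \<in> {0..1} \<Longrightarrow> frechet_derivative (\<phi> t) (at x) = blinfun_apply (D t x)"
  by (rule frechet_derivative_at[symmetric, OF \<phi>_has_derivative])

text \<open>The difference of two variational equations is forced by the difference of
  \<open>Du\<close> along the two trajectories. The three factors \<open>flow_const K\<close> come
  from the distance of the trajectories, the size of \<open>\<psi> y r w\<close>, and
  Gronwall.\<close>

lemma D_lipschitz:
  assumes t: "t \<in> {0..1}"
  shows "norm (D t x - D t y) \<le> sqrt K * flow_const K ^ 3 * norm (x - y)"
proof (rule norm_blinfun_bound)
  let ?L = "flow_const K"
  fix w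
  let ?e = "\<lambda>t. \<psi> x t w - \<psi> y t w"
  let ?b = "\<lambda>r. lin x r (\<psi> x r w) - lin y r (\<psi> y r w)"
  have i: "integrable (lebesgue_on {0..1}) (\<lambda>s. lin x s (\<psi> x s w))" for x
    using curve curve_\<psi> by (auto simp: integral_curve_def)
  have "norm (?e t) \<le> (norm (0::'a) + sqrt K * ((norm (x - y) * ?L) * (norm w * ?L))) * sqrt (2 * exp (2 * K))"
  proof (rule integral_gronwall[OF rate _ _ _ _ t, of ?e ?b])
    show "continuous_on {0..1} ?e"
      using curve_\<psi> by (auto simp: integral_curve_def intro!: continuous_intros)
    show "integrable (lebesgue_on {0..1}) ?b" using i by simp
  next
    fix t :: real assume t: "t \<in> {0..1}"
    have i': "integrable (lebesgue_on {0..t}) (\<lambda>s. lin x s (\<psi> x s w))" for x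
      using i t by (auto intro: integrable_sub01)
    have "\<psi> x t w = w + (LINT s|lebesgue_on {0..t}. lin x s (\<psi> x s w))" for x
      using curve_\<psi> t by (auto simp: integral_curve_def)
    then show "?e t = 0 + (LINT r|lebesgue_on {0..t}. ?b r)"
      using i' by simp
  next
    fix r :: real assume r: "r \<in> {0..1}"
    have "?b r = lin x r (?e r) + blinfun_apply (Du r (\<phi> r x) - Du r (\<phi> r y)) (\<psi> y r w)"
      by (simp add: lin_def blinfun.diff_right blinfun.diff_left)
    then have "norm (?b r) \<le> norm (lin x r (?e r)) + norm (blinfun_apply (Du r (\<phi> r x) - Du r (\<phi> r y)) (\<psi> y r w))"
      by (metis norm_triangle_ineq)
    also have "\<dots> \<le> a r * norm (?e r) + (a r * (norm (x - y) * ?L)) * (norm w * ?L)"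
    proof (rule add_mono)
      show "norm (lin x r (?e r)) \<le> a r * norm (?e r)"
        using caratheodory_lin r unfolding caratheodory_def by (metis diff_zero lin_def blinfun.zero_right)
      have "norm (blinfun_apply (Du r (\<phi> r x) - Du r (\<phi> r y)) (\<psi> y r w)) \<le>
        norm (Du r (\<phi> r x) - Du r (\<phi> r y)) * norm (\<psi> y r w)" by (rule norm_blinfun)
      also have "\<dots> \<le> (a r * norm (\<phi> r x - \<phi> r y)) * (norm w * ?L)"
        by (intro mult_mono Du_lipschitz r \<psi>_bounds) (auto simp: a_nonneg)
      also have "\<dots> \<le> (a r * (norm (x - y) * ?L)) * (norm w * ?L)"
        by (intro mult_right_mono mult_left_mono \<phi>_lipschitz r) (auto simp: a_nonneg)
      finally show "norm (blinfun_apply (Du r (\<phi> r x) - Du r (\<phi> r y)) (\<psi> y r w)) \<le> \<dots>" .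
    qed
    finally show "norm (?b r) \<le> a r * norm (?e r) + a r * ((norm (x - y) * ?L) * (norm w * ?L))"
      by (simp add: mult.assoc)
  qed auto
  then show "norm (blinfun_apply (D t x - D t y) w) \<le> sqrt K * ?L ^ 3 * norm (x - y) * norm w"
    unfolding flow_const_def[symmetric]
    by (simp add: blinfun.diff_left blinfun_apply_D[OF t] power3_eq_cube ac_simps)
qed (simp add: K_nonneg)

text \<open>Cauchy--Schwarz on an interval of length \<open>t - s\<close>. As the constant depends
  on \<open>K\<close> only, this and \<open>D_holder\<close> supply the equicontinuity for
  Arzela--Ascoli.\<close>

lemma \<phi>_holder:
  assumes "0 \<le> s" "s \<le> t" "t \<le> 1"
  shows "norm (\<phi> t x - \<phi> s x) \<le> sqrt (K * (t - s))"
proof -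
  have m: "(\<lambda>r. u r (\<phi> r x)) \<in> borel_measurable (lebesgue_on {s..t})"
    by (rule measurable_sub01[OF u_meas[OF continuous_curve]]) (use assms in auto)
  have "norm (\<phi> t x - \<phi> s x) \<le> (LINT r|lebesgue_on {s..t}. a r)"
    unfolding integral_curve_diff[OF curve assms]
    by (rule norm_LINT_le(2)[OF rate_integrable(1)[OF rate assms] m]) (use assms u_bound in auto)
  also have "\<dots> \<le> sqrt (K * (t - s))"
    by (rule real_le_rsqrt[OF rate_integrable(2)[OF rate assms]])
  finally show ?thesis .
qed

lemma \<psi>_holder:
  assumes "0 \<le> s" "s \<le> t" "t \<le> 1"
  shows "norm (\<psi> x t w - \<psi> x s w) \<le> sqrt (K * (t - s)) * flow_const K * norm w"
proof -
  have m: "(\<lambda>r. lin x r (\<psi> x r w)) \<in> borel_measurable (lebesgue_on {s..t})"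
    by (rule measurable_sub01) (use curve_\<psi>[of x w] assms in \<open>auto simp: integral_curve_def\<close>)
  have "norm (\<psi> x t w - \<psi> x s w) \<le> (LINT r|lebesgue_on {s..t}. a r * (norm w * flow_const K))"
    unfolding integral_curve_diff[OF curve_\<psi> assms]
  proof (rule norm_LINT_le(2)[OF _ m])
    show "integrable (lebesgue_on {s..t}) (\<lambda>r. a r * (norm w * flow_const K))"
      using rate_integrable(1)[OF rate assms] by simp
    fix r assume "r \<in> {s..t}"
    then have r: "r \<in> {0..1}" using assms by auto
    have "norm (lin x r (\<psi> x r w)) \<le> norm (Du r (\<phi> r x)) * norm (\<psi> x r w)"
      unfolding lin_def by (rule norm_blinfun)
    also have "\<dots> \<le> a r * (norm w * flow_const K)"
      by (intro mult_mono Du_bound \<psi>_bounds r) (auto simp: a_nonneg)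
    finally show "norm (lin x r (\<psi> x r w)) \<le> a r * (norm w * flow_const K)" .
  qed
  also have "\<dots> = (LINT r|lebesgue_on {s..t}. a r) * (norm w * flow_const K)" by simp
  also have "\<dots> \<le> sqrt (K * (t - s)) * (norm w * flow_const K)"
    by (intro mult_right_mono real_le_rsqrt[OF rate_integrable(2)[OF rate assms]]) auto
  finally show ?thesis by (simp add: ac_simps)
qed

lemma D_holder:
  assumes "0 \<le> s" "s \<le> t" "t \<le> 1"
  shows "norm (D t x - D s x) \<le> sqrt (K * (t - s)) * flow_const K"
  by (rule norm_blinfun_bound)
    (use assms \<psi>_holder[OF assms] K_nonneg in \<open>auto simp: blinfun.diff_left blinfun_apply_D\<close>)

end

subsection \<open>Square integrable paths in a Hilbert space\<close>

abbreviation leb01 :: "real measure" where "leb01 \<equiv> lebesgue_on {0..1}"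

lemma measure_leb01: "measure leb01 {0..1} = 1"
  by (simp add: measure_restrict_space)

text \<open>Extended by zero to the line, the limit agrees almost everywhere with a pointwise
  \<open>lim\<close> of measurable functions; completeness of Lebesgue measure does the
  rest.\<close>

lemma AE_limit_measurable:
  fixes f :: "real \<Rightarrow> 'b::euclidean_space"
  assumes g: "\<And>k. g k \<in> borel_measurable leb01" and lim: "AE t in leb01. (\<lambda>k. g k t) \<longlonglongrightarrow> f t"
  shows "f \<in> borel_measurable leb01"
proof -
  let ?ext = "\<lambda>h t. if t \<in> {0..1} then h t else (0::'b)"
  have "\<And>k. ?ext (g k) \<in> borel_measurable lebesgue"
    using g by (intro borel_measurable_if_I) auto
  then have "(\<lambda>t. lim (\<lambda>k. ?ext (g k) t)) \<in> borel_measurable lebesgue"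
    by (rule borel_measurable_lim_metric)
  moreover have "AE t in lebesgue. t \<in> {0..1} \<longrightarrow> (\<lambda>k. g k t) \<longlonglongrightarrow> f t"
    using lim by (simp add: AE_restrict_space_iff)
  then have "AE t in lebesgue. lim (\<lambda>k. ?ext (g k) t) = ?ext f t"
    by (rule AE_mp) (auto intro!: AE_I2 limI)
  ultimately have "?ext f \<in> borel_measurable lebesgue"
    by (rule borel_measurable_AE)
  then show ?thesis by (rule borel_measurable_if_D)
qed

text \<open>Measurability in the sense of Bochner, as in \<open>bochner_L2\<close>. The values need
  not lie in a separable space, so measurability of derived functions is obtained through the
  approximating simple functions.\<close>

definition strongly_measurable :: "(real \<Rightarrow> 'b::real_normed_vector) \<Rightarrow> bool" where
  "strongly_measurable f \<longleftrightarrow> (\<exists>s. (\<forall>k. simple_function leb01 (s k)) \<and> (AE t in leb01. (\<lambda>k. s k t) \<longlonglongrightarrow> f t))"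

lemma bochner_L2_UNIV:
  "f \<in> bochner_L2 UNIV norm \<longleftrightarrow> strongly_measurable f \<and> integrable leb01 (\<lambda>t. (norm (f t))\<^sup>2)"
  by (simp add: bochner_L2_def strongly_measurable_def tendsto_norm_zero_iff LIM_zero_iff)

text \<open>For a simple function in place of \<open>f\<close> the composition consists of finitely
  many measurable pieces; continuity in \<open>h\<close> carries measurability to the limit.\<close>

lemma strongly_measurable_comp:
  fixes g :: "'b::real_normed_vector \<Rightarrow> real \<Rightarrow> 'c::euclidean_space"
  assumes f: "strongly_measurable f"
    and g: "\<And>h. g h \<in> borel_measurable leb01" and cont: "\<And>t h. t \<in> {0..1} \<Longrightarrow> isCont (\<lambda>h. g h t) h"
  shows "(\<lambda>t. g (f t) t) \<in> borel_measurable leb01"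
proof -
  obtain s where s: "\<And>k. simple_function leb01 (s k)" "AE t in leb01. (\<lambda>k. s k t) \<longlonglongrightarrow> f t"
    using f unfolding strongly_measurable_def by blast
  show ?thesis
  proof (rule AE_limit_measurable)
    fix k
    have fin: "finite (s k ` {0..1})" using s(1)[of k] by (simp add: simple_function_def)
    show "(\<lambda>t. g (s k t) t) \<in> borel_measurable leb01"
    proof (rule measurable_compose_countable'[where I = "s k ` {0..1}" and f = g and g = "s k"])
      show "s k \<in> leb01 \<rightarrow>\<^sub>M count_space (s k ` {0..1})"
        using s(1)[of k] by (auto simp: measurable_count_space_eq2[OF fin] simple_function_def)
      show "countable (s k ` {0..1})" using fin by (rule countable_finite)
    qed (rule g)
  next
    show "AE t in leb01. (\<lambda>k. g (s k t) t) \<longlonglongrightarrow> g (f t) t"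
      using s(2) by (rule AE_mp) (auto intro!: AE_I2 isCont_tendsto_compose[OF cont])
  qed
qed

lemma strongly_measurable_norm: "strongly_measurable f \<Longrightarrow> (\<lambda>t. norm (f t)) \<in> borel_measurable leb01"
  using strongly_measurable_comp[of f "\<lambda>h t. norm h"] by (simp add: continuous_intros)

lemma strongly_measurable_lincomb:
  assumes "strongly_measurable f" "strongly_measurable g"
  shows "strongly_measurable (\<lambda>t. \<alpha> *\<^sub>R f t + \<beta> *\<^sub>R g t)"
proof -
  obtain s where s: "\<And>k. simple_function leb01 (s k)" "AE t in leb01. (\<lambda>k. s k t) \<longlonglongrightarrow> f t"
    using assms(1) unfolding strongly_measurable_def by blast
  obtain r where r: "\<And>k. simple_function leb01 (r k)" "AE t in leb01. (\<lambda>k. r k t) \<longlonglongrightarrow> g t"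
    using assms(2) unfolding strongly_measurable_def by blast
  have "AE t in leb01. (\<lambda>k. \<alpha> *\<^sub>R s k t + \<beta> *\<^sub>R r k t) \<longlonglongrightarrow> \<alpha> *\<^sub>R f t + \<beta> *\<^sub>R g t"
    using s(2) r(2) by eventually_elim (intro tendsto_intros)
  moreover have "\<And>k. simple_function leb01 (\<lambda>t. \<alpha> *\<^sub>R s k t + \<beta> *\<^sub>R r k t)"
    using s(1) r(1) by (rule simple_function_compose2)
  ultimately show ?thesis unfolding strongly_measurable_def
    by (intro exI[of _ "\<lambda>k t. \<alpha> *\<^sub>R s k t + \<beta> *\<^sub>R r k t"]) simp
qed

lemma bochner_L2_lincomb:
  fixes f g :: "real \<Rightarrow> 'b::real_normed_vector"
  assumes "f \<in> bochner_L2 UNIV norm" "g \<in> bochner_L2 UNIV norm"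
  shows "(\<lambda>t. \<alpha> *\<^sub>R f t + \<beta> *\<^sub>R g t) \<in> bochner_L2 UNIV norm"
  unfolding bochner_L2_UNIV
proof
  show s: "strongly_measurable (\<lambda>t. \<alpha> *\<^sub>R f t + \<beta> *\<^sub>R g t)"
    using assms by (auto simp: bochner_L2_UNIV intro: strongly_measurable_lincomb)
  show "integrable leb01 (\<lambda>t. (norm (\<alpha> *\<^sub>R f t + \<beta> *\<^sub>R g t))\<^sup>2)"
  proof (rule Bochner_Integration.integrable_bound)
    show "integrable leb01 (\<lambda>t. 2 * \<alpha>\<^sup>2 * (norm (f t))\<^sup>2 + 2 * \<beta>\<^sup>2 * (norm (g t))\<^sup>2)"
      using assms by (auto simp: bochner_L2_UNIV)
    show "(\<lambda>t. (norm (\<alpha> *\<^sub>R f t + \<beta> *\<^sub>R g t))\<^sup>2) \<in> borel_measurable leb01"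
      using strongly_measurable_norm[OF s] by measurable
    show "AE t in leb01. norm ((norm (\<alpha> *\<^sub>R f t + \<beta> *\<^sub>R g t))\<^sup>2) \<le> norm (2 * \<alpha>\<^sup>2 * (norm (f t))\<^sup>2 + 2 * \<beta>\<^sup>2 * (norm (g t))\<^sup>2)"
    proof (rule AE_I2)
      fix t
      have "(norm (\<alpha> *\<^sub>R f t + \<beta> *\<^sub>R g t))\<^sup>2 \<le> 2 * (norm (\<alpha> *\<^sub>R f t))\<^sup>2 + 2 * (norm (\<beta> *\<^sub>R g t))\<^sup>2"
        by (rule power2_le_two_sum[OF norm_ge_zero norm_triangle_ineq])
      then show "norm ((norm (\<alpha> *\<^sub>R f t + \<beta> *\<^sub>R g t))\<^sup>2) \<le> norm (2 * \<alpha>\<^sup>2 * (norm (f t))\<^sup>2 + 2 * \<beta>\<^sup>2 * (norm (g t))\<^sup>2)"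
        by (simp add: power_mult_distrib)
    qed
  qed
qed

lemma bochner_L2_diff:
  fixes f g :: "real \<Rightarrow> 'b::real_normed_vector"
  assumes "f \<in> bochner_L2 UNIV norm" "g \<in> bochner_L2 UNIV norm"
  shows "(\<lambda>t. f t - g t) \<in> bochner_L2 UNIV norm"
  using bochner_L2_lincomb[OF assms, of 1 "-1"] by simp

definition energy :: "(real \<Rightarrow> 'b::real_normed_vector) \<Rightarrow> real" where
  "energy f = (LINT t|leb01. (norm (f t))\<^sup>2)"

lemma energy_nonneg: "0 \<le> energy f" by (simp add: energy_def)

text \<open>Phrased with the midpoint because midpoints are the only convex combinations formed
  below.\<close>

lemma energy_parallelogram:
  fixes f g :: "real \<Rightarrow> 'b::real_inner"
  assumes f: "f \<in> bochner_L2 UNIV norm" and g: "g \<in> bochner_L2 UNIV norm"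
  shows "energy (\<lambda>t. f t - g t) + 4 * energy (\<lambda>t. (1/2) *\<^sub>R f t + (1/2) *\<^sub>R g t) = 2 * energy f + 2 * energy g"
proof -
  have i: "integrable leb01 (\<lambda>t. (norm (f t))\<^sup>2)" "integrable leb01 (\<lambda>t. (norm (g t))\<^sup>2)"
    "integrable leb01 (\<lambda>t. (norm (f t - g t))\<^sup>2)"
    "integrable leb01 (\<lambda>t. (norm ((1/2) *\<^sub>R f t + (1/2) *\<^sub>R g t))\<^sup>2)"
    using f g bochner_L2_diff[OF f g] bochner_L2_lincomb[OF f g, of "1/2" "1/2"]
    by (auto simp: bochner_L2_UNIV)
  have "energy (\<lambda>t. f t - g t) + 4 * energy (\<lambda>t. (1/2) *\<^sub>R f t + (1/2) *\<^sub>R g t)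
     = (LINT t|leb01. (norm (f t - g t))\<^sup>2 + 4 * (norm ((1/2) *\<^sub>R f t + (1/2) *\<^sub>R g t))\<^sup>2)"
    using i by (simp add: energy_def)
  also have "(\<lambda>t. (norm (f t - g t))\<^sup>2 + 4 * (norm ((1/2) *\<^sub>R f t + (1/2) *\<^sub>R g t))\<^sup>2)
     = (\<lambda>t. 2 * (norm (f t))\<^sup>2 + 2 * (norm (g t))\<^sup>2)"
    by (auto simp: power2_norm_eq_inner inner_add_left inner_add_right inner_diff_left inner_diff_right inner_commute)
  also have "(LINT t|leb01. 2 * (norm (f t))\<^sup>2 + 2 * (norm (g t))\<^sup>2) = 2 * energy f + 2 * energy g"
    using i by (simp add: energy_def)
  finally show ?thesis .
qed

text \<open>The sum of the integrals is finite, so by monotone convergence the sum of the functions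
  is finite almost everywhere. This turns fast convergence in mean into convergence almost
  everywhere.\<close>

lemma AE_summable_geometric:
  fixes f :: "nat \<Rightarrow> 'x \<Rightarrow> real"
  assumes i: "\<And>k. integrable M (f k)" and nn: "\<And>k x. 0 \<le> f k x"
    and le: "\<And>k. (LINT x|M. f k x) \<le> (1/2) ^ k"
  shows "AE x in M. summable (\<lambda>k. f k x)"
proof -
  have m: "\<And>k. f k \<in> borel_measurable M" using i by auto
  have "(\<integral>\<^sup>+x. (\<Sum>k. ennreal (f k x)) \<partial>M) = (\<Sum>k. \<integral>\<^sup>+x. ennreal (f k x) \<partial>M)"
    using m by (intro nn_integral_suminf) auto
  also have "\<dots> = (\<Sum>k. ennreal (LINT x|M. f k x))"
    by (intro suminf_cong nn_integral_eq_integral i AE_I2 nn)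
  also have "\<dots> \<le> (\<Sum>k. ennreal ((1/2) ^ k))"
    by (intro suminf_le ennreal_leI le) auto
  also have "\<dots> = ennreal (\<Sum>k. (1/2) ^ k)"
    by (intro suminf_ennreal2) (auto intro: summable_geometric)
  also have "\<dots> < \<infinity>" by simp
  finally have "AE x in M. (\<Sum>k. ennreal (f k x)) \<noteq> \<infinity>"
    using m by (intro nn_integral_noteq_infinite) auto
  then show ?thesis
    by eventually_elim (rule summable_suminf_not_top, auto simp: nn)
qed

lemma LINT_norm_le_energy:
  assumes "f \<in> bochner_L2 UNIV norm"
  shows "integrable leb01 (\<lambda>t. norm (f t))" "(LINT t|leb01. norm (f t))\<^sup>2 \<le> energy f"
proof -
  have f: "(\<lambda>t. norm (f t)) \<in> borel_measurable leb01" "integrable leb01 (\<lambda>t. (norm (f t))\<^sup>2)"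
    using assms by (auto simp: bochner_L2_UNIV intro: strongly_measurable_norm)
  show "integrable leb01 (\<lambda>t. norm (f t))" "(LINT t|leb01. norm (f t))\<^sup>2 \<le> energy f"
    using integrable_mult_square[OF f, of "\<lambda>_. 1"] cauchy_schwarz_integral[OF f, of "\<lambda>_. 1"]
    by (auto simp: energy_def measure_leb01)
qed

text \<open>Truncation at 1 makes dominated convergence applicable to functions that may fail to be
  integrable; the truncated mean distance is one for convergence in measure.\<close>

lemma strongly_measurable_approx:
  assumes f: "strongly_measurable f" and e: "0 < e"
  shows "\<exists>s. simple_function leb01 s \<and> (\<lambda>t. norm (s t - f t)) \<in> borel_measurable leb01 \<and>
    (LINT t|leb01. min 1 (norm (s t - f t))) \<le> e"
proof -
  obtain s where s: "\<And>k. simple_function leb01 (s k)" "AE t in leb01. (\<lambda>k. s k t) \<longlonglongrightarrow> f t"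
    using f unfolding strongly_measurable_def by blast
  have m: "(\<lambda>t. norm (s k t - f t)) \<in> borel_measurable leb01" for k
  proof -
    have "strongly_measurable (s k)"
      unfolding strongly_measurable_def using s(1) by (intro exI[of _ "\<lambda>_. s k"]) auto
    from strongly_measurable_lincomb[OF this f, of 1 "-1"] show ?thesis
      by (intro strongly_measurable_norm) simp
  qed
  have "(\<lambda>k. LINT t|leb01. min 1 (norm (s k t - f t))) \<longlonglongrightarrow> (LINT t|leb01. 0)"
  proof (rule integral_dominated_convergence[where w = "\<lambda>_. 1"])
    show "AE t in leb01. (\<lambda>k. min 1 (norm (s k t - f t))) \<longlonglongrightarrow> 0"
      using s(2)
    proof eventually_elim
      fix t assume "(\<lambda>k. s k t) \<longlonglongrightarrow> f t"
      then have "(\<lambda>k. min 1 (norm (s k t - f t))) \<longlonglongrightarrow> min 1 (norm (f t - f t))"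
        by (intro tendsto_intros)
      then show "(\<lambda>k. min 1 (norm (s k t - f t))) \<longlonglongrightarrow> 0" by simp
    qed
  qed (use m in \<open>auto intro!: borel_measurable_min\<close>)
  then have "(\<lambda>k. LINT t|leb01. min 1 (norm (s k t - f t))) \<longlonglongrightarrow> 0" by simp
  then obtain k where "norm (LINT t|leb01. min 1 (norm (s k t - f t))) < e"
    using e unfolding LIMSEQ_iff by (metis diff_zero le_refl)
  then show ?thesis using s(1) m by (intro exI[of _ "s k"]) auto
qed

text \<open>A diagonal sequence: \<open>s k\<close> is chosen within \<open>(1/2) ^ k\<close> of
  \<open>g k\<close> in truncated mean distance, so the distances are summable, hence null, almost
  everywhere.\<close>

lemma strongly_measurable_limit:
  fixes f :: "real \<Rightarrow> 'b::real_normed_vector"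
  assumes g: "\<And>k. strongly_measurable (g k)" and lim: "AE t in leb01. (\<lambda>k. g k t) \<longlonglongrightarrow> f t"
  shows "strongly_measurable f"
proof -
  have "\<forall>k. \<exists>s. simple_function leb01 s \<and> (\<lambda>t. norm (s t - g k t)) \<in> borel_measurable leb01 \<and>
    (LINT t|leb01. min 1 (norm (s t - g k t))) \<le> (1/2) ^ k"
    using g by (intro allI strongly_measurable_approx) auto
  from choice[OF this] obtain s where "\<forall>k. simple_function leb01 (s k) \<and>
    (\<lambda>t. norm (s k t - g k t)) \<in> borel_measurable leb01 \<and>
    (LINT t|leb01. min 1 (norm (s k t - g k t))) \<le> (1/2) ^ k" ..
  then have s: "\<And>k. simple_function leb01 (s k)"
    "\<And>k. (\<lambda>t. norm (s k t - g k t)) \<in> borel_measurable leb01"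
    "\<And>k. (LINT t|leb01. min 1 (norm (s k t - g k t))) \<le> (1/2) ^ k"
    by blast+
  have "AE t in leb01. summable (\<lambda>k. min 1 (norm (s k t - g k t)))"
  proof (rule AE_summable_geometric)
    fix k
    show "integrable leb01 (\<lambda>t. min 1 (norm (s k t - g k t)))"
      by (rule Bochner_Integration.integrable_bound[where f = "\<lambda>_. 1::real"]) (use s(2)[of k] in auto)
  qed (use s(3) in auto)
  with lim have "AE t in leb01. (\<lambda>k. s k t) \<longlonglongrightarrow> f t"
  proof eventually_elim
    fix t assume l: "(\<lambda>k. g k t) \<longlonglongrightarrow> f t" and "summable (\<lambda>k. min 1 (norm (s k t - g k t)))"
    then have m: "(\<lambda>k. min 1 (norm (s k t - g k t))) \<longlonglongrightarrow> 0" by (intro summable_LIMSEQ_zero)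
    then have "eventually (\<lambda>k. min 1 (norm (s k t - g k t)) < 1) sequentially"
      by (rule order_tendstoD) simp
    \<comment> \<open>A truncated norm below 1 is the norm itself.\<close>
    then have "eventually (\<lambda>k. min 1 (norm (s k t - g k t)) = norm (s k t - g k t)) sequentially"
      by eventually_elim auto
    from Lim_transform_eventually[OF m this] have "(\<lambda>k. norm (s k t - g k t)) \<longlonglongrightarrow> 0" .
    then have "(\<lambda>k. s k t - g k t) \<longlonglongrightarrow> 0" by (rule tendsto_norm_zero_cancel)
    from tendsto_add[OF this l] show "(\<lambda>k. s k t) \<longlonglongrightarrow> f t" by simp
  qed
  then show ?thesis unfolding strongly_measurable_def using s(1) by blast
qed

section \<open>Completeness of the space of square integrable paths\<close>

lemma summable_dist_imp_convergent:
  fixes y :: "nat \<Rightarrow> 'b::{real_normed_vector,complete_space}"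
  assumes "summable (\<lambda>k. norm (y (Suc k) - y k))"
  shows "convergent y"
proof -
  have "Cauchy y"
    unfolding Cauchy_altdef
  proof (intro allI impI)
    fix e :: real assume "0 < e"
    then obtain N where N: "\<And>m n. m \<ge> N \<Longrightarrow> norm (sum (\<lambda>k. norm (y (Suc k) - y k)) {m..<n}) < e"
      using assms unfolding summable_Cauchy by blast
    have "dist (y m) (y n) < e" if "m \<ge> N" "n > m" for m n
    proof -
      have "y n - y m = (\<Sum>k\<in>{m..<n}. y (Suc k) - y k)"
        using that by (simp add: sum_Suc_diff')
      then have "norm (y n - y m) \<le> (\<Sum>k\<in>{m..<n}. norm (y (Suc k) - y k))"
        by (simp add: norm_sum)
      also have "\<dots> < e" using N[OF that(1), of n] by simp
      finally show ?thesis by (simp add: dist_norm norm_minus_commute)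
    qed
    then show "\<exists>M. \<forall>m\<ge>M. \<forall>n>m. dist (y m) (y n) < e" by blast
  qed
  then show ?thesis by (rule Cauchy_convergent)
qed

lemma fast_subsequence:
  fixes d :: "nat \<Rightarrow> nat \<Rightarrow> real" and e :: "nat \<Rightarrow> real"
  assumes "\<And>e. 0 < e \<Longrightarrow> \<exists>M. \<forall>m\<ge>M. \<forall>n\<ge>M. d m n < e" and e: "\<And>k. 0 < e k"
  shows "\<exists>r. strict_mono r \<and> (\<forall>k. \<forall>m\<ge>r k. \<forall>n\<ge>r k. d m n < e k)"
proof -
  obtain M where M: "\<And>k m n. m \<ge> M k \<Longrightarrow> n \<ge> M k \<Longrightarrow> d m n < e k"
    using assms(1)[OF e] by metis
  define r where "r = rec_nat (M 0) (\<lambda>k p. max (Suc p) (M (Suc k)))"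
  have r: "r 0 = M 0" "r (Suc k) = max (Suc (r k)) (M (Suc k))" for k by (simp_all add: r_def)
  have "r k \<ge> M k" for k by (cases k) (simp_all add: r)
  then have "\<forall>k. \<forall>m\<ge>r k. \<forall>n\<ge>r k. d m n < e k" using M by (meson order_trans)
  moreover have "strict_mono r" by (rule strict_monoI_Suc) (simp add: r)
  ultimately show ?thesis by blast
qed

lemma quarter_power: "(1/4::real) ^ k = ((1/2) ^ k)\<^sup>2"
  by (induction k) (simp_all add: power2_eq_square)

text \<open>Riesz--Fischer: a rapidly Cauchy subsequence converges almost everywhere, and Fatou
  transfers the energy bounds on differences to its limit.\<close>

lemma bochner_L2_complete:
  fixes y :: "nat \<Rightarrow> real \<Rightarrow> 'b::{real_inner,complete_space}"
  assumes y: "\<And>m. y m \<in> bochner_L2 UNIV norm"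
    and cauchy: "\<And>e. 0 < e \<Longrightarrow> \<exists>M. \<forall>m\<ge>M. \<forall>n\<ge>M. energy (\<lambda>t. y m t - y n t) < e"
  shows "\<exists>v\<in>bochner_L2 UNIV norm. (\<lambda>m. energy (\<lambda>t. y m t - v t)) \<longlonglongrightarrow> 0"
proof -
  have yd: "(\<lambda>t. y m t - y n t) \<in> bochner_L2 UNIV norm" for m n by (intro bochner_L2_diff y)
  \<comment> \<open>Energies are squared norms, so the rate 1/4 yields the geometric series with
    ratio 1/2 for the norms.\<close>
  obtain r where r: "strict_mono r" "\<And>k m n. m \<ge> r k \<Longrightarrow> n \<ge> r k \<Longrightarrow> energy (\<lambda>t. y m t - y n t) < (1/4) ^ k"
    using fast_subsequence[OF cauchy, of "\<lambda>k. (1/4)^k"] by auto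
  have "AE t in leb01. summable (\<lambda>k. norm (y (r (Suc k)) t - y (r k) t))"
  proof (rule AE_summable_geometric)
    fix k
    show "integrable leb01 (\<lambda>t. norm (y (r (Suc k)) t - y (r k) t))"
      by (rule LINT_norm_le_energy(1)[OF yd])
    have "(LINT t|leb01. norm (y (r (Suc k)) t - y (r k) t))\<^sup>2 \<le> energy (\<lambda>t. y (r (Suc k)) t - y (r k) t)"
      by (rule LINT_norm_le_energy(2)[OF yd])
    also have "\<dots> \<le> (1/4) ^ k"
      using strict_mono_leD[OF r(1)] by (intro less_imp_le[OF r(2)[of k]]) auto
    also have "\<dots> = ((1/2) ^ k)\<^sup>2"  by (rule quarter_power)
    finally show "(LINT t|leb01. norm (y (r (Suc k)) t - y (r k) t)) \<le> (1/2) ^ k"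
      by (rule power2_le_imp_le) simp
  qed simp
  then have conv: "AE t in leb01. convergent (\<lambda>k. y (r k) t)"
    by eventually_elim (rule summable_dist_imp_convergent)
  define v where "v t = lim (\<lambda>k. y (r k) t)" for t
  have lim: "AE t in leb01. (\<lambda>k. y (r k) t) \<longlonglongrightarrow> v t"
    using conv by eventually_elim (simp add: v_def convergent_LIMSEQ_iff)
  have sv: "strongly_measurable v"
    by (rule strongly_measurable_limit[OF _ lim]) (use y in \<open>auto simp: bochner_L2_UNIV\<close>)
  have svd: "strongly_measurable (\<lambda>t. y m t - v t)" for m
    using strongly_measurable_lincomb[OF _ sv, of "y m" 1 "-1"] y[of m] by (simp add: bochner_L2_UNIV)
  have nn: "(\<integral>\<^sup>+t. ennreal ((norm (y m t - v t))\<^sup>2) \<partial>leb01) \<le> ennreal ((1/4) ^ k)" if m: "m \<ge> r k" for m k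
  proof -
    have meas: "(\<lambda>t. ennreal ((norm (y m t - y (r j) t))\<^sup>2)) \<in> borel_measurable leb01" for j
    proof -
      have [measurable]: "(\<lambda>t. norm (y m t - y (r j) t)) \<in> borel_measurable leb01"
        using yd[of m "r j"] by (intro strongly_measurable_norm) (simp add: bochner_L2_UNIV)
      show ?thesis by measurable
    qed
    have "(\<integral>\<^sup>+t. ennreal ((norm (y m t - v t))\<^sup>2) \<partial>leb01) =
        (\<integral>\<^sup>+t. liminf (\<lambda>j. ennreal ((norm (y m t - y (r j) t))\<^sup>2)) \<partial>leb01)"
    proof (rule nn_integral_cong_AE)
      show "AE t in leb01. ennreal ((norm (y m t - v t))\<^sup>2) = liminf (\<lambda>j. ennreal ((norm (y m t - y (r j) t))\<^sup>2))"
        using lim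
      proof eventually_elim
        fix t assume "(\<lambda>k. y (r k) t) \<longlonglongrightarrow> v t"
        then have "(\<lambda>j. ennreal ((norm (y m t - y (r j) t))\<^sup>2)) \<longlonglongrightarrow> ennreal ((norm (y m t - v t))\<^sup>2)"
          by (intro tendsto_intros)
        then show "ennreal ((norm (y m t - v t))\<^sup>2) = liminf (\<lambda>j. ennreal ((norm (y m t - y (r j) t))\<^sup>2))"
          by (intro lim_imp_Liminf[symmetric]) auto
      qed
    qed
    also have "\<dots> \<le> liminf (\<lambda>j. \<integral>\<^sup>+t. ennreal ((norm (y m t - y (r j) t))\<^sup>2) \<partial>leb01)"
      by (rule nn_integral_liminf[OF meas])
    also have "\<dots> \<le> ennreal ((1/4) ^ k)"
    proof (rule Liminf_le)
      show "\<forall>\<^sub>F j in sequentially. (\<integral>\<^sup>+t. ennreal ((norm (y m t - y (r j) t))\<^sup>2) \<partial>leb01) \<le> ennreal ((1/4) ^ k)"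
      proof (rule eventually_sequentiallyI)
        fix j assume j: "k \<le> j"
        have "(\<integral>\<^sup>+t. ennreal ((norm (y m t - y (r j) t))\<^sup>2) \<partial>leb01) = ennreal (energy (\<lambda>t. y m t - y (r j) t))"
          unfolding energy_def using yd[of m "r j"] by (intro nn_integral_eq_integral) (auto simp: bochner_L2_UNIV)
        also have "\<dots> \<le> ennreal ((1/4) ^ k)"
          using j m r(1) by (intro ennreal_leI less_imp_le[OF r(2)[of k]]) (auto simp: strict_mono_less_eq)
        finally show "(\<integral>\<^sup>+t. ennreal ((norm (y m t - y (r j) t))\<^sup>2) \<partial>leb01) \<le> ennreal ((1/4) ^ k)" .
      qed
    qed simp
    finally show ?thesis .
  qed
  have dm: "(\<lambda>t. (norm (y m t - v t))\<^sup>2) \<in> borel_measurable leb01" for m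
    using strongly_measurable_norm[OF svd[of m]] by measurable
  \<comment> \<open>Fatou bounds differences only, so square integrability of \<open>v\<close> is
    obtained from that of \<open>y (r 0) - v\<close>.\<close>
  have "integrable leb01 (\<lambda>t. (norm (y (r 0) t - v t))\<^sup>2)"
    by (rule integrableI_nonneg[OF dm]) (use nn[of 0 "r 0"] in \<open>auto simp: less_top[symmetric] top_unique\<close>)
  then have "(\<lambda>t. y (r 0) t - v t) \<in> bochner_L2 UNIV norm"
    using svd by (simp add: bochner_L2_UNIV)
  from bochner_L2_diff[OF y[of "r 0"] this] have v: "v \<in> bochner_L2 UNIV norm" by simp
  have "(\<lambda>m. energy (\<lambda>t. y m t - v t)) \<longlonglongrightarrow> 0"
  proof (rule LIMSEQ_I)
    fix e :: real assume "0 < e"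
    then obtain k where k: "(1/4) ^ k < e" using real_arch_pow_inv[of e "1/4"] by auto
    have "norm (energy (\<lambda>t. y m t - v t) - 0) < e" if "m \<ge> r k" for m
    proof -
      have "energy (\<lambda>t. y m t - v t) \<le> (1/4) ^ k"
        unfolding energy_def by (rule integral_real_bounded[OF _ nn[OF that]]) simp
      then show ?thesis using k energy_nonneg[of "\<lambda>t. y m t - v t"] by simp
    qed
    then show "\<exists>M. \<forall>m\<ge>M. norm (energy (\<lambda>t. y m t - v t) - 0) < e" by blast
  qed
  then show ?thesis using v by blast
qed

subsection \<open>Weak limits by midpoint combinations\<close>

text \<open>The dyadic convex combinations of the tail from \<open>m\<close> on. Closure under
  midpoints is all that the parallelogram identity asks for, and the inductive form replaces
  bookkeeping of weights by induction.\<close>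

inductive_set mid_hull :: "(nat \<Rightarrow> real \<Rightarrow> 'b::real_vector) \<Rightarrow> nat \<Rightarrow> (real \<Rightarrow> 'b) set" for z m where
  base: "m \<le> j \<Longrightarrow> z j \<in> mid_hull z m"
| mid: "y \<in> mid_hull z m \<Longrightarrow> y' \<in> mid_hull z m \<Longrightarrow> (\<lambda>t. (1/2) *\<^sub>R y t + (1/2) *\<^sub>R y' t) \<in> mid_hull z m"

lemma mid_hull_antimono: "m \<le> n \<Longrightarrow> y \<in> mid_hull z n \<Longrightarrow> y \<in> mid_hull z m"
  by (rotate_tac, induction rule: mid_hull.induct) (auto intro: mid_hull.intros)

lemma mid_hull_bochner_L2:
  fixes z :: "nat \<Rightarrow> real \<Rightarrow> 'b::real_normed_vector"
  assumes "\<And>j. z j \<in> bochner_L2 UNIV norm" "y \<in> mid_hull z m"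
  shows "y \<in> bochner_L2 UNIV norm"
  using assms(2) by induction (use assms(1) bochner_L2_lincomb in auto)

text \<open>By the parallelogram identity the energy of a midpoint is at most the mean of the two
  energies.\<close>

lemma energy_mid_hull_le:
  fixes z :: "nat \<Rightarrow> real \<Rightarrow> 'b::real_inner"
  assumes z: "\<And>j. z j \<in> bochner_L2 UNIV norm" and B: "\<And>j. m \<le> j \<Longrightarrow> energy (z j) \<le> B"
    and y: "y \<in> mid_hull z m"
  shows "energy y \<le> B"
  using y
proof induction
  case (mid y y')
  have "y \<in> bochner_L2 UNIV norm" "y' \<in> bochner_L2 UNIV norm"
    using mid_hull_bochner_L2[OF z] mid by auto
  from energy_parallelogram[OF this] show ?case
    using mid energy_nonneg[of "\<lambda>t. y t - y' t"] by linarith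
qed (rule B)

text \<open>The argument for the element of least norm in a convex set, run along the shrinking
  hulls. Their infima \<open>d m\<close> increase to a limit \<open>L\<close>. Near-minimizers with
  indices from \<open>k\<close> on have energy below \<open>L + 1 / Suc k\<close>, while their
  midpoint lies in the hull at \<open>k\<close> and has energy at least \<open>d k\<close>; the
  parallelogram identity bounds the energy of their difference.\<close>

lemma mid_hull_cauchy:
  fixes z :: "nat \<Rightarrow> real \<Rightarrow> 'b::real_inner"
  assumes z: "\<And>j. z j \<in> bochner_L2 UNIV norm" and M: "\<And>j. energy (z j) \<le> M"
  shows "\<exists>y. (\<forall>m. y m \<in> mid_hull z m) \<and>
    (\<forall>e>0. \<exists>N. \<forall>m\<ge>N. \<forall>n\<ge>N. energy (\<lambda>t. y m t - y n t) < e)"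
proof -
  define d where "d m = Inf (energy ` mid_hull z m)" for m
  have bdd: "bdd_below (energy ` mid_hull z m)" for m
    by (rule bdd_belowI[of _ 0]) (auto simp: energy_nonneg)
  have le: "d m \<le> energy y" if "y \<in> mid_hull z m" for y m
    unfolding d_def using that bdd by (intro cInf_lower) auto
  have ne: "z m \<in> mid_hull z m" for m by (rule mid_hull.base) simp
  have "\<exists>y. y \<in> mid_hull z m \<and> energy y < d m + 1 / Suc m" for m
  proof -
    have "\<exists>q\<in>energy ` mid_hull z m. q < d m + 1 / Suc m"
      using ne[of m] unfolding d_def by (intro cInf_lessD) auto
    then show ?thesis by auto
  qed
  then obtain y where y: "\<And>m. y m \<in> mid_hull z m" "\<And>m. energy (y m) < d m + 1 / Suc m"
    by metis
  have dmono: "d m \<le> d n" if "m \<le> n" for m n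
    unfolding d_def
  proof (rule cInf_superset_mono)
    show "energy ` mid_hull z n \<noteq> {}" using ne[of n] by blast
  qed (use mid_hull_antimono[OF that] bdd in auto)
  have "d m \<le> M" for m using le[OF ne[of m]] M[of m] by linarith
  then obtain L where L: "d \<longlonglongrightarrow> L"
    using incseq_convergent[of d M] dmono unfolding incseq_def by metis
  have dL: "d m \<le> L" for m using incseq_le[OF _ L] dmono by (auto simp: incseq_def)
  have key: "energy (\<lambda>t. y m t - y n t) \<le> 4 * (L - d k) + 4 / Suc k" if "k \<le> m" "k \<le> n" for m n k
  proof -
    have yk: "y m \<in> mid_hull z k" "y n \<in> mid_hull z k"
      using y(1) mid_hull_antimono that by blast+
    then have L2: "y m \<in> bochner_L2 UNIV norm" "y n \<in> bochner_L2 UNIV norm"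
      using mid_hull_bochner_L2[OF z] by auto
    have "d k \<le> energy (\<lambda>t. (1/2) *\<^sub>R y m t + (1/2) *\<^sub>R y n t)"
      by (intro le mid_hull.mid yk)
    moreover have "energy (y m) < L + 1 / Suc k" "energy (y n) < L + 1 / Suc k"
    proof -
      have "1 / Suc m \<le> 1 / Suc k" "1 / Suc n \<le> 1 / Suc k"
        using that by (auto simp: field_simps)
      then show "energy (y m) < L + 1 / Suc k" "energy (y n) < L + 1 / Suc k"
        using y(2)[of m] y(2)[of n] dL[of m] dL[of n] by linarith+
    qed
    ultimately show ?thesis
      using energy_parallelogram[OF L2] by (simp add: algebra_simps)
  qed
  have "(\<lambda>k. 4 * (L - d k) + 4 / Suc k) \<longlonglongrightarrow> 4 * (L - L) + 0"
    by (intro tendsto_intros L LIMSEQ_Suc lim_const_over_n)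
  then have lim: "(\<lambda>k. 4 * (L - d k) + 4 / Suc k) \<longlonglongrightarrow> 0" by simp
  have "\<exists>N. \<forall>m\<ge>N. \<forall>n\<ge>N. energy (\<lambda>t. y m t - y n t) < e" if e: "0 < e" for e
  proof -
    have "eventually (\<lambda>k. 4 * (L - d k) + 4 / Suc k < e) sequentially"
      by (rule order_tendstoD(2)[OF lim e])
    then obtain k where "4 * (L - d k) + 4 / Suc k < e" by (auto simp: eventually_sequentially)
    then show ?thesis using key[of k] by (meson le_less_trans)
  qed
  then show ?thesis using y(1) by blast
qed

lemma norm_LINT_le_energy:
  fixes f :: "real \<Rightarrow> 'c::euclidean_space"
  assumes z: "z \<in> bochner_L2 UNIV norm" and f: "f \<in> borel_measurable leb01"
    and le: "\<And>s. s \<in> {0..1} \<Longrightarrow> norm (f s) \<le> c * norm (z s)" and c: "0 \<le> c" and t: "t \<in> {0..1}"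
  shows "norm (LINT s|lebesgue_on {0..t}. f s) \<le> c * sqrt (energy z)"
proof -
  have n: "integrable leb01 (\<lambda>s. norm (z s))" by (rule LINT_norm_le_energy(1)[OF z])
  have nt: "integrable (lebesgue_on {0..t}) (\<lambda>s. norm (z s))"
    by (rule integrable_sub01[OF n]) (use t in auto)
  have "norm (LINT s|lebesgue_on {0..t}. f s) \<le> (LINT s|lebesgue_on {0..t}. c * norm (z s))"
    by (rule norm_LINT_le(2)) (use t nt measurable_sub01[OF f, of 0 t] le in auto)
  also have "\<dots> = c * (LINT s|lebesgue_on {0..t}. norm (z s))" by simp
  also have "(LINT s|lebesgue_on {0..t}. norm (z s)) = integral {0..t} (\<lambda>s. norm (z s))"
    by (rule lebesgue_integral_eq_integral[OF nt]) simp
  also have "\<dots> \<le> integral {0..1} (\<lambda>s. norm (z s))"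
    using integrable_on_lebesgue_on[OF n] integrable_on_lebesgue_on[OF nt] t by (intro integral_subset_le) auto
  also have "\<dots> = (LINT s|leb01. norm (z s))"
    by (rule lebesgue_integral_eq_integral[OF n, symmetric]) simp
  also have "\<dots> \<le> sqrt (energy z)"
    by (rule real_le_rsqrt[OF LINT_norm_le_energy(2)[OF z]])
  finally show ?thesis using c by (simp add: mult_left_mono)
qed

text \<open>\<open>G\<close> is the density of the functionals that send a path \<open>f\<close> to
  the integral of \<open>G (f s) s\<close>. Measurability in \<open>s\<close> is asked for fixed
  \<open>h\<close> only; \<open>strongly_measurable_comp\<close> extends it to paths.\<close>

definition linear_functional_density :: "('b::real_normed_vector \<Rightarrow> real \<Rightarrow> 'c::euclidean_space) \<Rightarrow> real \<Rightarrow> bool" where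
  "linear_functional_density G C \<longleftrightarrow> (\<forall>h. G h \<in> borel_measurable leb01) \<and>
     (\<forall>s\<in>{0..1}. linear (\<lambda>h. G h s) \<and> (\<forall>h. norm (G h s) \<le> C * norm h))"

lemma linear_functional_density_integral:
  fixes G :: "'b::real_normed_vector \<Rightarrow> real \<Rightarrow> 'c::euclidean_space"
  assumes G: "linear_functional_density G C" and f: "f \<in> bochner_L2 UNIV norm" and C: "0 \<le> C"
  shows "integrable leb01 (\<lambda>s. G (f s) s)"
    and "t \<in> {0..1} \<Longrightarrow> norm (LINT s|lebesgue_on {0..t}. G (f s) s) \<le> C * sqrt (energy f)"
proof -
  have "(\<lambda>s. G (f s) s) \<in> borel_measurable leb01"
  proof (rule strongly_measurable_comp[where g = G and f = f])
    show "strongly_measurable f" using f by (simp add: bochner_L2_UNIV)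
    show "G h \<in> borel_measurable leb01" for h using G by (simp add: linear_functional_density_def)
    fix t :: real and h assume t: "t \<in> {0..1}"
    have "bounded_linear (\<lambda>h. G h t)"
      using G t unfolding linear_functional_density_def bounded_linear_def bounded_linear_axioms_def
      by (metis mult.commute)
    then show "isCont (\<lambda>h. G h t) h" by (rule linear_continuous_at)
  qed
  note m = this
  then show "integrable leb01 (\<lambda>s. G (f s) s)"
    by (rule norm_LINT_le(1)[rotated, where g = "\<lambda>s. C * norm (f s)"])
      (use G LINT_norm_le_energy(1)[OF f] in \<open>auto simp: linear_functional_density_def\<close>)
  show "norm (LINT s|lebesgue_on {0..t}. G (f s) s) \<le> C * sqrt (energy f)" if "t \<in> {0..1}"
    by (rule norm_LINT_le_energy[OF f m _ C that]) (use G in \<open>auto simp: linear_functional_density_def\<close>)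
qed

text \<open>A ball around \<open>l\<close> is convex and the functional is linear in the path, so
  midpoints stay in the ball.\<close>

lemma functional_mid_hull:
  fixes z :: "nat \<Rightarrow> real \<Rightarrow> 'b::real_normed_vector" and G :: "'b \<Rightarrow> real \<Rightarrow> 'c::euclidean_space"
  assumes z: "\<And>j. z j \<in> bochner_L2 UNIV norm"
    and G: "linear_functional_density G C" and C: "0 \<le> C" and t: "t \<in> {0..1}"
    and e: "\<And>j. m \<le> j \<Longrightarrow> norm ((LINT s|lebesgue_on {0..t}. G (z j s) s) - l) \<le> e"
    and y: "y \<in> mid_hull z m"
  shows "norm ((LINT s|lebesgue_on {0..t}. G (y s) s) - l) \<le> e"
  using y
proof induction
  case (mid y y')
  have i: "integrable (lebesgue_on {0..t}) (\<lambda>s. G (f s) s)" if "f \<in> mid_hull z m" for f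
    using linear_functional_density_integral(1)[OF G mid_hull_bochner_L2[OF z that] C] t
    by (auto intro: integrable_sub01)
  let ?I = "\<lambda>y. LINT s|lebesgue_on {0..t}. G (y s) s"
  have "?I (\<lambda>s. (1/2) *\<^sub>R y s + (1/2) *\<^sub>R y' s) = (LINT s|lebesgue_on {0..t}. (1/2) *\<^sub>R G (y s) s + (1/2) *\<^sub>R G (y' s) s)"
  proof (rule Bochner_Integration.integral_cong)
    fix s assume "s \<in> space (lebesgue_on {0..t})"
    then have "linear (\<lambda>h. G h s)" using G t by (simp add: linear_functional_density_def)
    from linear_add[OF this] linear_scale[OF this]
    show "G ((1/2) *\<^sub>R y s + (1/2) *\<^sub>R y' s) s = (1/2) *\<^sub>R G (y s) s + (1/2) *\<^sub>R G (y' s) s"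
      by simp
  qed simp
  also have "\<dots> = (1/2) *\<^sub>R ?I y + (1/2) *\<^sub>R ?I y'"
    using i[OF mid(1)] i[OF mid(2)] by simp
  finally have "?I (\<lambda>s. (1/2) *\<^sub>R y s + (1/2) *\<^sub>R y' s) - l = (1/2) *\<^sub>R (?I y - l) + (1/2) *\<^sub>R (?I y' - l)"
    by (simp add: algebra_simps) (simp add: scaleR_add_left[symmetric])
  also have "norm \<dots> \<le> norm ((1/2) *\<^sub>R (?I y - l)) + norm ((1/2) *\<^sub>R (?I y' - l))"
    by (rule norm_triangle_ineq)
  also have "\<dots> \<le> e" using mid by simp
  finally show ?case .
qed (rule e)

text \<open>Young's inequality with weight \<epsilon> compares the energies without taking roots of
  them: \<open>m\<close> tends to infinity first, then \<epsilon> to 0.\<close>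

lemma energy_le_limit:
  fixes y :: "nat \<Rightarrow> real \<Rightarrow> 'b::real_normed_vector"
  assumes y: "\<And>m. y m \<in> bochner_L2 UNIV norm" and v: "v \<in> bochner_L2 UNIV norm"
    and lim: "(\<lambda>m. energy (\<lambda>t. y m t - v t)) \<longlonglongrightarrow> 0"
    and B: "eventually (\<lambda>m. energy (y m) \<le> B) sequentially"
  shows "energy v \<le> B"
proof -
  have eps: "energy v \<le> (1 + \<epsilon>) * B" if \<epsilon>: "0 < \<epsilon>" for \<epsilon>
  proof -
    have le: "energy v \<le> (1 + \<epsilon>) * energy (y m) + (1 + 1 / \<epsilon>) * energy (\<lambda>t. y m t - v t)" for m
    proof -
      have i: "integrable leb01 (\<lambda>t. (norm (y m t))\<^sup>2)" "integrable leb01 (\<lambda>t. (norm (y m t - v t))\<^sup>2)"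
        "integrable leb01 (\<lambda>t. (norm (v t))\<^sup>2)"
        using y[of m] v bochner_L2_diff[OF y[of m] v] by (auto simp: bochner_L2_UNIV)
      have "energy v \<le> (LINT t|leb01. (1 + \<epsilon>) * (norm (y m t))\<^sup>2 + (1 + 1 / \<epsilon>) * (norm (y m t - v t))\<^sup>2)"
        unfolding energy_def
      proof (rule Bochner_Integration.integral_mono)
        fix t
        let ?a = "norm (y m t)" and ?b = "norm (y m t - v t)"
        have "norm (v t) \<le> ?a + ?b" using norm_triangle_ineq4[of "y m t" "y m t - v t"] by simp
        then have "(norm (v t))\<^sup>2 \<le> (?a + ?b)\<^sup>2" by (intro power_mono) auto
        also have "\<dots> \<le> (1 + \<epsilon>) * ?a\<^sup>2 + (1 + 1 / \<epsilon>) * ?b\<^sup>2"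
        proof -
          have "0 \<le> (\<epsilon> * ?a - ?b)\<^sup>2 / \<epsilon>" using \<epsilon> by simp
          also have "\<dots> = \<epsilon> * ?a\<^sup>2 - 2 * ?a * ?b + ?b\<^sup>2 / \<epsilon>"
            using \<epsilon> by (simp add: power2_eq_square field_simps)
          finally show ?thesis by (simp add: power2_sum algebra_simps)
        qed
        finally show "(norm (v t))\<^sup>2 \<le> (1 + \<epsilon>) * ?a\<^sup>2 + (1 + 1 / \<epsilon>) * ?b\<^sup>2" .
      qed (use i in auto)
      also have "\<dots> = (1 + \<epsilon>) * energy (y m) + (1 + 1 / \<epsilon>) * energy (\<lambda>t. y m t - v t)"
        using i by (simp add: energy_def)
      finally show ?thesis .
    qed
    have "(\<lambda>m. (1 + \<epsilon>) * B + (1 + 1 / \<epsilon>) * energy (\<lambda>t. y m t - v t)) \<longlonglongrightarrow> (1 + \<epsilon>) * B + (1 + 1 / \<epsilon>) * 0"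
      by (intro tendsto_intros lim)
    moreover have "eventually (\<lambda>m. energy v \<le> (1 + \<epsilon>) * B + (1 + 1 / \<epsilon>) * energy (\<lambda>t. y m t - v t)) sequentially"
      using B
    proof eventually_elim
      fix m assume "energy (y m) \<le> B"
      then have "(1 + \<epsilon>) * energy (y m) \<le> (1 + \<epsilon>) * B" using \<epsilon> by simp
      then show "energy v \<le> (1 + \<epsilon>) * B + (1 + 1 / \<epsilon>) * energy (\<lambda>t. y m t - v t)"
        using le[of m] by linarith
    qed
    ultimately have "energy v \<le> (1 + \<epsilon>) * B + (1 + 1 / \<epsilon>) * 0"
      by (rule tendsto_lowerbound) simp
    then show ?thesis by simp
  qed
  have "((\<lambda>\<epsilon>. (1 + \<epsilon>) * B) \<longlongrightarrow> (1 + 0) * B) (at_right 0)"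
    by (intro tendsto_intros)
  moreover have "eventually (\<lambda>\<epsilon>. energy v \<le> (1 + \<epsilon>) * B) (at_right 0)"
    using eps by (auto simp: eventually_at_right_less intro: eventually_mono[OF eventually_at_right_less])
  ultimately have "energy v \<le> (1 + 0) * B"
    by (rule tendsto_lowerbound) simp
  then show ?thesis by simp
qed

text \<open>A substitute for weak sequential compactness: the strong limit of suitable midpoint
  combinations of the tails (Mazur) does everything the weak limit is needed for.\<close>

lemma bochner_L2_weak_limit:
  fixes z :: "nat \<Rightarrow> real \<Rightarrow> 'b::{real_inner,complete_space}"
  assumes z: "\<And>j. z j \<in> bochner_L2 UNIV norm" and M: "\<And>j. energy (z j) \<le> M"
  obtains v where "v \<in> bochner_L2 UNIV norm"
    and "\<And>B. eventually (\<lambda>j. energy (z j) \<le> B) sequentially \<Longrightarrow> energy v \<le> B"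
    and "\<And>(G :: 'b \<Rightarrow> real \<Rightarrow> 'c::euclidean_space) C t l. linear_functional_density G C \<Longrightarrow> 0 \<le> C \<Longrightarrow> t \<in> {0..1} \<Longrightarrow>
      (\<lambda>j. LINT s|lebesgue_on {0..t}. G (z j s) s) \<longlonglongrightarrow> l \<Longrightarrow> (LINT s|lebesgue_on {0..t}. G (v s) s) = l"
proof -
  obtain y where y: "\<And>m. y m \<in> mid_hull z m"
    and cauchy: "\<And>e. e > 0 \<Longrightarrow> \<exists>N. \<forall>m\<ge>N. \<forall>n\<ge>N. energy (\<lambda>t. y m t - y n t) < e"
    using mid_hull_cauchy[of z M, OF z M] by blast
  have yL2: "y m \<in> bochner_L2 UNIV norm" for m by (rule mid_hull_bochner_L2[OF z y])
  obtain v where v: "v \<in> bochner_L2 UNIV norm" and lim: "(\<lambda>m. energy (\<lambda>t. y m t - v t)) \<longlonglongrightarrow> 0"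
    using bochner_L2_complete[of y, OF yL2 cauchy] by blast
  have 1: "energy v \<le> B" if B: "eventually (\<lambda>j. energy (z j) \<le> B) sequentially" for B
  proof (rule energy_le_limit[OF yL2 v lim])
    obtain N where "\<And>j. j \<ge> N \<Longrightarrow> energy (z j) \<le> B" using B by (auto simp: eventually_sequentially)
    then show "eventually (\<lambda>m. energy (y m) \<le> B) sequentially"
      by (intro eventually_sequentiallyI[of N] energy_mid_hull_le[OF z _ y]) auto
  qed
  have 2: "(LINT s|lebesgue_on {0..t}. G (v s) s) = l"
    if G: "linear_functional_density G C" and C: "0 \<le> C" and t: "t \<in> {0..1}"
      and l: "(\<lambda>j. LINT s|lebesgue_on {0..t}. G (z j s) s) \<longlonglongrightarrow> l" for G :: "'b \<Rightarrow> real \<Rightarrow> 'c" and C t l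
  proof -
    let ?I = "\<lambda>y. LINT s|lebesgue_on {0..t}. G (y s) s"
    \<comment> \<open>The hulls inherit the limit of the functional from the tails; strong
      convergence of \<open>y\<close> then identifies it with the value at \<open>v\<close>.\<close>
    have "(\<lambda>m. ?I (y m)) \<longlonglongrightarrow> l"
    proof (rule LIMSEQ_I)
      fix e :: real assume "0 < e"
      then obtain N where "\<And>j. j \<ge> N \<Longrightarrow> norm (?I (z j) - l) < e / 2"
        using LIMSEQ_D[OF l, of "e/2"] by auto
      then have "norm (?I (y m) - l) \<le> e / 2" if "m \<ge> N" for m
        using that by (intro functional_mid_hull[OF z G C t _ y[of m]]) (force intro: less_imp_le)
      then show "\<exists>N. \<forall>m\<ge>N. norm (?I (y m) - l) < e"
        using \<open>0 < e\<close> by (intro exI[of _ N]) force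
    qed
    moreover have "(\<lambda>m. ?I (y m)) \<longlonglongrightarrow> ?I v"
    proof (rule Lim_null_comparison[THEN LIM_zero_cancel])
      show "eventually (\<lambda>m. norm (?I (y m) - ?I v) \<le> C * sqrt (energy (\<lambda>t. y m t - v t))) sequentially"
      proof (intro always_eventually allI)
        fix m
        have i: "integrable (lebesgue_on {0..t}) (\<lambda>s. G (f s) s)" if "f \<in> bochner_L2 UNIV norm" for f
          using linear_functional_density_integral(1)[OF G that C] t by (auto intro: integrable_sub01)
        have "?I (y m) - ?I v = (LINT s|lebesgue_on {0..t}. G (y m s) s - G (v s) s)"
          using i[OF yL2[of m]] i[OF v] by simp
        also have "\<dots> = ?I (\<lambda>s. y m s - v s)"
        proof (rule Bochner_Integration.integral_cong)
          fix s assume "s \<in> space (lebesgue_on {0..t})"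
          then have "linear (\<lambda>h. G h s)" using G t by (simp add: linear_functional_density_def)
          from linear_diff[OF this] show "G (y m s) s - G (v s) s = G (y m s - v s) s" by simp
        qed simp
        finally show "norm (?I (y m) - ?I v) \<le> C * sqrt (energy (\<lambda>t. y m t - v t))"
          using linear_functional_density_integral(2)[OF G bochner_L2_diff[OF yL2[of m] v] C t] by simp
      qed
      show "(\<lambda>m. C * sqrt (energy (\<lambda>t. y m t - v t))) \<longlonglongrightarrow> 0"
        using tendsto_mult_left[OF tendsto_real_sqrt[OF lim], of C] by simp
    qed
    ultimately show ?thesis by (rule LIMSEQ_unique[symmetric])
  qed
  show ?thesis by (rule that[of v]) (use v 1 2 in auto)
qed

subsection \<open>Flows of an embedded space of vector fields\<close>

text \<open>A real supremum is informative only for a set bounded above: continuity bounds the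
  function on a compact set, and vanishing at infinity bounds it by 1 outside.\<close>

lemma C0_norm_le_sup_norm:
  assumes f: "f \<in> C0 X" and p: "p \<in> X"
  shows "norm (f p) \<le> sup_norm X f"
proof -
  have "\<forall>e>0. \<exists>K. compact K \<and> K \<subseteq> X \<and> (\<forall>p\<in>X - K. norm (f p) < e)"
    using f by (simp add: C0_def)
  from this[rule_format, of 1] obtain K where K: "compact K" "K \<subseteq> X" "\<And>q. q \<in> X - K \<Longrightarrow> norm (f q) < 1"
    by auto
  have "continuous_on K f" using f K(2) by (auto simp: C0_def intro: continuous_on_subset)
  then have "bounded (f ` K)" using K(1) by (intro compact_imp_bounded compact_continuous_image)
  then obtain b where b: "\<And>q. q \<in> K \<Longrightarrow> norm (f q) \<le> b" by (auto simp: bounded_iff)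
  have "norm (f q) \<le> max b 1" if "q \<in> X" for q
    using b[of q] K(3)[of q] that by (cases "q \<in> K") auto
  then have "bdd_above ((\<lambda>q. norm (f q)) ` X)" by (rule bdd_aboveI2)
  then show ?thesis unfolding sup_norm_def by (intro cSUP_upper p)
qed

lemma has_derivative_Deriv:
  assumes "f differentiable at x"
  shows "(f has_derivative blinfun_apply (Deriv f x)) (at x)"
proof -
  have "(f has_derivative frechet_derivative f (at x)) (at x)"
    using assms by (simp add: frechet_derivative_works)
  then show ?thesis
    by (simp add: Deriv_def bounded_linear_Blinfun_apply[OF has_derivative_bounded_linear])
qed

lemma Deriv_eq:
  assumes "(f has_derivative blinfun_apply T) (at x)"
  shows "Deriv f x = T"
  unfolding Deriv_def frechet_derivative_at[OF assms, symmetric] by (rule blinfun_apply_inverse)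

lemma lipschitz_of_Deriv:
  assumes "\<And>x. f differentiable at x" "\<And>x. norm (Deriv f x) \<le> B"
  shows "norm (f y - f z) \<le> B * norm (y - z)"
  by (rule differentiable_bound[where S = UNIV and f' = "\<lambda>x. blinfun_apply (Deriv f x)"])
    (use assms in \<open>auto simp: has_derivative_Deriv norm_blinfun.rep_eq[symmetric]\<close>)

text \<open>The embedding in a form free of suprema: one constant for the field, its derivative and
  the Lipschitz constant of the derivative, each bound linear in \<open>norm h\<close>.\<close>

locale vector_fields =
  fixes eV :: "'v::{real_inner,complete_space} \<Rightarrow> 'a::euclidean_space \<Rightarrow> 'a" and C :: real
  assumes linear_eV: "linear (\<lambda>h. eV h p)"
    and C_nonneg: "0 \<le> C"
    and eV_bound: "norm (eV h p) \<le> C * norm h"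
    and Deriv_eV_bound: "norm (Deriv (eV h) p) \<le> C * norm h"
    and Deriv_eV_lipschitz: "norm (Deriv (eV h) p - Deriv (eV h) q) \<le> C * norm h * norm (p - q)"
    and eV_derivative: "(eV h has_derivative blinfun_apply (Deriv (eV h) p)) (at p)"

lemma vector_fields_exists:
  fixes eV :: "'v::{real_inner,complete_space} \<Rightarrow> 'a::euclidean_space \<Rightarrow> 'a"
  assumes "function_space UNIV eV" "continuously_embedded eV C2_0 C2_norm"
  shows "\<exists>C. vector_fields eV C"
proof -
  have C2: "eV h \<in> C2_0" for h using assms(2) by (auto simp: continuously_embedded_def)
  obtain C where C: "\<And>h. C2_norm (eV h) \<le> C * norm h"
    using assms(2) by (auto simp: continuously_embedded_def)
  have le: "norm (eV h p) \<le> \<bar>C\<bar> * norm h" "norm (Deriv (eV h) p) \<le> \<bar>C\<bar> * norm h"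
    "norm (Deriv (Deriv (eV h)) p) \<le> \<bar>C\<bar> * norm h" for h p
  proof -
    have *: "norm (eV h p) \<le> sup_norm UNIV (eV h)" "norm (Deriv (eV h) p) \<le> sup_norm UNIV (Deriv (eV h))"
     "norm (Deriv (Deriv (eV h)) p) \<le> sup_norm UNIV (Deriv (Deriv (eV h)))"
      using C2[of h] by (auto simp: C2_0_def intro: C0_norm_le_sup_norm)
    have "C * norm h \<le> \<bar>C\<bar> * norm h" by (intro mult_right_mono) auto
    then have "norm (eV h p) + norm (Deriv (eV h) p) + norm (Deriv (Deriv (eV h)) p) \<le> \<bar>C\<bar> * norm h"
      using * C[of h] unfolding C2_norm_def by linarith
    then show "norm (eV h p) \<le> \<bar>C\<bar> * norm h" "norm (Deriv (eV h) p) \<le> \<bar>C\<bar> * norm h"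
    "norm (Deriv (Deriv (eV h)) p) \<le> \<bar>C\<bar> * norm h"
      by (smt (verit) norm_ge_zero)+
  qed
  \<comment> \<open>The absolute value guards against a trivial space, where the embedding puts no
    restriction on the sign of \<open>C\<close>.\<close>
  have "vector_fields eV \<bar>C\<bar>"
  proof (rule vector_fields.intro)
    fix h :: 'v and p q :: 'a
    show "linear (\<lambda>h. eV h p)" using assms(1) by (simp add: function_space_def)
    show "(eV h has_derivative blinfun_apply (Deriv (eV h) p)) (at p)"
      using C2[of h] by (intro has_derivative_Deriv) (simp add: C2_0_def)
    show "norm (Deriv (eV h) p - Deriv (eV h) q) \<le> \<bar>C\<bar> * norm h * norm (p - q)"
      using C2[of h] le(3) by (intro lipschitz_of_Deriv) (simp_all add: C2_0_def)
  qed (use le in auto)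
  then show ?thesis ..
qed

text \<open>Induction over the points: each step extracts a further subsequence, along which the
  earlier uniform limits persist.\<close>

lemma Arzela_Ascoli_finite_family:
  fixes Z :: "nat \<Rightarrow> 'p \<Rightarrow> real \<Rightarrow> 'b::{real_normed_vector,heine_borel}"
  assumes "finite P"
    and "\<And>m p t. p \<in> P \<Longrightarrow> t \<in> {0..1} \<Longrightarrow> norm (Z m p t) \<le> B p"
    and holder: "\<And>m p s t. p \<in> P \<Longrightarrow> s \<in> {0..1} \<Longrightarrow> t \<in> {0..1} \<Longrightarrow> norm (Z m p t - Z m p s) \<le> H * sqrt \<bar>t - s\<bar>"
  shows "\<exists>g (k :: nat \<Rightarrow> nat). strict_mono k \<and> (\<forall>p\<in>P. continuous_on {0..1} (g p) \<and>
     uniform_limit {0..1} (\<lambda>n. Z (k n) p) (g p) sequentially)"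
  using assms
proof (induction P)
  case empty
  then show ?case by (auto intro!: exI[of _ id] simp: strict_mono_def)
next
  case (insert p P)
  have "\<exists>g (k :: nat \<Rightarrow> nat). strict_mono k \<and> (\<forall>p\<in>P. continuous_on {0..1} (g p) \<and>
     uniform_limit {0..1} (\<lambda>n. Z (k n) p) (g p) sequentially)"
    by (rule insert.IH) (use insert.prems in auto)
  then obtain g and k :: "nat \<Rightarrow> nat" where k: "strict_mono k"
    and g: "\<And>q. q \<in> P \<Longrightarrow> continuous_on {0..1} (g q)" "\<And>q. q \<in> P \<Longrightarrow> uniform_limit {0..1} (\<lambda>n. Z (k n) q) (g q) sequentially"
    by blast
  have equi: "\<exists>d>0. \<forall>n s. s \<in> {0..1} \<and> norm (t - s) < d \<longrightarrow> norm (Z (k n) p t - Z (k n) p s) < e"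
    if t: "t \<in> {0..1}" and e: "0 < e" for t e
  proof (intro exI conjI allI impI)
    \<comment> \<open>Inverts the modulus of continuity \<open>H * sqrt d\<close>; adding 1 avoids a
      division by zero.\<close>
    show "0 < (e / (\<bar>H\<bar> + 1))\<^sup>2" using e by (simp add: pos_less_divide_eq zero_less_power)
    fix n s assume s: "s \<in> {0..1} \<and> norm (t - s) < (e / (\<bar>H\<bar> + 1))\<^sup>2"
    then have "sqrt \<bar>t - s\<bar> < e / (\<bar>H\<bar> + 1)"
      using e by (intro real_less_lsqrt) auto
    then have "(\<bar>H\<bar> + 1) * sqrt \<bar>t - s\<bar> < e" by (simp add: field_simps)
    moreover have "H * sqrt \<bar>t - s\<bar> \<le> (\<bar>H\<bar> + 1) * sqrt \<bar>t - s\<bar>" by (intro mult_right_mono) auto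
    moreover have "norm (Z (k n) p t - Z (k n) p s) \<le> H * sqrt \<bar>t - s\<bar>"
      using insert.prems(2) s t by blast
    ultimately show "norm (Z (k n) p t - Z (k n) p s) < e" by linarith
  qed
  have bnd: "norm (Z (k n) p t) \<le> B p" if "t \<in> {0..1}" for n t
    using insert.prems(1) that by simp
  obtain g' and k' :: "nat \<Rightarrow> nat" where g': "continuous_on {0..1} g'" and k': "strict_mono k'"
    and lim: "\<And>e. 0 < e \<Longrightarrow> \<exists>N. \<forall>n t. n \<ge> N \<and> t \<in> {0..1} \<longrightarrow> norm (Z (k (k' n)) p t - g' t) < e"
    by (rule Arzela_Ascoli[of "{0..1::real}" "\<lambda>n. Z (k n) p" "B p", OF compact_Icc bnd equi]) (assumption | rule that)+
  have "uniform_limit {0..1} (\<lambda>n. Z (k (k' n)) p) g' sequentially"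
    unfolding uniform_limit_sequentially_iff dist_norm
  proof (intro allI impI)
    fix e :: real assume "0 < e"
    from lim[OF this] show "\<exists>N. \<forall>n\<ge>N. \<forall>t\<in>{0..1}. norm (Z (k (k' n)) p t - g' t) < e" by blast
  qed
  moreover have "uniform_limit {0..1} (\<lambda>n. Z (k (k' n)) q) (g q) sequentially" if "q \<in> P" for q
    using filterlim_compose[OF _ filterlim_subseq[OF k']] g(2)[OF that]
    unfolding uniform_limit_sequentially_iff
    by (meson seq_suble[OF k'] order_trans)
  moreover have "strict_mono (\<lambda>n. k (k' n))" using strict_mono_o[OF k k'] by (simp add: o_def)
  ultimately show ?case using g(1) g' insert.hyps
    by (intro exI[of _ "g(p := g')"] exI[of _ "\<lambda>n. k (k' n)"]) auto
qed

context vector_fields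
begin

lemma Deriv_eV_linear: "linear (\<lambda>h. blinfun_apply (Deriv (eV h) p) w)"
proof -
  have "Deriv (eV (h + h')) p = Deriv (eV h) p + Deriv (eV h') p" for h h'
  proof (rule Deriv_eq)
    have "eV (h + h') = (\<lambda>q. eV h q + eV h' q)" using linear_add[OF linear_eV] by auto
    then show "(eV (h + h') has_derivative blinfun_apply (Deriv (eV h) p + Deriv (eV h') p)) (at p)"
      using has_derivative_add[OF eV_derivative eV_derivative] by (simp add: plus_blinfun.rep_eq)
  qed
  moreover have "Deriv (eV (r *\<^sub>R h)) p = r *\<^sub>R Deriv (eV h) p" for r h
  proof (rule Deriv_eq)
    have "eV (r *\<^sub>R h) = (\<lambda>q. r *\<^sub>R eV h q)" using linear_scale[OF linear_eV] by auto
    then show "(eV (r *\<^sub>R h) has_derivative blinfun_apply (r *\<^sub>R Deriv (eV h) p)) (at p)"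
      using has_derivative_scaleR_right[OF eV_derivative] by (simp add: scaleR_blinfun.rep_eq)
  qed
  ultimately show ?thesis by (intro linearI) (simp_all add: blinfun.add_left blinfun.scaleR_left)
qed

lemma continuous_eV: "continuous_on S (eV h)"
  by (meson continuous_at_imp_continuous_on eV_derivative has_derivative_continuous)

lemma continuous_Deriv_eV: "continuous_on S (Deriv (eV h))"
proof (rule continuous_at_imp_continuous_on, intro ballI)
  fix p
  have "((\<lambda>q. Deriv (eV h) q - Deriv (eV h) p) \<longlongrightarrow> 0) (at p)"
  proof (rule Lim_null_comparison)
    show "\<forall>\<^sub>F q in at p. norm (Deriv (eV h) q - Deriv (eV h) p) \<le> C * norm h * norm (q - p)"
      by (intro always_eventually allI Deriv_eV_lipschitz)
    show "((\<lambda>q. C * norm h * norm (q - p)) \<longlongrightarrow> 0) (at p)"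
      by (rule tendsto_eq_intros refl | simp)+
  qed
  then show "isCont (Deriv (eV h)) p" unfolding isCont_def by (rule LIM_zero_cancel)
qed

text \<open>Along a frozen curve the right-hand side of the flow equation is linear in the field,
  the form that weak limits respect. The next lemma does the same for the variational
  equation.\<close>

lemma density_eV:
  assumes "continuous_on {0..1} c"
  shows "linear_functional_density (\<lambda>h s. eV h (c s)) C"
  unfolding linear_functional_density_def
  using continuous_measurable_lebesgue_on[OF continuous_on_compose2[OF continuous_eV assms subset_UNIV]]
    linear_eV eV_bound by auto

lemma density_Deriv_eV:
  assumes c: "continuous_on {0..1} c" and w: "continuous_on {0..1} w" and b: "\<And>s. s \<in> {0..1} \<Longrightarrow> norm (w s) \<le> b"
  shows "linear_functional_density (\<lambda>h s. blinfun_apply (Deriv (eV h) (c s)) (w s)) (C * b)"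
  unfolding linear_functional_density_def
proof (intro conjI allI ballI Deriv_eV_linear)
  fix h
  have "continuous_on {0..1} (\<lambda>s. blinfun_apply (Deriv (eV h) (c s)) (w s))"
    by (intro continuous_intros continuous_on_compose2[OF continuous_Deriv_eV c subset_UNIV] w)
  then show "(\<lambda>s. blinfun_apply (Deriv (eV h) (c s)) (w s)) \<in> borel_measurable leb01"
    by (rule continuous_measurable_lebesgue_on)
next
  fix s :: real and h assume s: "s \<in> {0..1}"
  have "norm (blinfun_apply (Deriv (eV h) (c s)) (w s)) \<le> norm (Deriv (eV h) (c s)) * norm (w s)"
    by (rule norm_blinfun)
  also have "\<dots> \<le> (C * norm h) * b"
    by (intro mult_mono Deriv_eV_bound b s) (auto simp: C_nonneg)
  finally show "norm (blinfun_apply (Deriv (eV h) (c s)) (w s)) \<le> C * b * norm h" by (simp add: ac_simps)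
qed

lemma smooth_field_eV:
  assumes v: "v \<in> bochner_L2 UNIV norm" and M: "energy v \<le> M"
  shows "smooth_field (\<lambda>s. eV (v s)) (\<lambda>s. Deriv (eV (v s))) (\<lambda>s. C * norm (v s)) (C\<^sup>2 * M)"
proof
  have m: "(\<lambda>t. norm (v t)) \<in> borel_measurable leb01" and i: "integrable leb01 (\<lambda>t. (norm (v t))\<^sup>2)"
    using v by (auto simp: bochner_L2_UNIV intro: strongly_measurable_norm)
  show "rate (\<lambda>s. C * norm (v s)) (C\<^sup>2 * M)"
    using m i M C_nonneg by (auto simp: rate_def power_mult_distrib energy_def intro!: mult_left_mono)
  fix c :: "real \<Rightarrow> 'a" assume c: "continuous_on {0..1} c"
  show "(\<lambda>s. eV (v s) (c s)) \<in> borel_measurable leb01"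
    using linear_functional_density_integral(1)[OF density_eV[OF c] v C_nonneg] by simp
  fix w :: "real \<Rightarrow> 'a" assume w: "continuous_on {0..1} w"
  have "bounded (w ` {0..1})" by (intro compact_imp_bounded compact_continuous_image w) simp
  then obtain b where "\<forall>y\<in>w ` {0..1}. norm y \<le> b" by (auto simp only: bounded_iff)
  then have b: "\<And>s. s \<in> {0..1} \<Longrightarrow> norm (w s) \<le> b" by simp
  moreover have "0 \<le> b" using b[of 0] norm_ge_zero[of "w 0"] by (auto simp del: norm_ge_zero)
  ultimately show "(\<lambda>s. blinfun_apply (Deriv (eV (v s)) (c s)) (w s)) \<in> borel_measurable leb01"
    using linear_functional_density_integral(1)[OF density_Deriv_eV[OF c w] v] C_nonneg by simp
next
  fix s y z
  show "norm (Deriv (eV (v s)) y - Deriv (eV (v s)) z) \<le> C * norm (v s) * norm (y - z)"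
    by (rule Deriv_eV_lipschitz)
qed (use eV_bound Deriv_eV_bound eV_derivative in auto)

section \<open>Trajectories and their derivatives as functions of the field\<close>

abbreviation traj :: "(real \<Rightarrow> 'v) \<Rightarrow> real \<Rightarrow> 'a \<Rightarrow> 'a" where
  "traj v \<equiv> flow (\<lambda>s. eV (v s))"

text \<open>Given by the variational equation and not as a Frechet derivative, because it is the
  equation that passes to the limit; \<open>traj_regularity\<close> identifies the two.\<close>

definition dtraj :: "(real \<Rightarrow> 'v) \<Rightarrow> real \<Rightarrow> 'a \<Rightarrow> 'a \<Rightarrow>\<^sub>L 'a" where
  "dtraj v = smooth_field.D (\<lambda>s. eV (v s)) (\<lambda>s. Deriv (eV (v s)))"

text \<open>Uniqueness turns any continuous solution of the integral equation into the trajectory.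
  This is how limits of curves are recognized, here and in \<open>dtraj_eqI\<close>.\<close>

lemma traj_eqI:
  assumes v: "v \<in> bochner_L2 UNIV norm" and g: "continuous_on {0..1} g"
    and eq: "\<And>t. t \<in> {0..1} \<Longrightarrow> (LINT s|lebesgue_on {0..t}. eV (v s) (g s)) = g t - p"
    and t: "t \<in> {0..1}"
  shows "traj v t p = g t"
proof -
  interpret smooth_field "\<lambda>s. eV (v s)" "\<lambda>s. Deriv (eV (v s))" "\<lambda>s. C * norm (v s)" "C\<^sup>2 * energy v"
    by (rule smooth_field_eV[OF v order_refl])
  have "integral_curve (\<lambda>s. eV (v s)) p g"
    unfolding integral_curve_def
    using g eq linear_functional_density_integral(1)[OF density_eV[OF g] v C_nonneg] by simp
  then show ?thesis by (rule flow_unique[OF rate caratheodory_u _ t])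
qed

lemma dtraj_eqI:
  assumes v: "v \<in> bochner_L2 UNIV norm" and A: "continuous_on {0..1} A"
    and eq: "\<And>t w. t \<in> {0..1} \<Longrightarrow>
      (LINT s|lebesgue_on {0..t}. blinfun_apply (Deriv (eV (v s)) (traj v s p)) (blinfun_apply (A s) w)) = blinfun_apply (A t) w - w"
    and t: "t \<in> {0..1}"
  shows "dtraj v t p = A t"
proof -
  interpret smooth_field "\<lambda>s. eV (v s)" "\<lambda>s. Deriv (eV (v s))" "\<lambda>s. C * norm (v s)" "C\<^sup>2 * energy v"
    by (rule smooth_field_eV[OF v order_refl])
  show ?thesis
  proof (rule blinfun_eqI)
    fix w
    have c: "continuous_on {0..1} (\<lambda>s. blinfun_apply (A s) w)" by (intro continuous_intros A)
    have "integral_curve (lin p) w (\<lambda>t. blinfun_apply (A t) w)"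
      unfolding integral_curve_def
    proof (intro conjI ballI c)
      show "integrable leb01 (\<lambda>s. lin p s (blinfun_apply (A s) w))"
        by (rule caratheodory_integrable[OF rate caratheodory_lin c])
    qed (use eq in \<open>simp add: lin_def\<close>)
    then show "blinfun_apply (dtraj v t p) w = blinfun_apply (A t) w"
      using \<psi>_unique[OF _ t] by (simp add: dtraj_def blinfun_apply_D[OF t])
  qed
qed

lemma traj_integral:
  assumes v: "v \<in> bochner_L2 UNIV norm" and t: "t \<in> {0..1}"
  shows "traj v t p - p = (LINT s|lebesgue_on {0..t}. eV (v s) (traj v s p))"
    and "blinfun_apply (dtraj v t p) w - w =
      (LINT s|lebesgue_on {0..t}. blinfun_apply (Deriv (eV (v s)) (traj v s p)) (blinfun_apply (dtraj v s p) w))"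
proof -
  interpret smooth_field "\<lambda>s. eV (v s)" "\<lambda>s. Deriv (eV (v s))" "\<lambda>s. C * norm (v s)" "C\<^sup>2 * energy v"
    by (rule smooth_field_eV[OF v order_refl])
  show "traj v t p - p = (LINT s|lebesgue_on {0..t}. eV (v s) (traj v s p))"
    using curve[of p] t by (auto simp: integral_curve_def)
  have "\<psi> p t w - w = (LINT s|lebesgue_on {0..t}. lin p s (\<psi> p s w))"
    using curve_\<psi>[of p w] t by (auto simp: integral_curve_def)
  also have "\<dots> = (LINT s|lebesgue_on {0..t}. blinfun_apply (Deriv (eV (v s)) (traj v s p)) (blinfun_apply (dtraj v s p) w))"
    using t by (intro Bochner_Integration.integral_cong) (auto simp: lin_def dtraj_def blinfun_apply_D)
  finally show "blinfun_apply (dtraj v t p) w - w = \<dots>"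
    using t by (simp add: dtraj_def blinfun_apply_D)
qed

text \<open>Apart from the points, the constants depend on \<open>C\<close> and \<open>M\<close> and
  not on \<open>v\<close>, so they are uniform along a sequence of bounded energy.\<close>

lemma traj_regularity:
  assumes v: "v \<in> bochner_L2 UNIV norm" and M: "energy v \<le> M" and t: "t \<in> {0..1}"
  shows "norm (dtraj v t p) \<le> flow_const (C\<^sup>2 * M)"
    and "norm w \<le> norm (blinfun_apply (dtraj v t p) w) * flow_const (C\<^sup>2 * M)"
    and "norm (p - q) \<le> norm (traj v t p - traj v t q) * flow_const (C\<^sup>2 * M)"
    and "norm (traj v t p) \<le> norm p + sqrt (C\<^sup>2 * M)"
    and "frechet_derivative (traj v t) (at p) = blinfun_apply (dtraj v t p)"
    and "(traj v t has_derivative blinfun_apply (dtraj v t p)) (at p)"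
    and "norm (dtraj v t p - dtraj v t q) \<le> sqrt (C\<^sup>2 * M) * flow_const (C\<^sup>2 * M) ^ 3 * norm (p - q)"
    and "s \<in> {0..1} \<Longrightarrow> norm (traj v t p - traj v s p) \<le> sqrt (C\<^sup>2 * M) * sqrt \<bar>t - s\<bar>"
    and "s \<in> {0..1} \<Longrightarrow> norm (dtraj v t p - dtraj v s p) \<le> sqrt (C\<^sup>2 * M) * flow_const (C\<^sup>2 * M) * sqrt \<bar>t - s\<bar>"
proof -
  interpret smooth_field "\<lambda>s. eV (v s)" "\<lambda>s. Deriv (eV (v s))" "\<lambda>s. C * norm (v s)" "C\<^sup>2 * M"
    by (rule smooth_field_eV[OF v M])
  show "norm (dtraj v t p) \<le> flow_const (C\<^sup>2 * M)"
    "norm w \<le> norm (blinfun_apply (dtraj v t p) w) * flow_const (C\<^sup>2 * M)"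
    "norm (p - q) \<le> norm (traj v t p - traj v t q) * flow_const (C\<^sup>2 * M)"
    "frechet_derivative (traj v t) (at p) = blinfun_apply (dtraj v t p)"
    "(traj v t has_derivative blinfun_apply (dtraj v t p)) (at p)"
    "norm (dtraj v t p - dtraj v t q) \<le> sqrt (C\<^sup>2 * M) * flow_const (C\<^sup>2 * M) ^ 3 * norm (p - q)"
    unfolding dtraj_def using norm_D_le norm_D_ge \<phi>_lipschitz(2) frechet_\<phi> \<phi>_has_derivative D_lipschitz t by auto
  have h: "norm (traj v t p - traj v s p) \<le> sqrt (C\<^sup>2 * M) * sqrt \<bar>t - s\<bar>"
    if "s \<in> {0..1}" "t \<in> {0..1}" for s t
    using \<phi>_holder[of s t p] \<phi>_holder[of t s p] that
    by (cases "s \<le> t") (auto simp: real_sqrt_mult[symmetric] norm_minus_commute)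
  then show "s \<in> {0..1} \<Longrightarrow> norm (traj v t p - traj v s p) \<le> sqrt (C\<^sup>2 * M) * sqrt \<bar>t - s\<bar>"
    using t by blast
  show "s \<in> {0..1} \<Longrightarrow> norm (dtraj v t p - dtraj v s p) \<le> sqrt (C\<^sup>2 * M) * flow_const (C\<^sup>2 * M) * sqrt \<bar>t - s\<bar>"
    unfolding dtraj_def using D_holder[of s t p] D_holder[of t s p] t
    by (cases "s \<le> t") (auto simp: real_sqrt_mult norm_minus_commute ac_simps)
  have "norm (traj v t p - traj v 0 p) \<le> sqrt (C\<^sup>2 * M) * sqrt \<bar>t - 0\<bar>" by (rule h) (use t in auto)
  also have "\<dots> \<le> sqrt (C\<^sup>2 * M)" using t K_nonneg by (intro mult_left_le) auto
  finally show "norm (traj v t p) \<le> norm p + sqrt (C\<^sup>2 * M)"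
    using integral_curve_0[OF curve, of p] norm_triangle_ineq2[of "traj v t p" p] by simp
qed

end

subsection \<open>Compactness of trajectories\<close>

context vector_fields
begin

lemma continuous_traj:
  assumes v: "v \<in> bochner_L2 UNIV norm"
  shows "continuous_on {0..1} (\<lambda>t. traj v t p)" "continuous_on {0..1} (\<lambda>t. dtraj v t p)"
proof -
  have *: "continuous_on {0..1} f" if "\<And>s t. s \<in> {0..1} \<Longrightarrow> t \<in> {0..1} \<Longrightarrow> norm (f t - f s) \<le> H * sqrt \<bar>t - s\<bar>"
    for f :: "real \<Rightarrow> 'b::real_normed_vector" and H
    unfolding continuous_on_def
  proof
    fix s :: real assume s: "s \<in> {0..1}"
    have "((\<lambda>t. f t - f s) \<longlongrightarrow> 0) (at s within {0..1})"
    proof (rule Lim_null_comparison)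
      show "\<forall>\<^sub>F t in at s within {0..1}. norm (f t - f s) \<le> H * sqrt \<bar>t - s\<bar>"
        using that[OF s] by (auto simp: eventually_at_topological)
      show "((\<lambda>t. H * sqrt \<bar>t - s\<bar>) \<longlongrightarrow> 0) (at s within {0..1})"
        by (rule tendsto_eq_intros refl | simp)+
    qed
    then show "(f \<longlongrightarrow> f s) (at s within {0..1})" by (rule LIM_zero_cancel)
  qed
  show "continuous_on {0..1} (\<lambda>t. traj v t p)"
    by (rule *) (rule traj_regularity(8)[OF v order_refl])
  show "continuous_on {0..1} (\<lambda>t. dtraj v t p)"
    by (rule *) (rule traj_regularity(9)[OF v order_refl])
qed

text \<open>Curves and field obtain their limits independently, from Arzela--Ascoli and from
  \<open>bochner_L2_weak_limit\<close>; the work is to show that the limit curves solve the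
  equations of the limit field.\<close>

lemma traj_compactness:
  fixes z :: "nat \<Rightarrow> real \<Rightarrow> 'v"
  assumes P: "finite P" and z: "\<And>j. z j \<in> bochner_L2 UNIV norm" and M: "\<And>j. energy (z j) \<le> M"
  obtains k :: "nat \<Rightarrow> nat" and v where "strict_mono k" "v \<in> bochner_L2 UNIV norm"
    "\<And>B. eventually (\<lambda>j. energy (z (k j)) \<le> B) sequentially \<Longrightarrow> energy v \<le> B"
    "\<And>p t. p \<in> P \<Longrightarrow> t \<in> {0..1} \<Longrightarrow> (\<lambda>j. traj (z (k j)) t p) \<longlonglongrightarrow> traj v t p"
    "\<And>p t. p \<in> P \<Longrightarrow> t \<in> {0..1} \<Longrightarrow> (\<lambda>j. dtraj (z (k j)) t p) \<longlonglongrightarrow> dtraj v t p"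
proof -
  let ?K = "C\<^sup>2 * M" and ?L = "flow_const (C\<^sup>2 * M)"
  \<comment> \<open>Pairing lets one subsequence serve the trajectories and their
    derivatives.\<close>
  let ?Z = "\<lambda>m p t. (traj (z m) t p, dtraj (z m) t p)"
  have "\<exists>g (k :: nat \<Rightarrow> nat). strict_mono k \<and> (\<forall>p\<in>P. continuous_on {0..1} (g p) \<and>
     uniform_limit {0..1} (\<lambda>n. ?Z (k n) p) (g p) sequentially)"
  proof (rule Arzela_Ascoli_finite_family[OF P])
    fix m p and t :: real assume t: "t \<in> {0..1}"
    show "norm (?Z m p t) \<le> norm p + sqrt ?K + ?L"
      using norm_Pair_le[of "traj (z m) t p" "dtraj (z m) t p"]
        traj_regularity(1)[OF z[of m] M[of m] t, of p] traj_regularity(4)[OF z[of m] M[of m] t, of p] by linarith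
    fix s :: real assume s: "s \<in> {0..1}"
    show "norm (?Z m p t - ?Z m p s) \<le> (sqrt ?K + sqrt ?K * ?L) * sqrt \<bar>t - s\<bar>"
      using norm_Pair_le[of "traj (z m) t p - traj (z m) s p" "dtraj (z m) t p - dtraj (z m) s p"]
        traj_regularity(8)[OF z[of m] M[of m] t s, of p] traj_regularity(9)[OF z[of m] M[of m] t s, of p]
      by (simp add: algebra_simps)
  qed
  then obtain g and k :: "nat \<Rightarrow> nat" where k: "strict_mono k"
    and cg: "\<And>p. p \<in> P \<Longrightarrow> continuous_on {0..1} (g p)"
    and lim: "\<And>p. p \<in> P \<Longrightarrow> uniform_limit {0..1} (\<lambda>n. ?Z (k n) p) (g p) sequentially"
    by blast
  define y where "y j = z (k j)" for j
  have y: "y j \<in> bochner_L2 UNIV norm" "energy (y j) \<le> M" for j using z M by (auto simp: y_def)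
  obtain v where v: "v \<in> bochner_L2 UNIV norm"
    and vB: "\<And>B. eventually (\<lambda>j. energy (y j) \<le> B) sequentially \<Longrightarrow> energy v \<le> B"
    and vG: "\<And>(G :: 'v \<Rightarrow> real \<Rightarrow> 'a) C t l. linear_functional_density G C \<Longrightarrow> 0 \<le> C \<Longrightarrow> t \<in> {0..1} \<Longrightarrow>
      (\<lambda>j. LINT s|lebesgue_on {0..t}. G (y j s) s) \<longlonglongrightarrow> l \<Longrightarrow> (LINT s|lebesgue_on {0..t}. G (v s) s) = l"
    by (rule bochner_L2_weak_limit[where 'c = 'a, of y M, OF y]) (rule that, assumption+)
  have sM: "sqrt (energy (y j)) \<le> sqrt M" for j using y(2) by simp
  have M0: "0 \<le> sqrt M" by (rule order_trans[OF _ sM[of 0]]) (simp add: energy_nonneg)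
  have main: "traj v t p = fst (g p t) \<and> dtraj v t p = snd (g p t)" if p: "p \<in> P" and t: "t \<in> {0..1}" for p t
  proof -
    define c where "c s = fst (g p s)" for s
    define A where "A s = snd (g p s)" for s
    have cc: "continuous_on {0..1} c" and cA: "continuous_on {0..1} A"
      unfolding c_def A_def using cg[OF p] by (auto intro: continuous_intros)
    have ev: "\<forall>\<^sub>F j in sequentially. \<forall>s\<in>{0..1}. norm (traj (y j) s p - c s) \<le> e \<and> norm (dtraj (y j) s p - A s) \<le> e"
      if "0 < e" for e
      using uniform_limitD[OF lim[OF p] that]
    proof eventually_elim
      fix j assume *: "\<forall>s\<in>{0..1}. dist (?Z (k j) p s) (g p s) < e"
      show "\<forall>s\<in>{0..1}. norm (traj (y j) s p - c s) \<le> e \<and> norm (dtraj (y j) s p - A s) \<le> e"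
      proof
        fix s :: real assume "s \<in> {0..1}"
        then have "dist (?Z (k j) p s) (g p s) < e" using * by blast
        then show "norm (traj (y j) s p - c s) \<le> e \<and> norm (dtraj (y j) s p - A s) \<le> e"
          using dist_fst_le[of "?Z (k j) p s" "g p s"] dist_snd_le[of "?Z (k j) p s" "g p s"]
          by (simp add: dist_norm y_def c_def A_def)
      qed
    qed
    \<comment> \<open>Dividing by \<open>b + 1\<close> covers the case \<open>b = 0\<close>.\<close>
    have criterion: "X \<longlonglongrightarrow> l" if "\<And>e. 0 < e \<Longrightarrow> \<forall>\<^sub>F j in sequentially. norm (X j - l) \<le> b * e" and "0 \<le> b"
      for X :: "nat \<Rightarrow> 'a" and l b
    proof (rule tendstoI)
      fix e :: real assume e: "0 < e"
      have pos: "0 < e / (b + 1)" using e that(2) by simp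
      have "b * (e / (b + 1)) < e" using e that(2) by (simp add: field_simps)
      with that(1)[OF pos] show "\<forall>\<^sub>F j in sequentially. dist (X j) l < e"
        unfolding dist_norm by (auto elim: eventually_mono)
    qed
    have meas_y: "(\<lambda>s. eV (y j s) (c' s)) \<in> borel_measurable leb01"
        "integrable (lebesgue_on {0..t}) (\<lambda>s. eV (y j s) (c' s))"
      if "continuous_on {0..1} c'" "t \<in> {0..1}" for j c' t
      using linear_functional_density_integral(1)[OF density_eV[OF that(1)] y(1)[of j] C_nonneg] that(2)
      by (auto intro: integrable_sub01)
    have traj_lim: "(LINT s|lebesgue_on {0..t}. eV (v s) (c s)) = c t - p" if t: "t \<in> {0..1}" for t
    proof (rule vG[OF density_eV[OF cc] C_nonneg t])
      show "(\<lambda>j. LINT s|lebesgue_on {0..t}. eV (y j s) (c s)) \<longlonglongrightarrow> c t - p"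
      proof (rule criterion)
        fix e :: real assume e: "0 < e"
        show "\<forall>\<^sub>F j in sequentially. norm ((LINT s|lebesgue_on {0..t}. eV (y j s) (c s)) - (c t - p)) \<le> (C * sqrt M + 1) * e"
          using ev[OF e]
        proof eventually_elim
          fix j assume close: "\<forall>s\<in>{0..1}. norm (traj (y j) s p - c s) \<le> e \<and> norm (dtraj (y j) s p - A s) \<le> e"
          \<comment> \<open>The error of freezing the curve: the Lipschitz bound times the uniform
            distance \<open>e\<close> leaves a multiple of \<open>e * norm (y j s)\<close>, whose
            integral the energy controls.\<close>
          let ?f = "\<lambda>s. eV (y j s) (c s) - eV (y j s) (traj (y j) s p)"
          note ct = continuous_traj(1)[OF y(1)[of j], of p]
          have "norm (LINT s|lebesgue_on {0..t}. ?f s) \<le> (C * e) * sqrt (energy (y j))"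
          proof (rule norm_LINT_le_energy[OF y(1) _ _ _ t])
            show "?f \<in> borel_measurable leb01" using meas_y(1)[OF cc t] meas_y(1)[OF ct t] by measurable
            fix s :: real assume s: "s \<in> {0..1}"
            have "norm (?f s) \<le> C * norm (y j s) * norm (c s - traj (y j) s p)"
              by (rule lipschitz_of_Deriv) (use eV_derivative Deriv_eV_bound in \<open>auto simp: differentiable_def\<close>)
            also have "\<dots> \<le> C * norm (y j s) * e"
              using close s by (intro mult_left_mono) (auto simp: C_nonneg norm_minus_commute)
            finally show "norm (?f s) \<le> C * e * norm (y j s)" by (simp add: ac_simps)
          qed (use e C_nonneg in auto)
          also have "\<dots> \<le> (C * e) * sqrt M" using e C_nonneg sM by (intro mult_left_mono) auto
          finally have 1: "norm (LINT s|lebesgue_on {0..t}. ?f s) \<le> C * sqrt M * e" by (simp add: ac_simps)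
          have "(LINT s|lebesgue_on {0..t}. eV (y j s) (c s)) - (c t - p) =
             (LINT s|lebesgue_on {0..t}. ?f s) + (traj (y j) t p - c t)"
            using traj_integral(1)[OF y(1)[of j] t, of p] meas_y(2)[OF cc t, of j] meas_y(2)[OF ct t, of j]
            by (simp add: algebra_simps)
          also have "norm \<dots> \<le> C * sqrt M * e + e"
            by (intro norm_triangle_le add_mono 1) (use close t in auto)
          finally show "norm ((LINT s|lebesgue_on {0..t}. eV (y j s) (c s)) - (c t - p)) \<le> (C * sqrt M + 1) * e"
            by (simp add: algebra_simps)
        qed
      qed (use C_nonneg M0 in auto)
    qed
    have traj: "traj v t p = c t" if "t \<in> {0..1}" for t
      by (rule traj_eqI[OF v cc traj_lim that])
    have "bounded (A ` {0..1})" by (intro compact_imp_bounded compact_continuous_image cA) simp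
    then obtain a where a: "\<And>s. s \<in> {0..1} \<Longrightarrow> norm (A s) \<le> a" by (auto simp only: bounded_iff ball_simps)
    have a0: "0 \<le> a" using a[of 0] norm_ge_zero[of "A 0"] by (auto simp del: norm_ge_zero)
    have bw: "norm (blinfun_apply (A s) w) \<le> a * norm w" if "s \<in> {0..1}" for s w
      using norm_blinfun[of "A s" w] mult_right_mono[OF a[OF that], of "norm w"] by simp
    have dtraj_lim: "(LINT s|lebesgue_on {0..t}. blinfun_apply (Deriv (eV (v s)) (c s)) (blinfun_apply (A s) w)) = blinfun_apply (A t) w - w"
      if t: "t \<in> {0..1}" for t w
    proof -
      have cAw: "continuous_on {0..1} (\<lambda>s. blinfun_apply (A s) w)" by (intro continuous_intros cA)
      let ?G = "\<lambda>h s. blinfun_apply (Deriv (eV h) (c s)) (blinfun_apply (A s) w)"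
      have dens: "linear_functional_density ?G (C * (a * norm w))"
        by (rule density_Deriv_eV[OF cc cAw bw])
      show ?thesis
      proof (rule vG[OF dens _ t])
        show "(\<lambda>j. LINT s|lebesgue_on {0..t}. ?G (y j s) s) \<longlonglongrightarrow> blinfun_apply (A t) w - w"
        proof (rule criterion)
          fix e :: real assume e: "0 < e"
          show "\<forall>\<^sub>F j in sequentially. norm ((LINT s|lebesgue_on {0..t}. ?G (y j s) s) - (blinfun_apply (A t) w - w))
              \<le> (C * (1 + ?L) * norm w * sqrt M + norm w) * e"
            using ev[OF e]
          proof eventually_elim
            fix j assume close: "\<forall>s\<in>{0..1}. norm (traj (y j) s p - c s) \<le> e \<and> norm (dtraj (y j) s p - A s) \<le> e"
            let ?H = "\<lambda>s. blinfun_apply (Deriv (eV (y j s)) (traj (y j) s p)) (blinfun_apply (dtraj (y j) s p) w)"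
            let ?f = "\<lambda>s. ?G (y j s) s - ?H s"
            note ct = continuous_traj(1)[OF y(1)[of j], of p]
            have cd: "continuous_on {0..1} (\<lambda>s. blinfun_apply (dtraj (y j) s p) w)"
              by (intro continuous_intros continuous_traj(2)[OF y(1)])
            have bd: "norm (blinfun_apply (dtraj (y j) s p) w) \<le> ?L * norm w" if "s \<in> {0..1}" for s
              using norm_blinfun[of "dtraj (y j) s p" w]
                mult_right_mono[OF traj_regularity(1)[OF y(1)[of j] y(2)[of j] that, of p], of "norm w"] by simp
            have iG: "integrable leb01 (\<lambda>s. ?G (y j s) s)"
              using linear_functional_density_integral(1)[OF dens y(1)] C_nonneg a0 by simp
            have iH: "integrable leb01 ?H"
              using linear_functional_density_integral(1)[OF density_Deriv_eV[OF ct cd bd] y(1)] C_nonneg by simp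
            have "norm (LINT s|lebesgue_on {0..t}. ?f s) \<le> (C * (1 + ?L) * norm w * e) * sqrt (energy (y j))"
            proof (rule norm_LINT_le_energy[OF y(1) _ _ _ t])
              show "?f \<in> borel_measurable leb01" using iG iH by measurable
              fix s :: real assume s: "s \<in> {0..1}"
              let ?T = "Deriv (eV (y j s)) (c s)" and ?T' = "Deriv (eV (y j s)) (traj (y j) s p)"
              have "?f s = blinfun_apply ?T (blinfun_apply (A s - dtraj (y j) s p) w)
                 + blinfun_apply (?T - ?T') (blinfun_apply (dtraj (y j) s p) w)"
                by (simp add: blinfun.diff_left blinfun.diff_right)
              also have "norm \<dots> \<le> norm ?T * (norm (A s - dtraj (y j) s p) * norm w) + norm (?T - ?T') * norm (blinfun_apply (dtraj (y j) s p) w)"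
                by (intro norm_triangle_le add_mono order_trans[OF norm_blinfun] mult_left_mono norm_blinfun order_refl) auto
              also have "\<dots> \<le> (C * norm (y j s)) * (e * norm w) + (C * norm (y j s) * e) * (?L * norm w)"
              proof (intro add_mono mult_mono Deriv_eV_bound order_refl bd s)
                show "norm (A s - dtraj (y j) s p) \<le> e" using close s by (simp add: norm_minus_commute)
                have "norm (?T - ?T') \<le> C * norm (y j s) * norm (c s - traj (y j) s p)" by (rule Deriv_eV_lipschitz)
                also have "\<dots> \<le> C * norm (y j s) * e"
                  using close s by (intro mult_left_mono) (auto simp: C_nonneg norm_minus_commute)
                finally show "norm (?T - ?T') \<le> C * norm (y j s) * e" .
              qed (use C_nonneg e in auto)
              finally show "norm (?f s) \<le> C * (1 + ?L) * norm w * e * norm (y j s)" by (simp add: algebra_simps)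
            qed (use e C_nonneg in auto)
            also have "\<dots> \<le> (C * (1 + ?L) * norm w * e) * sqrt M"
              using e C_nonneg sM by (intro mult_left_mono) auto
            finally have 1: "norm (LINT s|lebesgue_on {0..t}. ?f s) \<le> C * (1 + ?L) * norm w * sqrt M * e"
              by (simp add: ac_simps)
            have it: "integrable (lebesgue_on {0..t}) (\<lambda>s. ?G (y j s) s)" "integrable (lebesgue_on {0..t}) ?H"
              using iG iH t by (auto intro: integrable_sub01)
            have "(LINT s|lebesgue_on {0..t}. ?G (y j s) s) - (blinfun_apply (A t) w - w) =
               (LINT s|lebesgue_on {0..t}. ?f s) + blinfun_apply (dtraj (y j) t p - A t) w"
              unfolding Bochner_Integration.integral_diff[OF it]
              using traj_integral(2)[OF y(1)[of j] t, of p w]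
              by (simp add: blinfun.diff_left algebra_simps)
            also have "norm \<dots> \<le> C * (1 + ?L) * norm w * sqrt M * e + e * norm w"
            proof (intro norm_triangle_le add_mono 1 order_trans[OF norm_blinfun] mult_right_mono)
              show "norm (dtraj (y j) t p - A t) \<le> e" using close t by simp
            qed simp
            finally show "norm ((LINT s|lebesgue_on {0..t}. ?G (y j s) s) - (blinfun_apply (A t) w - w))
              \<le> (C * (1 + ?L) * norm w * sqrt M + norm w) * e" by (simp add: algebra_simps)
          qed
        qed (use C_nonneg M0 in auto)
      qed (use C_nonneg a0 in auto)
    qed
    have "dtraj v t p = A t"
    proof (rule dtraj_eqI[OF v cA _ t])
      fix t w assume t: "t \<in> {0..1::real}"
      \<comment> \<open>The trajectory of \<open>v\<close> is known to be \<open>c\<close> by now,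
        so the equation linearized along \<open>c\<close> is the variational equation of
        \<open>v\<close>.\<close>
      have "(LINT s|lebesgue_on {0..t}. blinfun_apply (Deriv (eV (v s)) (traj v s p)) (blinfun_apply (A s) w))
        = (LINT s|lebesgue_on {0..t}. blinfun_apply (Deriv (eV (v s)) (c s)) (blinfun_apply (A s) w))"
        using t traj by (intro Bochner_Integration.integral_cong) auto
      then show "(LINT s|lebesgue_on {0..t}. blinfun_apply (Deriv (eV (v s)) (traj v s p)) (blinfun_apply (A s) w)) = blinfun_apply (A t) w - w"
        using dtraj_lim[OF t] by simp
    qed
    then show ?thesis using traj[OF t] by (simp add: c_def A_def)
  qed
  show ?thesis
  proof (rule that[OF k v])
    fix B assume "\<forall>\<^sub>F j in sequentially. energy (z (k j)) \<le> B"
    then show "energy v \<le> B" by (intro vB) (simp add: y_def)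
  next
    fix p and t :: real assume pt: "p \<in> P" "t \<in> {0..1}"
    have "(\<lambda>j. ?Z (k j) p t) \<longlonglongrightarrow> g p t" by (rule tendsto_uniform_limitI[OF lim[OF pt(1)] pt(2)])
    from tendsto_fst[OF this] tendsto_snd[OF this] main[OF pt]
    show "(\<lambda>j. traj (z (k j)) t p) \<longlonglongrightarrow> traj v t p" "(\<lambda>j. dtraj (z (k j)) t p) \<longlonglongrightarrow> dtraj v t p" by simp_all
  qed
qed

end

subsection \<open>The oriented Grassmannian\<close>

lemma oriented_subspace_cases:
  obtains b us where "U = abs_oriented_subspace (b, us)" "distinct us" "independent (set us)"
proof -
  obtain p where "U = abs_oriented_subspace p" "frame_equiv p p"
    using Quotient_oriented_subspace by (metis Quotient_abs_rep Quotient_rep_reflp)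
  then show ?thesis using that by (cases p) (auto simp: frame_equiv_def)
qed

lemma linear_blinfun [simp]: "linear (blinfun_apply A)"
  by (rule bounded_linear.linear) (rule blinfun.bounded_linear_right)

lemma subspace_of_abs:
  "distinct us \<Longrightarrow> independent (set us) \<Longrightarrow> subspace_of (abs_oriented_subspace (b, us)) = span (set us)"
  using subspace_of.abs_eq[OF frame_equiv_refl] by simp

lemma oriented_image_abs:
  "distinct us \<Longrightarrow> independent (set us) \<Longrightarrow> linear T \<Longrightarrow> inj T \<Longrightarrow>
    oriented_image T (abs_oriented_subspace (b, us)) = abs_oriented_subspace (b, map T us)"
  by (subst oriented_image.abs_eq[OF frame_equiv_refl]) simp_all

lemma frame_image:
  fixes us :: "'a::euclidean_space list"
  assumes "distinct us" "independent (set us)" "linear T" "inj T"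
  shows "distinct (map T us)" "independent (set (map T us))"
  using assms inj_on_subset[OF assms(4)]
  by (simp_all add: distinct_map linear_independent_injective_image)

lemma subspace_of_oriented_image:
  assumes "linear T" "inj T"
  shows "subspace_of (oriented_image T U) = T ` subspace_of U"
proof (rule oriented_subspace_cases[of U])
  fix b us assume U: "U = abs_oriented_subspace (b, us)" "distinct us" "independent (set us)"
  show ?thesis
    using U assms frame_image[OF U(2,3) assms]
    by (simp add: oriented_image_abs subspace_of_abs linear_span_image)
qed

lemma oriented_image_comp:
  assumes "linear S" "inj S" "linear T" "inj T"
  shows "oriented_image S (oriented_image T U) = oriented_image (S \<circ> T) U"
proof (rule oriented_subspace_cases[of U])
  fix b us assume U: "U = abs_oriented_subspace (b, us)" "distinct us" "independent (set us)"
  show ?thesis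
    using U assms frame_image[OF U(2,3) assms(3,4)]
    by (simp add: oriented_image_abs linear_compose inj_compose)
qed

lemma oriented_image_id: "oriented_image (\<lambda>x. x) U = U"
proof (rule oriented_subspace_cases[of U])
  fix b us assume U: "U = abs_oriented_subspace (b, us)" "distinct us" "independent (set us)"
  show ?thesis
    using U by (simp add: oriented_image_abs linear_id[unfolded id_def])
qed

lemma Gr_oriented_image:
  assumes "linear T" "inj T"
  shows "oriented_image T U \<in> Gr d \<longleftrightarrow> U \<in> Gr d"
  using assms by (simp add: Gr_def subspace_of_oriented_image dim_image_eq[OF assms(1) inj_on_subset[OF assms(2)]])

text \<open>Continuity of the orbit maps is built into the topology. The open sets in its definition
  consist of injective maps, so injectivity of the limit extends to the maps near it.\<close>

lemma tendsto_oriented_image: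
  fixes A :: "'x \<Rightarrow> 'a::euclidean_space \<Rightarrow>\<^sub>L 'a"
  assumes A: "(A \<longlongrightarrow> L) F" and L: "inj (blinfun_apply L)"
  shows "((\<lambda>j. oriented_image (blinfun_apply (A j)) U) \<longlongrightarrow> oriented_image (blinfun_apply L) U) F"
proof (rule topological_tendstoI)
  fix S :: "'a oriented_subspace set" assume S: "open S" "oriented_image (blinfun_apply L) U \<in> S"
  have "open {A. inj (blinfun_apply A) \<and> oriented_image (blinfun_apply A) U \<in> S}"
    using S(1) by (simp add: open_oriented_subspace_def)
  from topological_tendstoD[OF A this] L S(2)
  show "\<forall>\<^sub>F j in F. oriented_image (blinfun_apply (A j)) U \<in> S"
    by (auto elim: eventually_mono)
qed

lemma inj_blinfun_inverse:
  fixes B :: "'a::euclidean_space \<Rightarrow>\<^sub>L 'a"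
  assumes "inj (blinfun_apply B)"
  obtains C where "inj (blinfun_apply C)" "\<And>x. blinfun_apply C (blinfun_apply B x) = x"
proof -
  obtain g where g: "linear g" "\<forall>x. g (blinfun_apply B x) = x" "\<forall>x. blinfun_apply B (g x) = x"
    using linear_injective_isomorphism[OF linear_blinfun assms] by blast
  have "blinfun_apply (Blinfun g) = g"
    using g(1) by (intro bounded_linear_Blinfun_apply) (simp add: linear_conv_bounded_linear[symmetric])
  moreover have "inj g" using g(3) by (metis injI)
  ultimately show ?thesis using g by (intro that[of "Blinfun g"]) auto
qed

text \<open>If \<open>B\<close> maps \<open>U'\<close> to the image of \<open>U\<close> under
  \<open>A\<close>, then \<open>U'\<close> is the image of \<open>U\<close> under
  \<open>C o\<^sub>L A\<close> with \<open>C\<close> the inverse of \<open>B\<close>. Hence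
  \<open>B'\<close> maps \<open>U'\<close> to the image of \<open>U\<close> under
  \<open>B' o\<^sub>L (C o\<^sub>L A)\<close>, which is continuous in \<open>B'\<close> and equals
  \<open>A\<close> at \<open>B' = B\<close>, so it stays in \<open>X\<close> nearby.\<close>

lemma open_orbit:
  fixes X :: "('a::euclidean_space \<Rightarrow>\<^sub>L 'a) set"
  assumes "open X"
  shows "open ((\<lambda>A. oriented_image (blinfun_apply A) U) ` {A \<in> X. inj (blinfun_apply A)})"
    (is "open ?S")
  unfolding open_oriented_subspace_def
proof (intro allI)
  fix U'
  let ?X = "X \<inter> {A. inj (blinfun_apply A)}"
  have oX: "open ?X" using assms open_inj_blinfun by (rule open_Int)
  show "open {B. inj (blinfun_apply B) \<and> oriented_image (blinfun_apply B) U' \<in> ?S}"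
  proof (subst open_subopen, intro ballI)
    fix B assume "B \<in> {B. inj (blinfun_apply B) \<and> oriented_image (blinfun_apply B) U' \<in> ?S}"
    then obtain A where B: "inj (blinfun_apply B)" and A: "A \<in> X" "inj (blinfun_apply A)"
      and eq: "oriented_image (blinfun_apply B) U' = oriented_image (blinfun_apply A) U"
      by auto
    obtain C where C: "inj (blinfun_apply C)" "\<And>x. blinfun_apply C (blinfun_apply B x) = x"
      using inj_blinfun_inverse[OF B] by blast
    have BC: "blinfun_apply B (blinfun_apply C x) = x" for x
      by (rule injD[OF C(1)]) (rule C(2))
    have CB: "blinfun_apply C \<circ> blinfun_apply B = (\<lambda>x. x)" using C(2) by auto
    have "U' = oriented_image (blinfun_apply C) (oriented_image (blinfun_apply B) U')"
      using oriented_image_comp[of "blinfun_apply C" "blinfun_apply B" U'] B C(1) by (simp add: CB oriented_image_id)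
    then have U': "U' = oriented_image (blinfun_apply C \<circ> blinfun_apply A) U"
      using A C(1) by (simp add: eq oriented_image_comp)
    define h where "h B' = B' o\<^sub>L (C o\<^sub>L A)" for B' :: "'a \<Rightarrow>\<^sub>L 'a"
    have happ: "blinfun_apply (h B') = blinfun_apply B' \<circ> (blinfun_apply C \<circ> blinfun_apply A)" for B'
      by (auto simp: h_def)
    have "open (h -` ?X)"
      unfolding h_def by (intro open_vimage oX continuous_intros)
    moreover have "B \<in> h -` ?X"
    proof -
      have "h B = A" by (rule blinfun_eqI) (simp add: h_def BC)
      then show ?thesis using A by simp
    qed
    moreover have "h -` ?X \<subseteq> {B. inj (blinfun_apply B) \<and> oriented_image (blinfun_apply B) U' \<in> ?S}"
    proof
      fix B' assume B': "B' \<in> h -` ?X"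
      have "blinfun_apply (C o\<^sub>L A) = blinfun_apply C \<circ> blinfun_apply A" by auto
      then have "inj (blinfun_apply (C o\<^sub>L A))" using inj_compose[OF C(1) A(2)] by simp
      then obtain E where E: "inj (blinfun_apply E)" "\<And>x. blinfun_apply E (blinfun_apply (C o\<^sub>L A) x) = x"
        using inj_blinfun_inverse by blast
      have CAE: "blinfun_apply (C o\<^sub>L A) (blinfun_apply E x) = x" for x
        by (rule injD[OF E(1)]) (rule E(2))
      \<comment> \<open>The second factor of \<open>h B'\<close> is invertible, so injectivity of
        the product is inherited by \<open>B'\<close>.\<close>
      have inj: "inj (blinfun_apply B')"
      proof (rule injI)
        fix x y assume "blinfun_apply B' x = blinfun_apply B' y"
        then have "blinfun_apply (h B') (blinfun_apply E x) = blinfun_apply (h B') (blinfun_apply E y)"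
          using CAE by (simp add: happ)
        then have "blinfun_apply E x = blinfun_apply E y" using B' by (auto dest: injD)
        then show "x = y" using E(1) by (auto dest: injD)
      qed
      have "oriented_image (blinfun_apply B') U' = oriented_image (blinfun_apply (h B')) U"
        unfolding U' happ using inj A(2) C(1)
        by (intro oriented_image_comp) (auto simp: linear_compose inj_compose)
      then show "B' \<in> {B. inj (blinfun_apply B) \<and> oriented_image (blinfun_apply B) U' \<in> ?S}"
        using inj B' by auto
    qed
    ultimately show "\<exists>T. open T \<and> B \<in> T \<and> T \<subseteq> {B. inj (blinfun_apply B) \<and> oriented_image (blinfun_apply B) U' \<in> ?S}"
      by blast
  qed
qed

text \<open>Orbit maps are open, so continuity can be tested along them at the identity.\<close>

lemma continuous_on_Gr:
  fixes f :: "'a::euclidean_space \<times> 'a oriented_subspace \<Rightarrow> 'c::topological_space"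
  assumes "\<And>x U. U \<in> Gr d \<Longrightarrow>
    ((\<lambda>(y, B). f (y, oriented_image (blinfun_apply B) U)) \<longlongrightarrow> f (x, U)) (nhds (x, id_blinfun))"
  shows "continuous_on (UNIV \<times> Gr d) f"
  unfolding continuous_on_topological
proof (intro ballI allI impI)
  fix p B assume p: "p \<in> UNIV \<times> Gr d" and B: "open B" "f p \<in> B"
  obtain x U where xU: "p = (x, U)" "U \<in> Gr d" using p by auto
  have "\<forall>\<^sub>F q in nhds (x, id_blinfun). (\<lambda>(y, B). f (y, oriented_image (blinfun_apply B) U)) q \<in> B"
    using topological_tendstoD[OF assms[OF xU(2)] B(1)] B(2) xU(1) by blast
  then obtain Q where Q12: "open Q" "(x, id_blinfun) \<in> Q"
    and Q3: "\<forall>q\<in>Q. (\<lambda>(y, B). f (y, oriented_image (blinfun_apply B) U)) q \<in> B"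
    unfolding eventually_nhds by blast
  have "f (y, oriented_image (blinfun_apply A) U) \<in> B" if "(y, A) \<in> Q" for y A
    using bspec[OF Q3 that] by simp
  note Q = Q12 this
  obtain Y X where YX: "open Y" "open X" "x \<in> Y" "id_blinfun \<in> X" "Y \<times> X \<subseteq> Q"
    by (rule open_prod_elim[OF Q(1,2)]) (rule that, auto)
  let ?S = "(\<lambda>A. oriented_image (blinfun_apply A) U) ` {A \<in> X. inj (blinfun_apply A)}"
  have "U \<in> ?S"
    using YX(4) by (intro image_eqI[where x = id_blinfun]) (simp_all add: oriented_image_id)
  then show "\<exists>A. open A \<and> p \<in> A \<and> (\<forall>q\<in>UNIV \<times> Gr d. q \<in> A \<longrightarrow> f q \<in> B)"
    using YX Q(3) open_orbit[OF YX(2), of U] xU(1)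
    by (intro exI[of _ "Y \<times> ?S"]) (auto intro: open_Times)
qed

subsection \<open>Gram determinants\<close>

definition gram :: "('a \<Rightarrow> 'b::real_inner) \<Rightarrow> 'a list \<Rightarrow> real mat" where
  "gram T us = Matrix.mat (length us) (length us) (\<lambda>(i, j). inner (T (us ! i)) (T (us ! j)))"

lemma gram_map: "gram T (map S us) = gram (\<lambda>u. T (S u)) us"
  by (auto simp: gram_def intro!: eq_matI)

text \<open>By the Leibniz formula the determinant is a polynomial in the entries.\<close>

lemma tendsto_det:
  fixes f :: "'x \<Rightarrow> nat \<Rightarrow> nat \<Rightarrow> real"
  assumes "\<And>i j. i < n \<Longrightarrow> j < n \<Longrightarrow> ((\<lambda>x. f x i j) \<longlongrightarrow> L i j) F"
  shows "((\<lambda>x. Determinant.det (Matrix.mat n n (\<lambda>(i, j). f x i j))) \<longlongrightarrow>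
    Determinant.det (Matrix.mat n n (\<lambda>(i, j). L i j))) F"
proof -
  have eq: "Determinant.det (Matrix.mat n n (\<lambda>(i, j). h i j)) =
      (\<Sum>p | p permutes {0..<n}. signof p * (\<Prod>i = 0..<n. h i (p i)))" for h :: "nat \<Rightarrow> nat \<Rightarrow> real"
  proof -
    have "Determinant.det (Matrix.mat n n (\<lambda>(i, j). h i j)) =
       (\<Sum>p | p permutes {0..<n}. signof p * (\<Prod>i = 0..<n. Matrix.mat n n (\<lambda>(i, j). h i j) $$ (i, p i)))"
      by (rule det_def') simp
    also have "\<dots> = (\<Sum>p | p permutes {0..<n}. signof p * (\<Prod>i = 0..<n. h i (p i)))"
      by (intro sum.cong refl arg_cong2[where f = "(*)"] prod.cong)
        (auto dest: permutes_in_image[THEN iffD2])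
    finally show ?thesis .
  qed
  show ?thesis
    unfolding eq
    by (intro tendsto_sum tendsto_mult tendsto_const tendsto_prod assms)
      (auto dest: permutes_in_image[THEN iffD2])
qed

lemma quadratic_form_mat:
  fixes h :: "nat \<Rightarrow> nat \<Rightarrow> real"
  assumes v: "v \<in> carrier_vec n"
  shows "v \<bullet> (Matrix.mat n n (\<lambda>(i, j). h i j) *\<^sub>v v) = (\<Sum>i<n. \<Sum>j<n. (v $ i) * (v $ j) * h i j)"
proof -
  let ?A = "Matrix.mat n n (\<lambda>(i, j). h i j)"
  have d: "dim_vec (?A *\<^sub>v v) = n" "dim_vec v = n" using v by auto
  have row: "(?A *\<^sub>v v) $ i = (\<Sum>j<n. h i j * v $ j)" if "i < n" for i
    using that d(2) by (simp add: scalar_prod_def atLeast0LessThan)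
  have "v \<bullet> (?A *\<^sub>v v) = (\<Sum>i<n. v $ i * (?A *\<^sub>v v) $ i)"
    unfolding scalar_prod_def d atLeast0LessThan ..
  also have "\<dots> = (\<Sum>i<n. v $ i * (\<Sum>j<n. h i j * v $ j))"
    by (intro sum.cong refl) (simp only: row lessThan_iff)
  also have "\<dots> = (\<Sum>i<n. \<Sum>j<n. (v $ i) * (v $ j) * h i j)"
    unfolding sum_distrib_left by (intro sum.cong refl) (simp only: mult_ac)
  finally show ?thesis .
qed
lemma norm_combination:
  "(norm (\<Sum>i<n. c i *\<^sub>R (w i :: 'b::real_inner)))\<^sup>2 = (\<Sum>i<n. \<Sum>j<n. c i * c j * inner (w i) (w j))"
  unfolding power2_norm_eq_inner inner_sum_left unfolding inner_sum_right
  by (intro sum.cong refl) simp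
lemma combination_inner:
  "inner (\<Sum>k<n. c k *\<^sub>R w k) (\<Sum>l<m. c' l *\<^sub>R w' l) = (\<Sum>l<m. (\<Sum>k<n. c k * inner (w k) (w' l)) * c' l)"
  for w w' :: "nat \<Rightarrow> 'b::real_inner"
  unfolding inner_sum_right unfolding inner_sum_left 
  by (intro sum.cong refl) (simp add: sum_distrib_left sum_distrib_right mult_ac)

text \<open>Distinctness translates independence of a set into coefficients indexed by list
  positions.\<close>

lemma independent_nth_combination:
  fixes us :: "'a::real_vector list"
  assumes "distinct us" "independent (set us)" "(\<Sum>i<length us. c i *\<^sub>R us ! i) = 0" "i < length us"
  shows "c i = 0"
proof -
  let ?f = "\<lambda>u. c (the_inv_into {..<length us} ((!) us) u)"
  have inj: "inj_on ((!) us) {..<length us}" using assms(1) by (simp add: inj_on_nth)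
  have img: "(!) us ` {..<length us} = set us" by (auto simp: set_conv_nth)
  have "(\<Sum>u\<in>set us. ?f u *\<^sub>R u) = (\<Sum>i<length us. c i *\<^sub>R us ! i)"
    unfolding img[symmetric] sum.reindex[OF inj]
    by (intro sum.cong refl) (simp add: the_inv_into_f_f[OF inj])
  then have "(\<Sum>u\<in>set us. ?f u *\<^sub>R u) = 0" using assms(3) by simp
  from independentD[OF assms(2) finite_set subset_refl this, of "us ! i"] have "?f (us ! i) = 0"
    using assms(4) by simp
  then show ?thesis using the_inv_into_f_f[OF inj, of i] assms(4) by simp
qed

text \<open>The segment from the identity to the Gram matrix consists of invertible matrices.\<close>

lemma det_gram_pos:
  fixes us :: "'a::euclidean_space list"
  assumes us: "distinct us" "independent (set us)" and T: "linear T" "inj T"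
  shows "0 < Determinant.det (gram T us)"
proof (rule ccontr)
  let ?n = "length us"
  let ?g = "\<lambda>i j. inner (T (us ! i)) (T (us ! j))"
  define h :: "real \<Rightarrow> nat \<Rightarrow> nat \<Rightarrow> real" where "h s i j = (1 - s) * (if i = j then 1 else 0) + s * ?g i j" for s i j
  define \<delta> where "\<delta> s = Determinant.det (Matrix.mat ?n ?n (\<lambda>(i, j). h s i j))" for s
  assume "\<not> 0 < Determinant.det (gram T us)"
  moreover have "Determinant.det (gram T us) = \<delta> 1" by (simp add: \<delta>_def h_def gram_def)
  ultimately have 1: "\<delta> 1 \<le> 0" by simp
  have "Matrix.mat ?n ?n (\<lambda>(i, j). h 0 i j) = 1\<^sub>m ?n" by (auto simp: h_def)
  then have 0: "\<delta> 0 = 1" by (simp add: \<delta>_def)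
  have "continuous_on {0..1} \<delta>"
    unfolding continuous_on_def \<delta>_def
    by (intro ballI tendsto_det) (auto simp: h_def intro!: tendsto_intros)
  \<comment> \<open>A determinant that is 1 at the identity and nonpositive at the Gram matrix
    vanishes somewhere on the segment.\<close>
  then obtain s where s: "0 \<le> s" "s \<le> 1" "\<delta> s = 0"
    using IVT2'[of \<delta> 1 0 0] 0 1 by auto
  obtain v where v: "v \<in> carrier_vec ?n" "v \<noteq> 0\<^sub>v ?n" "Matrix.mat ?n ?n (\<lambda>(i, j). h s i j) *\<^sub>v v = 0\<^sub>v ?n"
    using s(3) det_0_iff_vec_prod_zero[of "Matrix.mat ?n ?n (\<lambda>(i, j). h s i j)" ?n] by (auto simp: \<delta>_def)
  \<comment> \<open>The quadratic form of a kernel vector splits into two nonnegative parts, which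
    must both vanish. For \<open>s < 1\<close> the part from the identity gives
    \<open>v = 0\<close>; for \<open>s = 1\<close> injectivity of \<open>T\<close> and independence
    do.\<close>
  have "0 = v \<bullet> (Matrix.mat ?n ?n (\<lambda>(i, j). h s i j) *\<^sub>v v)" using v by simp
  also have "\<dots> = (\<Sum>i<?n. \<Sum>j<?n. (v $ i) * (v $ j) * h s i j)" by (rule quadratic_form_mat[OF v(1)])
  also have "\<dots> = (1 - s) * (\<Sum>i<?n. \<Sum>j<?n. (v $ i) * (v $ j) * (if i = j then 1 else 0))
      + s * (\<Sum>i<?n. \<Sum>j<?n. (v $ i) * (v $ j) * ?g i j)"
    by (simp add: h_def sum_distrib_left sum.distrib[symmetric] algebra_simps)
  also have "(\<Sum>i<?n. \<Sum>j<?n. (v $ i) * (v $ j) * (if i = j then 1 else 0)) = (\<Sum>i<?n. (v $ i)\<^sup>2)"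
  proof (rule sum.cong[OF refl])
    fix i assume i: "i \<in> {..<?n}"
    have "(\<Sum>j<?n. (v $ i) * (v $ j) * (if i = j then 1 else 0)) = (\<Sum>j<?n. if i = j then (v $ i)\<^sup>2 else 0)"
      by (intro sum.cong) (auto simp: power2_eq_square)
    also have "\<dots> = (v $ i)\<^sup>2" using i by simp
    finally show "(\<Sum>j<?n. (v $ i) * (v $ j) * (if i = j then 1 else 0)) = (v $ i)\<^sup>2" .
  qed
  also have "(\<Sum>i<?n. \<Sum>j<?n. (v $ i) * (v $ j) * ?g i j) = (norm (\<Sum>i<?n. (v $ i) *\<^sub>R T (us ! i)))\<^sup>2"
    by (rule norm_combination[symmetric])
  finally have eq: "(1 - s) * (\<Sum>i<?n. (v $ i)\<^sup>2) + s * (norm (\<Sum>i<?n. (v $ i) *\<^sub>R T (us ! i)))\<^sup>2 = 0" by simp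
  have nn: "0 \<le> (1 - s) * (\<Sum>i<?n. (v $ i)\<^sup>2)" "0 \<le> s * (norm (\<Sum>i<?n. (v $ i) *\<^sub>R T (us ! i)))\<^sup>2"
    using s by (auto intro!: mult_nonneg_nonneg sum_nonneg)
  have "v $ i = 0" if i: "i < ?n" for i
  proof (cases "s = 1")
    case True
    then have "(\<Sum>i<?n. (v $ i) *\<^sub>R T (us ! i)) = 0" using eq by simp
    then have "T (\<Sum>i<?n. (v $ i) *\<^sub>R us ! i) = 0"
      by (simp add: linear_sum[OF T(1)] linear_scale[OF T(1)])
    then have "(\<Sum>i<?n. (v $ i) *\<^sub>R us ! i) = 0" using T by (simp add: linear_injective_0)
    then show ?thesis by (rule independent_nth_combination[OF us _ i])
  next
    case False
    then have "(\<Sum>i<?n. (v $ i)\<^sup>2) = 0" using eq nn s by (smt (verit) mult_eq_0_iff)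
    then show ?thesis using i by (simp add: sum_nonneg_eq_0_iff)
  qed
  then have "v = 0\<^sub>v ?n" using v(1) by (intro eq_vecI) auto
  then show False using v(2) by simp
qed

lemma gram_change_of_basis:
  fixes us :: "'a::euclidean_space list"
  assumes M: "M \<in> carrier_mat n n" and n: "length us = n" and T: "linear T"
    and vs: "vs = map (\<lambda>i. \<Sum>j<n. (M $$ (i, j)) *\<^sub>R us ! j) [0..<n]"
  shows "gram T vs = M * gram T us * transpose_mat M"
proof (rule eq_matI)
  show "dim_row (gram T vs) = dim_row (M * gram T us * transpose_mat M)"
    "dim_col (gram T vs) = dim_col (M * gram T us * transpose_mat M)"
    using M by (auto simp: gram_def vs)
next
  fix i j assume "i < dim_row (M * gram T us * transpose_mat M)" "j < dim_col (M * gram T us * transpose_mat M)"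
  then have ij: "i < n" "j < n" using M by auto
  have "gram T vs $$ (i, j) = inner (\<Sum>k<n. (M $$ (i, k)) *\<^sub>R T (us ! k)) (\<Sum>l<n. (M $$ (j, l)) *\<^sub>R T (us ! l))"
    using ij by (simp add: gram_def vs linear_sum[OF T] linear_scale[OF T])
  also have "\<dots> = (\<Sum>l<n. (\<Sum>k<n. M $$ (i, k) * inner (T (us ! k)) (T (us ! l))) * M $$ (j, l))"
    by (rule combination_inner)
  also have "\<dots> = (\<Sum>l<n. (M * gram T us) $$ (i, l) * M $$ (j, l))"
  proof (intro sum.cong refl arg_cong2[where f = "(*)"])
    fix l assume "l \<in> {..<n}"
    then have "(M * gram T us) $$ (i, l) = (\<Sum>k<n. row M i $ k * col (gram T us) l $ k)"
      using ij M n by (simp add: scalar_prod_def atLeast0LessThan gram_def)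
    also have "\<dots> = (\<Sum>k<n. M $$ (i, k) * inner (T (us ! k)) (T (us ! l)))"
      using ij M n \<open>l \<in> {..<n}\<close> by (intro sum.cong) (auto simp: gram_def)
    finally show "(\<Sum>k<n. M $$ (i, k) * inner (T (us ! k)) (T (us ! l))) = (M * gram T us) $$ (i, l)" ..
  qed
  also have "\<dots> = (\<Sum>l<n. row (M * gram T us) i $ l * col (transpose_mat M) j $ l)"
    using ij M n by (intro sum.cong) (auto simp: gram_def)
  also have "\<dots> = (M * gram T us * transpose_mat M) $$ (i, j)"
    using ij M n by (simp add: scalar_prod_def atLeast0LessThan)
  finally show "gram T vs $$ (i, j) = (M * gram T us * transpose_mat M) $$ (i, j)" .
qed

lemma det_gram_change_of_basis:
  fixes us :: "'a::euclidean_space list"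
  assumes M: "M \<in> carrier_mat n n" and n: "length us = n" and T: "linear T"
    and vs: "vs = map (\<lambda>i. \<Sum>j<n. (M $$ (i, j)) *\<^sub>R us ! j) [0..<n]"
  shows "Determinant.det (gram T vs) = (Determinant.det M)\<^sup>2 * Determinant.det (gram T us)"
proof -
  have g: "gram T us \<in> carrier_mat n n" using n by (simp add: gram_def)
  show ?thesis
    unfolding gram_change_of_basis[OF assms]
    using M g det_mult[of "M * gram T us" n "transpose_mat M"] det_mult[OF M g] det_transpose[OF M]
    by (simp add: power2_eq_square)
qed

section \<open>Orthonormal frames and the Jacobian of a linear map on a subspace\<close>

lemma orthonormal_frame_props:
  assumes "orthonormal_frame U os"
  shows "distinct os" "independent (set os)" "gram (\<lambda>x. x) os = 1\<^sub>m (length os)"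
    "x \<in> subspace_of U \<Longrightarrow> x = (\<Sum>j<length os. inner x (os ! j) *\<^sub>R os ! j)"
proof -
  have o: "\<And>i j. i < length os \<Longrightarrow> j < length os \<Longrightarrow> inner (os ! i) (os ! j) = (if i = j then 1 else 0)"
    and sp: "span (set os) = subspace_of U"
    using assms by (auto simp: orthonormal_frame_def)
  show d: "distinct os"
    unfolding distinct_conv_nth using o by (metis zero_neq_one)
  show "independent (set os)"
  proof (rule pairwise_orthogonal_independent)
    show "pairwise Linear_Algebra.orthogonal (set os)"
      using o by (auto simp: pairwise_def Linear_Algebra.orthogonal_def in_set_conv_nth)
    show "0 \<notin> set os" using o by (auto simp: in_set_conv_nth) (metis inner_zero_left zero_neq_one)
  qed
  show "gram (\<lambda>x. x) os = 1\<^sub>m (length os)" by (auto simp: gram_def o)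
  assume x: "x \<in> subspace_of U"
  show "x = (\<Sum>j<length os. inner x (os ! j) *\<^sub>R os ! j)"
  proof (rule linear_eq_on_span[where B = "set os" and f = "\<lambda>x. x" and g = "\<lambda>x. \<Sum>j<length os. inner x (os ! j) *\<^sub>R os ! j"])
    show "linear (\<lambda>x. x :: 'a)" by (rule linear_id[unfolded id_def])
    show "linear (\<lambda>x. \<Sum>j<length os. inner x (os ! j) *\<^sub>R os ! j)"
      by (rule linearI) (simp_all add: inner_add_left scaleR_add_left sum.distrib scaleR_sum_right)
    fix y assume "y \<in> set os"
    then obtain i where i: "i < length os" "y = os ! i" by (auto simp: in_set_conv_nth)
    have "(\<Sum>j<length os. inner y (os ! j) *\<^sub>R os ! j) = (\<Sum>j<length os. if i = j then os ! j else 0)"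
      using i o by (intro sum.cong) auto
    then show "y = (\<Sum>j<length os. inner y (os ! j) *\<^sub>R os ! j)" using i by simp
  qed (use x sp in auto)
qed

lemma orthonormal_frame_exists: "\<exists>os. orthonormal_frame U os"
proof (rule oriented_subspace_cases[of U])
  fix b us assume U: "U = abs_oriented_subspace (b, us)" "distinct us" "independent (set us)"
  have "subspace (subspace_of U)" using U by (simp add: subspace_of_abs)
  then obtain B where B: "B \<subseteq> subspace_of U" "pairwise Linear_Algebra.orthogonal B" "\<And>x. x \<in> B \<Longrightarrow> norm x = 1"
     "independent B" "span B = subspace_of U"
    using orthonormal_basis_subspace[of "subspace_of U"] by metis
  obtain os where os: "set os = B" "distinct os"
    using finite_distinct_list[of B] B(4) independent_imp_finite by blast
  have "orthonormal_frame U os"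
    unfolding orthonormal_frame_def
  proof (intro conjI allI impI)
    fix i j assume ij: "i < length os" "j < length os"
    show "inner (os ! i) (os ! j) = (if i = j then 1 else 0)"
    proof (cases "i = j")
      case True
      then show ?thesis using B(3)[of "os ! i"] os ij by (auto simp: norm_eq_1)
    next
      case False
      then have "os ! i \<noteq> os ! j" using os(2) ij by (simp add: nth_eq_iff_index_eq)
      then show ?thesis using B(2) os(1) ij False by (auto simp: pairwise_def Linear_Algebra.orthogonal_def)
    qed
  qed (use os B in auto)
  then show ?thesis ..
qed

text \<open>The choice made inside \<open>jac\<close>, named so that it can be exchanged for an
  arbitrary basis.\<close>

definition frame_of :: "'a::euclidean_space oriented_subspace \<Rightarrow> 'a list" where
  "frame_of U = (SOME us. orthonormal_frame U us)"

lemma orthonormal_frame_of: "orthonormal_frame U (frame_of U)"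
  unfolding frame_of_def by (rule someI_ex[OF orthonormal_frame_exists])

text \<open>The Jacobian as a function of the derivative alone, so that its limits follow from those
  of \<open>dtraj\<close>.\<close>

definition jac_blinfun :: "'a::euclidean_space oriented_subspace \<Rightarrow> ('a \<Rightarrow>\<^sub>L 'a) \<Rightarrow> real" where
  "jac_blinfun U A = sqrt (Determinant.det (gram (blinfun_apply A) (frame_of U)))"

lemma jac_eq_jac_blinfun:
  assumes "frechet_derivative \<phi> (at x) = blinfun_apply A"
  shows "jac \<phi> x U = jac_blinfun U A"
  by (simp add: jac_def Let_def assms jac_blinfun_def gram_def frame_of_def)

lemma jac_blinfun_pos:
  assumes "inj (blinfun_apply A)"
  shows "0 < jac_blinfun U A"
  unfolding jac_blinfun_def
  using det_gram_pos[OF orthonormal_frame_props(1,2)[OF orthonormal_frame_of] linear_blinfun assms] by simp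

lemma tendsto_det_gram:
  fixes T :: "'x \<Rightarrow> 'a \<Rightarrow> 'b::real_inner"
  assumes "\<And>u. u \<in> set us \<Longrightarrow> ((\<lambda>x. T x u) \<longlongrightarrow> T' u) F"
  shows "((\<lambda>x. Determinant.det (gram (T x) us)) \<longlongrightarrow> Determinant.det (gram T' us)) F"
  unfolding gram_def by (intro tendsto_det tendsto_inner assms) auto

lemma tendsto_jac_blinfun:
  assumes "(A \<longlongrightarrow> L) F"
  shows "((\<lambda>x. jac_blinfun U (A x)) \<longlongrightarrow> jac_blinfun U L) F"
  unfolding jac_blinfun_def
  by (intro tendsto_real_sqrt tendsto_det_gram blinfun.tendsto assms tendsto_const)

text \<open>The orthonormal frame is an arbitrary choice and need not vary continuously with the
  subspace. The quotient allows any basis: both Gram determinants carry the squared determinant of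
  the change of basis, which cancels.\<close>

lemma jac_blinfun_arbitrary_frame:
  assumes us: "distinct us" "independent (set us)"
  shows "jac_blinfun (abs_oriented_subspace (b, us)) A =
    sqrt (Determinant.det (gram (blinfun_apply A) us) / Determinant.det (gram (\<lambda>x. x) us))"
proof -
  define U where "U = abs_oriented_subspace (b, us)"
  define os where "os = frame_of U"
  have on: "orthonormal_frame U os" unfolding os_def by (rule orthonormal_frame_of)
  note op = orthonormal_frame_props[OF on]
  have sp: "subspace_of U = span (set us)" using us by (simp add: U_def subspace_of_abs)
  have "length os = card (set os)" "length us = card (set us)"
    using op(1) us(1) by (simp_all add: distinct_card)
  moreover have "card (set os) = dim (span (set os))" "card (set us) = dim (span (set us))"
    using op(2) us(2) by (simp_all add: dim_eq_card_independent)
  moreover have "span (set os) = span (set us)" using on sp by (simp add: orthonormal_frame_def)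
  ultimately have len: "length os = length us" by simp
  let ?n = "length us"
  define M where "M = Matrix.mat ?n ?n (\<lambda>(i, j). inner (us ! i) (os ! j))"
  have M: "M \<in> carrier_mat ?n ?n" by (simp add: M_def)
  have eq: "us = map (\<lambda>i. \<Sum>j<?n. (M $$ (i, j)) *\<^sub>R os ! j) [0..<?n]"
  proof (rule nth_equalityI)
    fix i assume i: "i < length us"
    have "us ! i \<in> subspace_of U" using i unfolding sp by (intro span_base) simp
    from op(4)[OF this] i show "us ! i = map (\<lambda>i. \<Sum>j<?n. (M $$ (i, j)) *\<^sub>R os ! j) [0..<?n] ! i"
      by (simp add: M_def len)
  qed simp
  have 1: "Determinant.det (gram (blinfun_apply A) us) = (Determinant.det M)\<^sup>2 * Determinant.det (gram (blinfun_apply A) os)"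
    by (rule det_gram_change_of_basis[OF M len linear_blinfun eq])
  have 2: "Determinant.det (gram (\<lambda>x. x) us) = (Determinant.det M)\<^sup>2"
    using det_gram_change_of_basis[OF M len linear_id[unfolded id_def] eq] op(3) by simp
  have "0 < Determinant.det (gram (\<lambda>x. x) us)"
    by (rule det_gram_pos[OF us linear_id[unfolded id_def]]) simp
  then show ?thesis
    unfolding jac_blinfun_def U_def[symmetric] os_def[symmetric] using 1 2 by simp
qed

text \<open>Along an orbit map the varied subspace has the transported basis
  \<open>map B us\<close>, and the quotient of Gram determinants for this basis is continuous in
  \<open>B\<close>.\<close>

lemma continuous_jac_blinfun:
  fixes T :: "'a::euclidean_space \<Rightarrow> 'a \<Rightarrow>\<^sub>L 'a"
  assumes T: "continuous_on UNIV T"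
  shows "continuous_on (UNIV \<times> Gr d) (\<lambda>(x, U). jac_blinfun U (T x))"
proof (rule continuous_on_Gr)
  fix x :: 'a and U :: "'a oriented_subspace" assume "U \<in> Gr d"
  let ?F = "nhds (x, id_blinfun :: 'a \<Rightarrow>\<^sub>L 'a)"
  obtain b us where U: "U = abs_oriented_subspace (b, us)" "distinct us" "independent (set us)"
    by (rule oriented_subspace_cases)
  have fst: "(fst \<longlongrightarrow> x) ?F" and snd: "(snd \<longlongrightarrow> id_blinfun) ?F"
    by (auto intro!: tendsto_eq_intros filterlim_ident)
  have Tx: "((\<lambda>q. T (fst q)) \<longlongrightarrow> T x) ?F"
    by (rule continuous_on_tendsto_compose[OF T fst]) auto
  have ev: "\<forall>\<^sub>F q in ?F. inj (blinfun_apply (snd q))"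
    using topological_tendstoD[OF snd open_inj_blinfun] by simp
  have p: "Determinant.det (gram (\<lambda>u. u) us) \<noteq> 0"
    using det_gram_pos[OF U(2,3) linear_id[unfolded id_def]] by simp
  let ?j = "\<lambda>q. sqrt (Determinant.det (gram (\<lambda>u. blinfun_apply (T (fst q)) (blinfun_apply (snd q) u)) us) /
      Determinant.det (gram (\<lambda>u. blinfun_apply (snd q) u) us))"
  have "(?j \<longlongrightarrow>
      sqrt (Determinant.det (gram (\<lambda>u. blinfun_apply (T x) (blinfun_apply id_blinfun u)) us) / Determinant.det (gram (\<lambda>u. blinfun_apply id_blinfun u) us))) ?F"
    by (intro tendsto_real_sqrt tendsto_divide tendsto_det_gram blinfun.tendsto Tx snd tendsto_const) (use p in simp)
  then have lim: "(?j \<longlongrightarrow> jac_blinfun U (T x)) ?F"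
    by (simp add: U jac_blinfun_arbitrary_frame)
  have "((\<lambda>q. jac_blinfun (oriented_image (blinfun_apply (snd q)) U) (T (fst q))) \<longlongrightarrow> jac_blinfun U (T x)) ?F"
  proof (rule Lim_transform_eventually[OF lim])
    show "\<forall>\<^sub>F q in ?F. ?j q = jac_blinfun (oriented_image (blinfun_apply (snd q)) U) (T (fst q))"
      using ev
    proof eventually_elim
      fix q :: "'a \<times> ('a \<Rightarrow>\<^sub>L 'a)" assume q: "inj (blinfun_apply (snd q))"
      show "?j q = jac_blinfun (oriented_image (blinfun_apply (snd q)) U) (T (fst q))"
        using U frame_image[OF U(2,3) linear_blinfun q] q
        by (simp add: oriented_image_abs jac_blinfun_arbitrary_frame gram_map del: set_map)
    qed
  qed
  then show "((\<lambda>(y, B). (\<lambda>(x, U). jac_blinfun U (T x)) (y, oriented_image (blinfun_apply B) U)) \<longlongrightarrow>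
      (\<lambda>(x, U). jac_blinfun U (T x)) (x, U)) ?F"
    by (simp add: case_prod_unfold)
qed

lemma continuous_oriented_image:
  fixes T :: "'a::euclidean_space \<Rightarrow> 'a \<Rightarrow>\<^sub>L 'a"
  assumes \<phi>: "continuous_on UNIV \<phi>" and T: "continuous_on UNIV T" and inj: "\<And>x. inj (blinfun_apply (T x))"
  shows "continuous_on (UNIV \<times> Gr d) (\<lambda>(x, U). (\<phi> x, oriented_image (blinfun_apply (T x)) U))"
proof (rule continuous_on_Gr)
  fix x :: 'a and U :: "'a oriented_subspace" assume "U \<in> Gr d"
  let ?F = "nhds (x, id_blinfun :: 'a \<Rightarrow>\<^sub>L 'a)"
  have fst: "(fst \<longlongrightarrow> x) ?F" and snd: "(snd \<longlongrightarrow> id_blinfun) ?F"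
    by (auto intro!: tendsto_eq_intros filterlim_ident)
  have Tx: "((\<lambda>q. T (fst q)) \<longlongrightarrow> T x) ?F" "((\<lambda>q. \<phi> (fst q)) \<longlongrightarrow> \<phi> x) ?F"
    by (rule continuous_on_tendsto_compose[OF T fst] continuous_on_tendsto_compose[OF \<phi> fst]; simp)+
  have ev: "\<forall>\<^sub>F q in ?F. inj (blinfun_apply (snd q))"
    using topological_tendstoD[OF snd open_inj_blinfun] by simp
  have "((\<lambda>q. T (fst q) o\<^sub>L snd q) \<longlongrightarrow> T x o\<^sub>L id_blinfun) ?F"
    by (intro tendsto_intros Tx snd)
  moreover have "T x o\<^sub>L id_blinfun = T x" by (rule blinfun_eqI) simp
  ultimately have "((\<lambda>q. oriented_image (blinfun_apply (T (fst q) o\<^sub>L snd q)) U) \<longlongrightarrow> oriented_image (blinfun_apply (T x)) U) ?F"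
    by (intro tendsto_oriented_image inj) simp
  then have "((\<lambda>q. oriented_image (blinfun_apply (T (fst q))) (oriented_image (blinfun_apply (snd q)) U)) \<longlongrightarrow> oriented_image (blinfun_apply (T x)) U) ?F"
  proof (rule Lim_transform_eventually)
    show "\<forall>\<^sub>F q in ?F. oriented_image (blinfun_apply (T (fst q) o\<^sub>L snd q)) U = oriented_image (blinfun_apply (T (fst q))) (oriented_image (blinfun_apply (snd q)) U)"
      using ev
    proof eventually_elim
      fix q :: "'a \<times> ('a \<Rightarrow>\<^sub>L 'a)" assume q: "inj (blinfun_apply (snd q))"
      have "blinfun_apply (T (fst q) o\<^sub>L snd q) = blinfun_apply (T (fst q)) \<circ> blinfun_apply (snd q)" by auto
      then show "oriented_image (blinfun_apply (T (fst q) o\<^sub>L snd q)) U = oriented_image (blinfun_apply (T (fst q))) (oriented_image (blinfun_apply (snd q)) U)"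
        using q inj by (simp add: oriented_image_comp)
    qed
  qed
  from tendsto_Pair[OF Tx(2) this]
  show "((\<lambda>(y, B). (\<lambda>(x, U). (\<phi> x, oriented_image (blinfun_apply (T x)) U)) (y, oriented_image (blinfun_apply B) U)) \<longlongrightarrow>
      (\<lambda>(x, U). (\<phi> x, oriented_image (blinfun_apply (T x)) U)) (x, U)) ?F"
    by (simp add: case_prod_unfold)
qed

subsection \<open>Discrete varifolds\<close>

lemma space_varifold_space: "space (varifold_space d) = UNIV \<times> Gr d"
  by (simp add: varifold_space_def space_restrict_space)

lemma varifold_measurable:
  "continuous_on (UNIV \<times> Gr d) f \<Longrightarrow> f \<in> borel_measurable (varifold_space d)"
  unfolding varifold_space_def by (rule borel_measurable_continuous_on_restrict)

lemma fst_varifold_measurable: "fst \<in> borel_measurable (varifold_space d)"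
  by (intro varifold_measurable continuous_intros)

locale discrete_data =
  fixes d N :: nat and r :: "nat \<Rightarrow> real" and x :: "nat \<Rightarrow> 'a::euclidean_space"
    and U :: "nat \<Rightarrow> 'a oriented_subspace"
  assumes r_pos: "i < N \<Longrightarrow> 0 < r i" and U_Gr: "i < N \<Longrightarrow> U i \<in> Gr d"
begin

abbreviation \<mu> :: "('a \<times> 'a oriented_subspace) measure" where "\<mu> \<equiv> discrete_varifold d N r x U"

lemma point_measurable:
  "(\<lambda>i. (x i, U i)) \<in> point_measure {..<N} (\<lambda>i. ennreal (r i)) \<rightarrow>\<^sub>M varifold_space d"
  by (auto simp: space_varifold_space U_Gr)

lemma sets_\<mu> [measurable_cong]: "sets \<mu> = sets (varifold_space d)"
  by (simp add: discrete_varifold_def)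

lemma space_\<mu>: "space \<mu> = UNIV \<times> Gr d"
  by (simp add: discrete_varifold_def space_varifold_space)

lemma borel_measurable_\<mu>: "borel_measurable \<mu> = borel_measurable (varifold_space d)"
  by (rule measurable_cong_sets[OF sets_\<mu> refl])

lemma LINT_\<mu>:
  fixes f :: "_ \<Rightarrow> real"
  assumes "f \<in> borel_measurable (varifold_space d)"
  shows "(LINT p|\<mu>. f p) = (\<Sum>i<N. r i * f (x i, U i))"
proof -
  have nn: "\<And>i. i \<in> {..<N} \<Longrightarrow> 0 \<le> r i" using r_pos by (simp add: less_imp_le)
  show ?thesis
    unfolding discrete_varifold_def integral_distr[OF point_measurable assms]
    by (subst lebesgue_integral_point_measure_finite) (use nn in auto)
qed

lemma fst_\<mu>: "fst \<in> \<mu> \<rightarrow>\<^sub>M borel"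
  using fst_varifold_measurable by (simp add: borel_measurable_\<mu>)

lemma sets_weight [simp]: "sets (weight \<mu>) = sets borel"
  by (simp add: weight_def)

lemma borel_measurable_weight: "borel_measurable (weight \<mu>) = borel_measurable borel"
  by (rule measurable_cong_sets[OF sets_weight refl])

lemma LINT_weight:
  fixes f :: "'a \<Rightarrow> real"
  assumes "f \<in> borel_measurable borel"
  shows "(LINT y|weight \<mu>. f y) = (\<Sum>i<N. r i * f (x i))"
proof -
  have "(\<lambda>p. f (fst p)) \<in> borel_measurable (varifold_space d)"
    by (rule measurable_compose[OF fst_varifold_measurable assms])
  then show ?thesis
    unfolding weight_def by (simp add: integral_distr[OF fst_\<mu> assms] LINT_\<mu>)
qed

lemma integrable_weight:
  fixes f :: "'a \<Rightarrow> real"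
  assumes f: "f \<in> borel_measurable borel"
  shows "integrable (weight \<mu>) f"
proof -
  have m: "(\<lambda>p. f (fst p)) \<in> borel_measurable (varifold_space d)"
    by (rule measurable_compose[OF fst_varifold_measurable f])
  show ?thesis
    unfolding weight_def integrable_distr_eq[OF fst_\<mu> f]
    unfolding discrete_varifold_def integrable_distr_eq[OF point_measurable m]
    by (rule integrable_point_measure_finite) simp
qed

text \<open>A finite sum of point masses makes every Borel function square integrable.\<close>

lemma L2_space_weight: "L2_space (weight \<mu>) = borel_measurable borel"
proof -
  have "integrable (weight \<mu>) (\<lambda>y. (f y)\<^sup>2)" if "f \<in> borel_measurable borel" for f :: "'a \<Rightarrow> real"
    by (rule integrable_weight) (use that in measurable)
  then show ?thesis by (auto simp: L2_space_def borel_measurable_weight)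
qed

lemma weighted_square_sum_nonneg: "0 \<le> (\<Sum>i<N. r i * (f i)\<^sup>2)"
  using r_pos by (auto intro!: sum_nonneg mult_nonneg_nonneg simp: less_imp_le)

lemma L2_norm_weight:
  assumes "f \<in> borel_measurable borel"
  shows "L2_norm (weight \<mu>) f = sqrt (\<Sum>i<N. r i * (f (x i))\<^sup>2)"
proof -
  have "(\<lambda>y. (f y)\<^sup>2) \<in> borel_measurable borel" using assms by measurable
  then show ?thesis unfolding L2_norm_def by (simp add: LINT_weight)
qed

lemma emeasure_weight:
  assumes "S \<in> sets borel"
  shows "emeasure (weight \<mu>) S = (\<Sum>i | i < N \<and> x i \<in> S. ennreal (r i))"
proof -
  have "emeasure (weight \<mu>) S = emeasure \<mu> (fst -` S \<inter> space \<mu>)"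
    unfolding weight_def by (rule emeasure_distr[OF fst_\<mu> assms])
  also have "\<dots> = emeasure (point_measure {..<N} (\<lambda>i. ennreal (r i)))
     ((\<lambda>i. (x i, U i)) -` (fst -` S \<inter> space \<mu>) \<inter> space (point_measure {..<N} (\<lambda>i. ennreal (r i))))"
    using measurable_sets[OF fst_varifold_measurable assms, of d]
    unfolding discrete_varifold_def
    by (intro emeasure_distr[OF point_measurable]) (simp add: space_varifold_space)
  also have "((\<lambda>i. (x i, U i)) -` (fst -` S \<inter> space \<mu>) \<inter> space (point_measure {..<N} (\<lambda>i. ennreal (r i)))) = {i. i < N \<and> x i \<in> S}"
    by (auto simp: space_\<mu> space_point_measure U_Gr)
  also have "emeasure (point_measure {..<N} (\<lambda>i. ennreal (r i))) \<dots> = (\<Sum>i | i < N \<and> x i \<in> S. ennreal (r i))"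
    by (rule emeasure_point_measure_finite) auto
  finally show ?thesis .
qed

lemma msupp_weight: "msupp (weight \<mu>) = x ` {..<N}"
proof (rule Set.set_eqI)
  fix y
  have pos: "0 < emeasure (weight \<mu>) S \<longleftrightarrow> (\<exists>i<N. x i \<in> S)" if "open S" for S
  proof -
    have "0 < emeasure (weight \<mu>) S \<longleftrightarrow> (\<Sum>i | i < N \<and> x i \<in> S. ennreal (r i)) \<noteq> 0"
      using that by (simp add: emeasure_weight zero_less_iff_neq_zero)
    also have "\<dots> \<longleftrightarrow> (\<exists>i<N. x i \<in> S)"
      using r_pos by (auto simp: ennreal_eq_0_iff not_le)
    finally show ?thesis .
  qed
  show "y \<in> msupp (weight \<mu>) \<longleftrightarrow> y \<in> x ` {..<N}"
  proof
    assume y: "y \<in> msupp (weight \<mu>)"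
    show "y \<in> x ` {..<N}"
    proof (rule ccontr)
      assume "y \<notin> x ` {..<N}"
      moreover have "open (- (x ` {..<N}))" by (intro open_Compl finite_imp_closed) simp
      ultimately have "0 < emeasure (weight \<mu>) (- (x ` {..<N}))" using y by (auto simp: msupp_def)
      then show False using pos[OF \<open>open (- (x ` {..<N}))\<close>] by auto
    qed
  next
    assume "y \<in> x ` {..<N}"
    then show "y \<in> msupp (weight \<mu>)" using pos by (auto simp: msupp_def)
  qed
qed

text \<open>Evaluation at a support point is continuous for the L2 seminorm because the point
  carries mass at least \<open>r i > 0\<close>. This gives meaning to the values of \<eta> at these
  points.\<close>

lemma bochner_L2_weight_point:
  assumes \<eta>: "\<eta> \<in> bochner_L2 (L2_space (weight \<mu>)) (L2_norm (weight \<mu>))" and i: "i < N"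
  shows "(\<lambda>t. \<eta> t (x i)) \<in> borel_measurable leb01"
    and "integrable leb01 (\<lambda>t. (\<eta> t (x i))\<^sup>2)"
proof -
  obtain s where s: "\<And>k. simple_function leb01 (s k)" "\<And>k t. t \<in> {0..1} \<Longrightarrow> s k t \<in> borel_measurable borel"
    and lim: "AE t in leb01. (\<lambda>k. L2_norm (weight \<mu>) (s k t - \<eta> t)) \<longlonglongrightarrow> 0"
    and \<eta>b: "\<And>t. t \<in> {0..1} \<Longrightarrow> \<eta> t \<in> borel_measurable borel"
    and int: "integrable leb01 (\<lambda>t. (L2_norm (weight \<mu>) (\<eta> t))\<^sup>2)"
    using \<eta> unfolding bochner_L2_def L2_space_weight by blast
  have single: "r i * (f (x i))\<^sup>2 \<le> (\<Sum>i<N. r i * (f (x i))\<^sup>2)" for f :: "'a \<Rightarrow> real"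
    by (rule member_le_sum) (use i r_pos in \<open>auto simp: less_imp_le\<close>)
  have le: "sqrt (r i) * \<bar>f (x i)\<bar> \<le> L2_norm (weight \<mu>) f" if "f \<in> borel_measurable borel" for f
  proof -
    have "sqrt (r i) * \<bar>f (x i)\<bar> = sqrt (r i * (f (x i))\<^sup>2)" by (simp add: real_sqrt_mult)
    also have "\<dots> \<le> L2_norm (weight \<mu>) f" unfolding L2_norm_weight[OF that] using single by simp
    finally show ?thesis .
  qed
  show m: "(\<lambda>t. \<eta> t (x i)) \<in> borel_measurable leb01"
  proof (rule AE_limit_measurable)
    show "(\<lambda>t. s k t (x i)) \<in> borel_measurable leb01" for k
      using simple_function_compose1[OF s(1)[of k], of "\<lambda>h. h (x i)"] by (rule borel_measurable_simple_function)
    have "AE t in leb01. t \<in> {0..1}" by (rule AE_I2) simp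
    with lim show "AE t in leb01. (\<lambda>k. s k t (x i)) \<longlonglongrightarrow> \<eta> t (x i)"
    proof eventually_elim
      fix t :: real assume l: "(\<lambda>k. L2_norm (weight \<mu>) (s k t - \<eta> t)) \<longlonglongrightarrow> 0" and t: "t \<in> {0..1}"
      have "(\<lambda>k. s k t (x i) - \<eta> t (x i)) \<longlonglongrightarrow> 0"
      proof (rule Lim_null_comparison)
        show "\<forall>\<^sub>F k in sequentially. norm (s k t (x i) - \<eta> t (x i)) \<le> L2_norm (weight \<mu>) (s k t - \<eta> t) / sqrt (r i)"
        proof (intro always_eventually allI)
          fix k
          have "s k t - \<eta> t \<in> borel_measurable borel"
            unfolding fun_diff_def using s(2)[OF t] \<eta>b[OF t] by measurable
          from le[OF this] show "norm (s k t (x i) - \<eta> t (x i)) \<le> L2_norm (weight \<mu>) (s k t - \<eta> t) / sqrt (r i)"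
            using r_pos[OF i] by (simp add: field_simps)
        qed
        show "(\<lambda>k. L2_norm (weight \<mu>) (s k t - \<eta> t) / sqrt (r i)) \<longlonglongrightarrow> 0"
          using tendsto_divide[OF l tendsto_const[of "sqrt (r i)"]] r_pos[OF i] by simp
      qed
      then show "(\<lambda>k. s k t (x i)) \<longlonglongrightarrow> \<eta> t (x i)" by (rule LIM_zero_cancel)
    qed
  qed
  show "integrable leb01 (\<lambda>t. (\<eta> t (x i))\<^sup>2)"
  proof (rule Bochner_Integration.integrable_bound)
    show "integrable leb01 (\<lambda>t. (L2_norm (weight \<mu>) (\<eta> t))\<^sup>2 / r i)" using int by simp
    show "(\<lambda>t. (\<eta> t (x i))\<^sup>2) \<in> borel_measurable leb01" using m by measurable
    show "AE t in leb01. norm ((\<eta> t (x i))\<^sup>2) \<le> norm ((L2_norm (weight \<mu>) (\<eta> t))\<^sup>2 / r i)"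
    proof (rule AE_I2)
      fix t assume "t \<in> space leb01"
      then have "(L2_norm (weight \<mu>) (\<eta> t))\<^sup>2 = (\<Sum>i<N. r i * (\<eta> t (x i))\<^sup>2)"
        using \<eta>b[of t] r_pos by (simp add: L2_norm_weight weighted_square_sum_nonneg)
      then show "norm ((\<eta> t (x i))\<^sup>2) \<le> norm ((L2_norm (weight \<mu>) (\<eta> t))\<^sup>2 / r i)"
        using single[of "\<eta> t"] r_pos[OF i] by (simp add: field_simps)
    qed
  qed
qed

text \<open>Provides the optimal growth function, which is continuous in time. Its value 0 off the
  support makes every time slice Borel.\<close>

lemma continuous_bochner_L2_weight:
  assumes h: "\<And>p. p \<in> x ` {..<N} \<Longrightarrow> continuous_on {0..1} (\<lambda>t. h t p)"
  shows "(\<lambda>t p. if p \<in> x ` {..<N} then h t p else 0) \<in> bochner_L2 (L2_space (weight \<mu>)) (L2_norm (weight \<mu>))"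
    (is "?\<eta> \<in> _")
proof -
  have b: "(\<lambda>p. if p \<in> x ` {..<N} then f p else 0) \<in> borel_measurable borel" for f :: "'a \<Rightarrow> real"
    by (rule measurable_discrete_difference[where f = "\<lambda>_. 0" and X = "x ` {..<N}"]) (auto intro: countable_finite)
  \<comment> \<open>Time rounded down to a multiple of \<open>1 / Suc k\<close>: finitely many
    values, all in the unit interval, tending to \<open>t\<close>. Sampling the path there gives the
    simple approximations.\<close>
  define q :: "nat \<Rightarrow> real \<Rightarrow> real" where "q k t = real_of_int \<lfloor>real (Suc k) * t\<rfloor> / real (Suc k)" for k t
  have q01: "q k t \<in> {0..1}" if "t \<in> {0..1}" for k t
  proof -
    have "real (Suc k) * t \<le> real (Suc k)" by (rule mult_left_le) (use that in auto)
    with of_int_floor_le[of "real (Suc k) * t"]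
    have "real_of_int \<lfloor>real (Suc k) * t\<rfloor> \<le> real (Suc k)" by (rule order_trans)
    moreover have "0 \<le> real_of_int \<lfloor>real (Suc k) * t\<rfloor>" using that by simp
    ultimately show ?thesis by (simp add: q_def)
  qed
  have qlim: "(\<lambda>k. q k t) \<longlonglongrightarrow> t" for t
  proof (rule LIM_zero_cancel, rule Lim_null_comparison)
    show "\<forall>\<^sub>F k in sequentially. norm (q k t - t) \<le> 1 / real (Suc k)"
    proof (intro always_eventually allI)
      fix k
      have "q k t - t = (real_of_int \<lfloor>real (Suc k) * t\<rfloor> - real (Suc k) * t) / real (Suc k)"
        by (simp add: q_def diff_divide_distrib)
      moreover have "\<bar>real_of_int \<lfloor>real (Suc k) * t\<rfloor> - real (Suc k) * t\<bar> \<le> 1" by linarith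
      ultimately show "norm (q k t - t) \<le> 1 / real (Suc k)"
        by (simp only: real_norm_def abs_divide abs_of_nat divide_right_mono of_nat_0_le_iff)
    qed
    show "(\<lambda>k. 1 / real (Suc k)) \<longlonglongrightarrow> 0" by (intro LIMSEQ_Suc lim_const_over_n)
  qed
  have simple: "simple_function leb01 (\<lambda>t. ?\<eta> (q k t))" for k
  proof (rule simple_function_compose1[where f = "q k" and g = ?\<eta>])
    show "simple_function leb01 (q k)"
      unfolding simple_function_def
    proof (intro conjI ballI)
      have "q k ` {0..1} \<subseteq> (\<lambda>m. real_of_int m / real (Suc k)) ` {0..int (Suc k)}"
      proof
        fix y assume "y \<in> q k ` {0..1}"
        then obtain t where t: "t \<in> {0..1}" "y = q k t" by auto
        have "real (Suc k) * t \<le> real (Suc k)" by (rule mult_left_le) (use t in auto)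
        then have "\<lfloor>real (Suc k) * t\<rfloor> \<le> int (Suc k)" by linarith
        then show "y \<in> (\<lambda>m. real_of_int m / real (Suc k)) ` {0..int (Suc k)}"
          using t by (auto simp: q_def)
      qed
      then show "finite (q k ` space leb01)" by (simp add: finite_subset)
      fix y
      have "q k \<in> borel_measurable borel" unfolding q_def by measurable
      then have "q k \<in> borel_measurable lebesgue" by (simp add: measurable_completion)
      then have "q k \<in> borel_measurable leb01" by (rule measurable_restrict_space1)
      then show "q k -` {y} \<inter> space leb01 \<in> sets leb01" by (rule measurable_sets) simp
    qed
  qed
  have lim: "(\<lambda>k. L2_norm (weight \<mu>) (?\<eta> (q k t) - ?\<eta> t)) \<longlonglongrightarrow> 0" if t: "t \<in> {0..1}" for t
  proof -
    have m: "?\<eta> (q k t) - ?\<eta> t \<in> borel_measurable borel" for k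
      unfolding fun_diff_def using b by measurable
    have "(\<lambda>k. h (q k t) (x i)) \<longlonglongrightarrow> h t (x i)" if "i < N" for i
      by (rule continuous_on_tendsto_compose[OF h qlim]) (use q01[OF t] t that in auto)
    then have "(\<lambda>k. sqrt (\<Sum>i<N. r i * (h (q k t) (x i) - h t (x i))\<^sup>2)) \<longlonglongrightarrow> sqrt (\<Sum>i<N. r i * (h t (x i) - h t (x i))\<^sup>2)"
      by (intro tendsto_intros) auto
    then show ?thesis unfolding L2_norm_weight[OF m] by simp
  qed
  have int: "integrable leb01 (\<lambda>t. (L2_norm (weight \<mu>) (?\<eta> t))\<^sup>2)"
  proof -
    have "continuous_on {0..1} (\<lambda>t. \<Sum>i<N. r i * (h t (x i))\<^sup>2)"
      using h by (intro continuous_intros) auto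
    then have "integrable leb01 (\<lambda>t. \<Sum>i<N. r i * (h t (x i))\<^sup>2)" by (rule continuous_imp_integrable_real)
    moreover have "(L2_norm (weight \<mu>) (?\<eta> t))\<^sup>2 = (\<Sum>i<N. r i * (h t (x i))\<^sup>2)" for t
      using b r_pos by (simp add: L2_norm_weight weighted_square_sum_nonneg)
    ultimately show ?thesis by simp
  qed
  show ?thesis
    unfolding bochner_L2_def L2_space_weight
    using b simple lim int
    by (intro CollectI conjI exI[of _ "\<lambda>k t. ?\<eta> (q k t)"] AE_I2) auto
qed

end

subsection \<open>Elimination of the growth function\<close>

context discrete_data
begin

text \<open>The Jacobian is a density before the image measure and is taken at the source; the
  factor \<beta> is a density after it and is taken at the image point.\<close>

lemma LINT_reweight_pushforward:
  fixes f :: "'a \<times> 'a oriented_subspace \<Rightarrow> real"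
  defines "\<Phi> \<equiv> \<lambda>\<phi> p. (\<phi> (fst p), oriented_image (frechet_derivative \<phi> (at (fst p))) (snd p))"
  assumes j: "(\<lambda>p. jac \<phi> (fst p) (snd p)) \<in> borel_measurable (varifold_space d)" "\<And>y S. 0 \<le> jac \<phi> y S"
    and \<Phi>: "\<Phi> \<phi> \<in> varifold_space d \<rightarrow>\<^sub>M varifold_space d"
    and \<beta>: "\<beta> \<in> borel_measurable borel" "\<And>y. 0 \<le> \<beta> y"
    and f: "f \<in> borel_measurable (varifold_space d)"
  shows "(LINT p|reweight \<beta> (pushforward \<phi> \<mu>). f p) =
    (\<Sum>i<N. r i * (jac \<phi> (x i) (U i) * (\<beta> (\<phi> (x i)) * f (\<Phi> \<phi> (x i, U i)))))"
proof -
  let ?D = "density \<mu> (\<lambda>p. ennreal (jac \<phi> (fst p) (snd p)))"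
  let ?P = "distr ?D \<mu> (\<Phi> \<phi>)"
  have P: "pushforward \<phi> \<mu> = ?P"
    by (simp add: pushforward_def \<Phi>_def case_prod_unfold)
  have sP: "borel_measurable ?P = borel_measurable (varifold_space d)"
    by (rule measurable_cong_sets) (simp_all add: sets_\<mu>)
  have sD: "borel_measurable ?D = borel_measurable (varifold_space d)"
    by (rule measurable_cong_sets) (simp_all add: sets_\<mu>)
  have \<Phi>D: "\<Phi> \<phi> \<in> ?D \<rightarrow>\<^sub>M \<mu>"
    using \<Phi> by (subst measurable_cong_sets[where M' = "varifold_space d" and N' = "varifold_space d"]) (simp_all add: sets_\<mu>)
  have \<beta>m: "(\<lambda>p. \<beta> (fst p)) \<in> borel_measurable (varifold_space d)"
    by (rule measurable_compose[OF fst_varifold_measurable \<beta>(1)])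
  have g: "(\<lambda>p. \<beta> (fst p) * f p) \<in> borel_measurable (varifold_space d)"
    using \<beta>m f by measurable
  have "(LINT p|reweight \<beta> (pushforward \<phi> \<mu>). f p) = (LINT p|density ?P (\<lambda>p. ennreal (\<beta> (fst p))). f p)"
    by (simp add: reweight_def P case_prod_unfold)
  also have "\<dots> = (LINT p|?P. \<beta> (fst p) *\<^sub>R f p)"
    by (rule integral_density) (use \<beta>m f \<beta>(2) in \<open>auto simp: sP\<close>)
  also have "\<dots> = (LINT p|?D. \<beta> (fst (\<Phi> \<phi> p)) * f (\<Phi> \<phi> p))"
    using g by (subst integral_distr[OF \<Phi>D]) (simp_all add: borel_measurable_\<mu>)
  also have "\<dots> = (LINT p|\<mu>. jac \<phi> (fst p) (snd p) *\<^sub>R (\<beta> (fst (\<Phi> \<phi> p)) * f (\<Phi> \<phi> p)))"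
    by (rule integral_density)
      (use j measurable_compose[OF \<Phi> g] in \<open>auto simp: borel_measurable_\<mu>\<close>)
  also have "\<dots> = (\<Sum>i<N. r i * (jac \<phi> (x i) (U i) * (\<beta> (\<phi> (x i)) * f (\<Phi> \<phi> (x i, U i)))))"
    using j(1) measurable_compose[OF \<Phi> g] by (subst LINT_\<mu>) (simp_all add: \<Phi>_def)
  finally show ?thesis .
qed

end

text \<open>As \<open>F\<close> is constant off a finite set, the composition has, up to finitely
  many points, one value on the range of \<phi> and one off it. Measurability thus reduces to that
  of the range.\<close>

lemma borel_measurable_inv_into_finite:
  fixes \<phi> :: "'a::euclidean_space \<Rightarrow> 'a" and F :: "'a \<Rightarrow> real"
  assumes \<phi>: "continuous_on UNIV \<phi>" "inj \<phi>" and P: "finite P" and F: "\<And>p. p \<notin> P \<Longrightarrow> F p = c"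
  shows "(\<lambda>y. F (inv_into UNIV \<phi> y)) \<in> borel_measurable borel"
proof -
  \<comment> \<open>The result of an unsatisfiable choice, to which \<open>inv_into\<close>
    evaluates at points without preimage.\<close>
  define e :: 'a where "e = (SOME z. False)"
  have range: "range \<phi> \<in> sets borel"
  proof -
    \<comment> \<open>A countable union of compact sets, by continuity.\<close>
    have "range \<phi> = (\<Union>n::nat. \<phi> ` cball 0 (real n))"
      using real_arch_simple by (fastforce simp: dist_norm)
    also have "\<dots> \<in> sets borel"
    proof (rule sets.countable_UN'')
      fix n :: nat
      have "compact (\<phi> ` cball 0 (real n))"
        by (intro compact_continuous_image continuous_on_subset[OF \<phi>(1)]) auto
      then show "\<phi> ` cball 0 (real n) \<in> sets borel" by (intro borel_closed compact_imp_closed)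
    qed auto
    finally show ?thesis .
  qed
  show ?thesis
  proof (rule measurable_discrete_difference[where X = "\<phi> ` P" and f = "\<lambda>y. if y \<in> range \<phi> then c else F e"])
    show "(\<lambda>y. if y \<in> range \<phi> then c else F e) \<in> borel_measurable borel"
      using range by (intro measurable_If_set) auto
    show "countable (\<phi> ` P)" using P by (simp add: countable_finite)
    fix y assume y: "y \<notin> \<phi> ` P"
    show "(if y \<in> range \<phi> then c else F e) = F (inv_into UNIV \<phi> y)"
    proof (cases "y \<in> range \<phi>")
      case True
      then have "\<phi> (inv_into UNIV \<phi> y) = y" by (rule f_inv_into_f)
      then have "inv_into UNIV \<phi> y \<notin> P" using y by (metis imageI)
      then show ?thesis using True F by simp
    next
      case False
      then have "(\<lambda>z. z \<in> UNIV \<and> \<phi> z = y) = (\<lambda>z. False)" by auto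
      then have "inv_into UNIV \<phi> y = e" by (simp add: inv_into_def e_def)
      then show ?thesis using False by simp
    qed
  qed auto
qed

text \<open>The space \<open>W\<close> enters through the continuity of its functions and a uniform
  bound linear in \<open>norm w\<close>.\<close>

locale matching = vector_fields eV C + discrete_data d N r x U
  for eV :: "'v::{real_inner,complete_space} \<Rightarrow> 'a::euclidean_space \<Rightarrow> 'a" and C
    and d N r and x :: "nat \<Rightarrow> 'a" and U +
  fixes eW :: "'w::real_normed_vector \<Rightarrow> 'a \<times> 'a oriented_subspace \<Rightarrow> real" and CW :: real
    and \<mu>tar :: "('a \<times> 'a oriented_subspace) measure" and \<gamma> \<Lambda> :: real
  assumes \<gamma>_pos: "0 < \<gamma>" and \<Lambda>_pos: "0 < \<Lambda>" and CW_nonneg: "0 \<le> CW"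
    and eW_continuous: "continuous_on (UNIV \<times> Gr d) (eW w)"
    and eW_bound: "p \<in> UNIV \<times> Gr d \<Longrightarrow> \<bar>eW w p\<bar> \<le> CW * norm w"
    and sets_\<mu>tar: "sets \<mu>tar = sets (varifold_space d)" and finite_\<mu>tar: "finite_measure \<mu>tar"
begin

definition J :: "(real \<Rightarrow> 'v) \<Rightarrow> real \<Rightarrow> nat \<Rightarrow> real" where
  "J v t i = jac_blinfun (U i) (dtraj v t (x i))"

text \<open>Several indices may carry the same point with different subspaces. This is the total
  weight with which \<open>(\<eta> t p)\<^sup>2\<close> occurs in the growth cost.\<close>

definition Jsum :: "(real \<Rightarrow> 'v) \<Rightarrow> real \<Rightarrow> 'a \<Rightarrow> real" where
  "Jsum v t p = (\<Sum>i | i < N \<and> x i = p. r i * J v t i)"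

text \<open>By Cauchy--Schwarz, growth with time integral \<open>a p\<close> at \<open>p\<close>
  costs at least \<open>(a p)\<^sup>2 / Jint v p\<close>.\<close>

definition Jint :: "(real \<Rightarrow> 'v) \<Rightarrow> 'a \<Rightarrow> real" where
  "Jint v p = (LINT t|leb01. 1 / Jsum v t p)"

definition endpoint :: "(real \<Rightarrow> 'v) \<Rightarrow> nat \<Rightarrow> 'a \<times> 'a oriented_subspace" where
  "endpoint v i = (traj v 1 (x i), oriented_image (blinfun_apply (dtraj v 1 (x i))) (U i))"

text \<open>The difference of the transported varifold and the target as a linear form at
  \<open>w\<close>, with \<open>a p\<close> in place of the time integral of \<eta> at
  \<open>p\<close>.\<close>

definition residual :: "(real \<Rightarrow> 'v) \<Rightarrow> ('a \<Rightarrow> real) \<Rightarrow> 'w \<Rightarrow> real" where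
  "residual v a w = (\<Sum>i<N. r i * J v 1 i * (1 + 1 / 2 * a (x i))\<^sup>2 * eW w (endpoint v i)) - (LINT p|\<mu>tar. eW w p)"

definition mismatch :: "(real \<Rightarrow> 'v) \<Rightarrow> ('a \<Rightarrow> real) \<Rightarrow> real" where
  "mismatch v a = (SUP w\<in>{w. norm w \<le> 1}. residual v a w)"

text \<open>The least relaxed energy over all growth functions with time integrals \<open>a\<close>,
  by \<open>reduced_le_relaxed_energy\<close> and
  \<open>relaxed_energy_attains_reduced\<close>.\<close>

definition reduced :: "(real \<Rightarrow> 'v) \<Rightarrow> ('a \<Rightarrow> real) \<Rightarrow> real" where
  "reduced v a = 1 / 2 * energy v + \<gamma> / 2 * (\<Sum>p\<in>x ` {..<N}. (a p)\<^sup>2 / Jint v p) + \<Lambda> / 2 * (mismatch v a)\<^sup>2"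

section \<open>Positivity and continuity of the Jacobians along the flow\<close>

lemma inj_dtraj:
  assumes "v \<in> bochner_L2 UNIV norm" "t \<in> {0..1}"
  shows "inj (blinfun_apply (dtraj v t p))"
  unfolding linear_injective_0[OF linear_blinfun]
proof (intro allI impI)
  fix w assume "blinfun_apply (dtraj v t p) w = 0"
  then show "w = 0" using traj_regularity(2)[OF assms(1) order_refl assms(2), of w p] by simp
qed

lemma inj_traj:
  assumes "v \<in> bochner_L2 UNIV norm" "t \<in> {0..1}"
  shows "inj (traj v t)"
proof (rule injI)
  fix y z assume "traj v t y = traj v t z"
  then show "y = z" using traj_regularity(3)[OF assms(1) order_refl assms(2), of y z] by simp
qed

lemma continuous_dtraj:
  assumes "v \<in> bochner_L2 UNIV norm" "t \<in> {0..1}"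
  shows "continuous_on UNIV (dtraj v t)"
proof (rule continuous_at_imp_continuous_on, intro ballI)
  fix p
  let ?c = "sqrt (C\<^sup>2 * energy v) * flow_const (C\<^sup>2 * energy v) ^ 3"
  have "((\<lambda>q. dtraj v t q - dtraj v t p) \<longlongrightarrow> 0) (at p)"
  proof (rule Lim_null_comparison)
    show "\<forall>\<^sub>F q in at p. norm (dtraj v t q - dtraj v t p) \<le> ?c * norm (q - p)"
      by (intro always_eventually allI traj_regularity(7)[OF assms(1) order_refl assms(2)])
    show "((\<lambda>q. ?c * norm (q - p)) \<longlongrightarrow> 0) (at p)"
      by (rule tendsto_eq_intros refl | simp)+
  qed
  then show "isCont (dtraj v t) p" unfolding isCont_def by (rule LIM_zero_cancel)
qed

lemma continuous_traj_space:
  assumes "v \<in> bochner_L2 UNIV norm" "t \<in> {0..1}"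
  shows "continuous_on UNIV (traj v t)"
  by (rule continuous_at_imp_continuous_on, intro ballI)
    (rule has_derivative_continuous[OF traj_regularity(6)[OF assms(1) order_refl assms(2)]])

lemma jac_traj:
  assumes "v \<in> bochner_L2 UNIV norm" "t \<in> {0..1}"
  shows "jac (traj v t) p S = jac_blinfun S (dtraj v t p)"
  by (rule jac_eq_jac_blinfun) (rule traj_regularity(5)[OF assms(1) order_refl assms(2)])

lemma jac_traj_measurable:
  assumes v: "v \<in> bochner_L2 UNIV norm" and t: "t \<in> {0..1}"
  shows "(\<lambda>p. jac (traj v t) (fst p) (snd p)) \<in> borel_measurable (varifold_space d)"
  unfolding jac_traj[OF assms]
  using continuous_jac_blinfun[OF continuous_dtraj[OF assms], of d]
  by (intro varifold_measurable) (simp add: case_prod_unfold)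

lemma J_pos: "v \<in> bochner_L2 UNIV norm \<Longrightarrow> t \<in> {0..1} \<Longrightarrow> 0 < J v t i"
  unfolding J_def by (intro jac_blinfun_pos inj_dtraj)

lemma Jsum_pos:
  assumes "v \<in> bochner_L2 UNIV norm" "t \<in> {0..1}" "p \<in> x ` {..<N}"
  shows "0 < Jsum v t p"
  unfolding Jsum_def
proof (rule sum_pos)
  fix i assume "i \<in> {i. i < N \<and> x i = p}"
  then show "0 < r i * J v t i" by (intro mult_pos_pos r_pos J_pos assms) simp
qed (use assms(3) in auto)

lemma continuous_J:
  assumes "v \<in> bochner_L2 UNIV norm"
  shows "continuous_on {0..1} (\<lambda>t. J v t i)"
  using continuous_traj(2)[OF assms] unfolding J_def continuous_on_def
  by (auto intro: tendsto_jac_blinfun)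

lemma continuous_Jsum: "v \<in> bochner_L2 UNIV norm \<Longrightarrow> continuous_on {0..1} (\<lambda>t. Jsum v t p)"
  unfolding Jsum_def by (intro continuous_intros continuous_J)

lemma continuous_inverse_Jsum:
  assumes "v \<in> bochner_L2 UNIV norm" "p \<in> x ` {..<N}"
  shows "continuous_on {0..1} (\<lambda>t. 1 / Jsum v t p)"
  using Jsum_pos[OF assms(1) _ assms(2)] by (intro continuous_intros continuous_Jsum assms) force

lemma Jint_pos:
  assumes "v \<in> bochner_L2 UNIV norm" "p \<in> x ` {..<N}"
  shows "0 < Jint v p"
proof -
  note c = continuous_inverse_Jsum[OF assms]
  have "0 \<le> Jint v p"
    unfolding Jint_def using Jsum_pos[OF assms(1) _ assms(2)]
    by (intro Bochner_Integration.integral_nonneg_AE AE_I2) (auto simp: less_imp_le)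
  moreover have "Jint v p \<noteq> 0"
  proof
    assume "Jint v p = 0"
    then have "integral {0..1} (\<lambda>t. 1 / Jsum v t p) = 0"
      unfolding Jint_def using lebesgue_integral_eq_integral[OF continuous_imp_integrable_real[OF c]] by simp
    then have "\<forall>t\<in>{0..1}. 1 / Jsum v t p = 0"
      using integral_eq_0_iff[OF c] Jsum_pos[OF assms(1) _ assms(2)] by (simp add: less_imp_le)
    then show False using Jsum_pos[OF assms(1) _ assms(2), of 0] by force
  qed
  ultimately show ?thesis by simp
qed

lemma eW_measurable: "eW w \<in> borel_measurable (varifold_space d)"
  by (rule varifold_measurable[OF eW_continuous])

lemma endpoint_Gr:
  assumes "v \<in> bochner_L2 UNIV norm" "i < N"
  shows "endpoint v i \<in> UNIV \<times> Gr d"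
  using assms by (simp add: endpoint_def Gr_oriented_image inj_dtraj U_Gr)

text \<open>At the image of a support point the inverse flow returns the point itself, so the growth
  factor is evaluated on the support.\<close>

lemma dual_dist_eq_mismatch:
  assumes v: "v \<in> bochner_L2 UNIV norm"
  shows "dual_dist eW (reweight (\<lambda>y. (weight_factor (weight \<mu>) \<eta> 1 (inv_into UNIV (traj v 1) y))\<^sup>2)
     (pushforward (traj v 1) \<mu>)) \<mu>tar = mismatch v (\<lambda>p. LINT s|leb01. \<eta> s p)"
proof -
  let ?\<phi> = "traj v 1"
  let ?\<beta> = "\<lambda>y. (weight_factor (weight \<mu>) \<eta> 1 (inv_into UNIV ?\<phi> y))\<^sup>2"
  have 1: "(1::real) \<in> {0..1}" by simp
  have fr: "frechet_derivative ?\<phi> (at y) = blinfun_apply (dtraj v 1 y)" for y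
    by (rule traj_regularity(5)[OF v order_refl 1])
  \<comment> \<open>The constant 1 is the default of \<open>weight_factor\<close> off the finite
    support.\<close>
  have \<beta>: "?\<beta> \<in> borel_measurable borel"
    by (rule borel_measurable_inv_into_finite[where P = "x ` {..<N}" and c = 1])
      (auto simp: weight_factor_def msupp_weight continuous_traj_space[OF v 1] inj_traj[OF v 1])
  have cont: "continuous_on (UNIV \<times> Gr d) (\<lambda>p. (?\<phi> (fst p), oriented_image (frechet_derivative ?\<phi> (at (fst p))) (snd p)))"
    using continuous_oriented_image[OF continuous_traj_space[OF v 1] continuous_dtraj[OF v 1] inj_dtraj[OF v 1], of d]
    by (simp add: case_prod_unfold fr)
  have \<Phi>: "(\<lambda>p. (?\<phi> (fst p), oriented_image (frechet_derivative ?\<phi> (at (fst p))) (snd p))) \<in> varifold_space d \<rightarrow>\<^sub>M varifold_space d"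
    (is "?\<Phi> \<in> _")
  proof -
    have "?\<Phi> \<in> varifold_space d \<rightarrow>\<^sub>M restrict_space borel (UNIV \<times> Gr d)"
      by (rule measurable_restrict_space2[OF _ varifold_measurable[OF cont]])
        (auto simp: space_varifold_space fr Gr_oriented_image inj_dtraj[OF v 1])
    then show ?thesis by (simp add: varifold_space_def)
  qed
  have "(LINT p|reweight ?\<beta> (pushforward ?\<phi> \<mu>). eW w p) =
     (\<Sum>i<N. r i * J v 1 i * (1 + 1 / 2 * (LINT s|leb01. \<eta> s (x i)))\<^sup>2 * eW w (endpoint v i))" for w
  proof -
    have "(LINT p|reweight ?\<beta> (pushforward ?\<phi> \<mu>). eW w p) =
      (\<Sum>i<N. r i * (jac ?\<phi> (x i) (U i) * (?\<beta> (?\<phi> (x i)) * eW w (?\<Phi> (x i, U i)))))"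
      by (rule LINT_reweight_pushforward[OF jac_traj_measurable[OF v 1] _ \<Phi> \<beta> _ eW_measurable])
        (simp_all add: jac_traj[OF v 1] less_imp_le[OF jac_blinfun_pos] inj_dtraj[OF v 1])
    also have "\<dots> = (\<Sum>i<N. r i * J v 1 i * (1 + 1 / 2 * (LINT s|leb01. \<eta> s (x i)))\<^sup>2 * eW w (endpoint v i))"
      by (intro sum.cong refl)
        (simp add: jac_traj[OF v 1] J_def inv_f_f[OF inj_traj[OF v 1]] weight_factor_def msupp_weight fr endpoint_def)
    finally show ?thesis .
  qed
  then show ?thesis by (simp add: dual_dist_def mismatch_def residual_def)
qed

lemma growth_cost_eq:
  assumes v: "v \<in> bochner_L2 UNIV norm" and \<eta>: "\<eta> \<in> bochner_L2 (L2_space (weight \<mu>)) (L2_norm (weight \<mu>))"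
  shows "(LINT t|leb01. LINT p|\<mu>. (\<eta> t (fst p))\<^sup>2 * jac (traj v t) (fst p) (snd p)) =
    (\<Sum>p\<in>x ` {..<N}. LINT t|leb01. (\<eta> t p)\<^sup>2 * Jsum v t p)"
    and "p \<in> x ` {..<N} \<Longrightarrow> integrable leb01 (\<lambda>t. (\<eta> t p)\<^sup>2 * Jsum v t p)"
proof -
  have \<eta>b: "\<eta> t \<in> borel_measurable borel" if "t \<in> {0..1}" for t
    using \<eta> that by (auto simp: bochner_L2_def L2_space_weight)
  show int: "integrable leb01 (\<lambda>t. (\<eta> t p)\<^sup>2 * Jsum v t p)" if p: "p \<in> x ` {..<N}" for p
  proof -
    obtain i where i: "i < N" "p = x i" using p by auto
    have "bounded ((\<lambda>t. Jsum v t p) ` {0..1})"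
      by (intro compact_imp_bounded compact_continuous_image continuous_Jsum v) simp
    then obtain b where b: "\<forall>y\<in>(\<lambda>t. Jsum v t p) ` {0..1}. norm y \<le> b" by (auto simp only: bounded_iff)
    show ?thesis
    proof (rule Bochner_Integration.integrable_bound)
      show "integrable leb01 (\<lambda>t. (\<eta> t p)\<^sup>2 * b)"
        using bochner_L2_weight_point(2)[OF \<eta> i(1)] i(2) by simp
      show "(\<lambda>t. (\<eta> t p)\<^sup>2 * Jsum v t p) \<in> borel_measurable leb01"
        using bochner_L2_weight_point(1)[OF \<eta> i(1)] continuous_measurable_lebesgue_on[OF continuous_Jsum[OF v, of p]]
        unfolding i(2) by measurable
      show "AE t in leb01. norm ((\<eta> t p)\<^sup>2 * Jsum v t p) \<le> norm ((\<eta> t p)\<^sup>2 * b)"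
      proof (rule AE_I2)
        fix t assume "t \<in> space leb01"
        then have "\<bar>Jsum v t p\<bar> \<le> b" using b by simp
        then show "norm ((\<eta> t p)\<^sup>2 * Jsum v t p) \<le> norm ((\<eta> t p)\<^sup>2 * b)"
          unfolding real_norm_def abs_mult by (intro mult_left_mono) auto
      qed
    qed
  qed
  have "(LINT t|leb01. LINT p|\<mu>. (\<eta> t (fst p))\<^sup>2 * jac (traj v t) (fst p) (snd p)) =
    (LINT t|leb01. (\<Sum>p\<in>x ` {..<N}. (\<eta> t p)\<^sup>2 * Jsum v t p))"
  proof (rule Bochner_Integration.integral_cong[OF refl])
    fix t assume "t \<in> space leb01"
    then have t: "t \<in> {0..1}" by simp
    have "(\<lambda>p. \<eta> t (fst p)) \<in> borel_measurable (varifold_space d)"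
      by (rule measurable_compose[OF fst_varifold_measurable \<eta>b[OF t]])
    then have m: "(\<lambda>p. (\<eta> t (fst p))\<^sup>2 * jac (traj v t) (fst p) (snd p)) \<in> borel_measurable (varifold_space d)"
      using jac_traj_measurable[OF v t] by measurable
    have "(LINT p|\<mu>. (\<eta> t (fst p))\<^sup>2 * jac (traj v t) (fst p) (snd p)) = (\<Sum>i<N. r i * ((\<eta> t (x i))\<^sup>2 * J v t i))"
      unfolding LINT_\<mu>[OF m] by (simp add: jac_traj[OF v t] J_def)
    \<comment> \<open>Indices are grouped by their point, at which \<eta> has a single
      value.\<close>
    also have "\<dots> = (\<Sum>p\<in>x ` {..<N}. \<Sum>i | i \<in> {..<N} \<and> x i = p. r i * ((\<eta> t (x i))\<^sup>2 * J v t i))"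
      by (rule sum.image_gen) simp
    also have "\<dots> = (\<Sum>p\<in>x ` {..<N}. (\<eta> t p)\<^sup>2 * Jsum v t p)"
      unfolding Jsum_def sum_distrib_left
      by (intro sum.cong refl) auto
    finally show "(LINT p|\<mu>. (\<eta> t (fst p))\<^sup>2 * jac (traj v t) (fst p) (snd p)) = \<dots>" .
  qed
  also have "\<dots> = (\<Sum>p\<in>x ` {..<N}. LINT t|leb01. (\<eta> t p)\<^sup>2 * Jsum v t p)"
    using int by (rule Bochner_Integration.integral_sum)
  finally show "(LINT t|leb01. LINT p|\<mu>. (\<eta> t (fst p))\<^sup>2 * jac (traj v t) (fst p) (snd p)) =
    (\<Sum>p\<in>x ` {..<N}. LINT t|leb01. (\<eta> t p)\<^sup>2 * Jsum v t p)" .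
qed

lemma relaxed_energy_eq:
  assumes v: "v \<in> bochner_L2 UNIV norm" and \<eta>: "\<eta> \<in> bochner_L2 (L2_space (weight \<mu>)) (L2_norm (weight \<mu>))"
  shows "relaxed_energy eV eW \<gamma> \<Lambda> \<mu> \<mu>tar v \<eta> = 1 / 2 * energy v +
     \<gamma> / 2 * (\<Sum>p\<in>x ` {..<N}. LINT t|leb01. (\<eta> t p)\<^sup>2 * Jsum v t p) +
     \<Lambda> / 2 * (mismatch v (\<lambda>p. LINT s|leb01. \<eta> s p))\<^sup>2"
  unfolding relaxed_energy_def Let_def growth_cost_eq(1)[OF assms] dual_dist_eq_mismatch[OF v] energy_def ..

text \<open>Cauchy--Schwarz at each support point, with \<eta> split into
  \<open>\<eta> t p * sqrt (Jsum v t p)\<close> and \<open>1 / sqrt (Jsum v t p)\<close>.\<close>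

lemma reduced_le_relaxed_energy:
  assumes v: "v \<in> bochner_L2 UNIV norm" and \<eta>: "\<eta> \<in> bochner_L2 (L2_space (weight \<mu>)) (L2_norm (weight \<mu>))"
  shows "reduced v (\<lambda>p. LINT s|leb01. \<eta> s p) \<le> relaxed_energy eV eW \<gamma> \<Lambda> \<mu> \<mu>tar v \<eta>"
proof -
  have "(LINT s|leb01. \<eta> s p)\<^sup>2 / Jint v p \<le> (LINT t|leb01. (\<eta> t p)\<^sup>2 * Jsum v t p)" if p: "p \<in> x ` {..<N}" for p
  proof -
    obtain i where i: "i < N" "p = x i" using p by auto
    note pos = Jsum_pos[OF v _ p]
    let ?f = "\<lambda>t. \<eta> t p * sqrt (Jsum v t p)" and ?g = "\<lambda>t. 1 / sqrt (Jsum v t p)"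
    have jm [measurable]: "(\<lambda>t. Jsum v t p) \<in> borel_measurable leb01"
      by (rule continuous_measurable_lebesgue_on[OF continuous_Jsum[OF v]])
    have [measurable]: "(\<lambda>t. \<eta> t p) \<in> borel_measurable leb01"
      using bochner_L2_weight_point(1)[OF \<eta> i(1)] i(2) by simp
    have fm: "?f \<in> borel_measurable leb01" and gm: "?g \<in> borel_measurable leb01" by measurable
    have f2: "(?f t)\<^sup>2 = (\<eta> t p)\<^sup>2 * Jsum v t p" and g2: "(?g t)\<^sup>2 = 1 / Jsum v t p" and fg: "?f t * ?g t = \<eta> t p"
      if "t \<in> {0..1}" for t
      using pos[OF that] by (simp_all add: power_mult_distrib power_divide)
    have "integrable leb01 (\<lambda>t. (?f t)\<^sup>2) \<longleftrightarrow> integrable leb01 (\<lambda>t. (\<eta> t p)\<^sup>2 * Jsum v t p)"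
      by (rule Bochner_Integration.integrable_cong[OF refl]) (simp only: f2 space_lebesgue_on)
    with growth_cost_eq(2)[OF v \<eta> p] have if2: "integrable leb01 (\<lambda>t. (?f t)\<^sup>2)" by blast
    have "integrable leb01 (\<lambda>t. (?g t)\<^sup>2) \<longleftrightarrow> integrable leb01 (\<lambda>t. 1 / Jsum v t p)"
      by (rule Bochner_Integration.integrable_cong[OF refl]) (simp only: g2 space_lebesgue_on)
    with continuous_imp_integrable_real[OF continuous_inverse_Jsum[OF v p]]
    have ig2: "integrable leb01 (\<lambda>t. (?g t)\<^sup>2)" by blast
    have "(LINT t|leb01. ?f t * ?g t)\<^sup>2 \<le> (LINT t|leb01. (?f t)\<^sup>2) * (LINT t|leb01. (?g t)\<^sup>2)"
      by (rule cauchy_schwarz_integral[OF fm if2 gm ig2])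
    also have "(LINT t|leb01. ?f t * ?g t) = (LINT t|leb01. \<eta> t p)"
      by (rule Bochner_Integration.integral_cong[OF refl]) (simp only: fg space_lebesgue_on)
    also have "(LINT t|leb01. (?f t)\<^sup>2) = (LINT t|leb01. (\<eta> t p)\<^sup>2 * Jsum v t p)"
      by (rule Bochner_Integration.integral_cong[OF refl]) (simp only: f2 space_lebesgue_on)
    also have "(LINT t|leb01. (?g t)\<^sup>2) = Jint v p"
      unfolding Jint_def by (rule Bochner_Integration.integral_cong[OF refl]) (simp only: g2 space_lebesgue_on)
    finally show ?thesis using Jint_pos[OF v p] by (simp add: field_simps)
  qed
  then have "(\<Sum>p\<in>x ` {..<N}. (LINT s|leb01. \<eta> s p)\<^sup>2 / Jint v p) \<le> (\<Sum>p\<in>x ` {..<N}. LINT t|leb01. (\<eta> t p)\<^sup>2 * Jsum v t p)"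
    by (rule sum_mono)
  then show ?thesis
    unfolding relaxed_energy_eq[OF assms] reduced_def using \<gamma>_pos by simp
qed

lemma mismatch_cong: "(\<And>i. i < N \<Longrightarrow> a (x i) = b (x i)) \<Longrightarrow> mismatch v a = mismatch v b"
  by (simp add: mismatch_def residual_def)

lemma relaxed_energy_attains_reduced:
  assumes v: "v \<in> bochner_L2 UNIV norm"
  shows "\<exists>\<eta>\<in>bochner_L2 (L2_space (weight \<mu>)) (L2_norm (weight \<mu>)).
    relaxed_energy eV eW \<gamma> \<Lambda> \<mu> \<mu>tar v \<eta> = reduced v a"
proof
  \<comment> \<open>The equality case of Cauchy--Schwarz; division by \<open>Jint v p\<close>
    normalizes the time integral to \<open>a p\<close>.\<close>
  define h where "h t p = a p / Jint v p * (1 / Jsum v t p)" for t p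
  define \<eta> where "\<eta> = (\<lambda>t p. if p \<in> x ` {..<N} then h t p else 0)"
  have "continuous_on {0..1} (\<lambda>t. h t p)" if "p \<in> x ` {..<N}" for p
    unfolding h_def by (intro continuous_on_mult continuous_on_const continuous_inverse_Jsum v that)
  then show \<eta>: "\<eta> \<in> bochner_L2 (L2_space (weight \<mu>)) (L2_norm (weight \<mu>))"
    unfolding \<eta>_def by (rule continuous_bochner_L2_weight)
  have i: "integrable leb01 (\<lambda>t. 1 / Jsum v t p)" if "p \<in> x ` {..<N}" for p
    by (rule continuous_imp_integrable_real[OF continuous_inverse_Jsum[OF v that]])
  have a: "(LINT s|leb01. \<eta> s p) = a p" if p: "p \<in> x ` {..<N}" for p
  proof -
    have "(LINT s|leb01. \<eta> s p) = (LINT s|leb01. a p / Jint v p * (1 / Jsum v s p))"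
      by (simp only: \<eta>_def h_def if_P[OF p])
    also have "\<dots> = a p / Jint v p * Jint v p"
      by (simp only: Bochner_Integration.integral_mult_right_zero Jint_def[symmetric])
    finally show ?thesis using Jint_pos[OF v p] by simp
  qed
  have c: "(LINT t|leb01. (\<eta> t p)\<^sup>2 * Jsum v t p) = (a p)\<^sup>2 / Jint v p" if p: "p \<in> x ` {..<N}" for p
  proof -
    have "(LINT t|leb01. (\<eta> t p)\<^sup>2 * Jsum v t p) = (LINT t|leb01. (a p / Jint v p)\<^sup>2 * (1 / Jsum v t p))"
    proof (rule Bochner_Integration.integral_cong[OF refl])
      fix t assume "t \<in> space leb01"
      then have "0 < Jsum v t p" using Jsum_pos[OF v _ p] by simp
      then show "(\<eta> t p)\<^sup>2 * Jsum v t p = (a p / Jint v p)\<^sup>2 * (1 / Jsum v t p)"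
        using p by (simp add: \<eta>_def h_def power2_eq_square)
    qed
    also have "\<dots> = (a p / Jint v p)\<^sup>2 * Jint v p"
      using i[OF p] by (simp only: Bochner_Integration.integral_mult_right_zero Jint_def)
    also have "\<dots> = (a p)\<^sup>2 / Jint v p"
      using Jint_pos[OF v p] by (simp add: power2_eq_square)
    finally show ?thesis .
  qed
  have "mismatch v (\<lambda>p. LINT s|leb01. \<eta> s p) = mismatch v a"
    by (rule mismatch_cong) (use a in auto)
  then show "relaxed_energy eV eW \<gamma> \<Lambda> \<mu> \<mu>tar v \<eta> = reduced v a"
    unfolding relaxed_energy_eq[OF v \<eta>] reduced_def using c by simp
qed

end

subsection \<open>Existence of minimizers\<close>

text \<open>Injectivity is an open condition, but the two-sided bound is a closed one that implies
  it. On the resulting compact set the continuous positive Jacobian attains its minimum.\<close>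

lemma jac_blinfun_lower_bound:
  fixes S :: "'a::euclidean_space oriented_subspace"
  assumes L: "0 < L"
  shows "\<exists>j>0. \<forall>A. norm A \<le> L \<longrightarrow> (\<forall>w. norm w \<le> norm (blinfun_apply A w) * L) \<longrightarrow> j \<le> jac_blinfun S A"
proof -
  let ?K = "{A :: 'a \<Rightarrow>\<^sub>L 'a. norm A \<le> L} \<inter> (\<Inter>w. {A. norm w \<le> norm (blinfun_apply A w) * L})"
  have "bounded ?K" by (auto simp: bounded_iff)
  moreover have "closed ?K"
    by (intro closed_Int closed_INT ballI closed_Collect_le continuous_intros)
  ultimately have K: "compact ?K" by (simp add: compact_eq_bounded_closed)
  have inj: "inj (blinfun_apply A)" if "A \<in> ?K" for A
    unfolding linear_injective_0[OF linear_blinfun]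
  proof (intro allI impI)
    fix w assume "blinfun_apply A w = 0"
    moreover have "norm w \<le> norm (blinfun_apply A w) * L" using that by blast
    ultimately show "w = 0" by simp
  qed
  show ?thesis
  proof (cases "?K = {}")
    case True
    then show ?thesis by (intro exI[of _ 1]) auto
  next
    case False
    have "continuous_on ?K (jac_blinfun S)"
      unfolding continuous_on_def by (auto intro: tendsto_jac_blinfun tendsto_ident_at)
    from continuous_attains_inf[OF K False this]
    obtain A where A: "A \<in> ?K" "\<And>B. B \<in> ?K \<Longrightarrow> jac_blinfun S A \<le> jac_blinfun S B" by blast
    then show ?thesis
      using jac_blinfun_pos[OF inj[OF A(1)], of S] by (intro exI[of _ "jac_blinfun S A"]) auto
  qed
qed

context matching
begin

lemma Jsum_lower_bound:
  assumes "p \<in> x ` {..<N}"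
  shows "\<exists>j>0. \<forall>v t. v \<in> bochner_L2 UNIV norm \<longrightarrow> energy v \<le> M \<longrightarrow> t \<in> {0..1} \<longrightarrow> j \<le> Jsum v t p"
proof -
  obtain i where i: "i < N" "x i = p" using assms by auto
  obtain j where j: "0 < j" "\<And>A. norm A \<le> flow_const (C\<^sup>2 * M) \<Longrightarrow>
      (\<And>w. norm w \<le> norm (blinfun_apply A w) * flow_const (C\<^sup>2 * M)) \<Longrightarrow> j \<le> jac_blinfun (U i) A"
    using jac_blinfun_lower_bound[of "flow_const (C\<^sup>2 * M)" "U i"] by auto
  have "r i * j \<le> Jsum v t p" if v: "v \<in> bochner_L2 UNIV norm" "energy v \<le> M" and t: "t \<in> {0..1}" for v t
  proof -
    have "j \<le> J v t i"
      unfolding J_def using traj_regularity(1,2)[OF v t] by (intro j(2)) auto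
    then have "r i * j \<le> r i * J v t i" using r_pos[OF i(1)] by simp
    also have "\<dots> \<le> Jsum v t p"
      unfolding Jsum_def
      using i r_pos J_pos[OF v(1) t] by (intro member_le_sum[where f = "\<lambda>i. r i * J v t i"]) (auto simp: less_imp_le)
    finally show ?thesis .
  qed
  then show ?thesis using j(1) r_pos[OF i(1)] by (intro exI[of _ "r i * j"]) auto
qed

text \<open>The reduced energy controls only the quotient of \<open>(a p)\<^sup>2\<close> by
  \<open>Jint v p\<close>; this bound makes it control \<open>a p\<close> itself.\<close>

lemma Jint_upper_bound:
  assumes p: "p \<in> x ` {..<N}"
  shows "\<exists>j>0. \<forall>v. v \<in> bochner_L2 UNIV norm \<longrightarrow> energy v \<le> M \<longrightarrow> Jint v p \<le> 1 / j"
proof -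
  obtain j where j: "0 < j" "\<And>v t. v \<in> bochner_L2 UNIV norm \<Longrightarrow> energy v \<le> M \<Longrightarrow> t \<in> {0..1} \<Longrightarrow> j \<le> Jsum v t p"
    using Jsum_lower_bound[OF p, of M] by blast
  have "Jint v p \<le> 1 / j" if v: "v \<in> bochner_L2 UNIV norm" "energy v \<le> M" for v
  proof -
    have "Jint v p \<le> (LINT t|leb01. 1 / j)"
      unfolding Jint_def
    proof (rule Bochner_Integration.integral_mono)
      show "integrable leb01 (\<lambda>t. 1 / Jsum v t p)"
        by (rule continuous_imp_integrable_real[OF continuous_inverse_Jsum[OF v(1) p]])
      fix t assume "t \<in> space leb01"
      then show "1 / Jsum v t p \<le> 1 / j" using j v by (intro frac_le) auto
    qed simp
    then show ?thesis by (simp add: measure_leb01)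
  qed
  then show ?thesis using j(1) by blast
qed

section \<open>Convergence and semicontinuity of the terms of the reduced functional\<close>

lemma J_tendsto:
  assumes "(\<lambda>n. dtraj (z n) t (x i)) \<longlonglongrightarrow> dtraj v t (x i)"
  shows "(\<lambda>n. J (z n) t i) \<longlonglongrightarrow> J v t i"
  unfolding J_def by (rule tendsto_jac_blinfun[OF assms])

text \<open>Dominated convergence, with the constant majorant from
  \<open>Jsum_lower_bound\<close>.\<close>

lemma Jint_tendsto:
  assumes z: "\<And>n. z n \<in> bochner_L2 UNIV norm" "\<And>n. energy (z n) \<le> M" and v: "v \<in> bochner_L2 UNIV norm"
    and lim: "\<And>q t. q \<in> x ` {..<N} \<Longrightarrow> t \<in> {0..1} \<Longrightarrow> (\<lambda>n. dtraj (z n) t q) \<longlonglongrightarrow> dtraj v t q"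
    and p: "p \<in> x ` {..<N}"
  shows "(\<lambda>n. Jint (z n) p) \<longlonglongrightarrow> Jint v p"
proof -
  obtain j where j: "0 < j" "\<And>n t. t \<in> {0..1} \<Longrightarrow> j \<le> Jsum (z n) t p"
    using Jsum_lower_bound[OF p, of M] z by blast
  show ?thesis
    unfolding Jint_def
  proof (rule integral_dominated_convergence[where w = "\<lambda>_. 1 / j"])
    show "(\<lambda>t. 1 / Jsum v t p) \<in> borel_measurable leb01"
      by (rule continuous_measurable_lebesgue_on[OF continuous_inverse_Jsum[OF v p]])
    show "(\<lambda>t. 1 / Jsum (z n) t p) \<in> borel_measurable leb01" for n
      by (rule continuous_measurable_lebesgue_on[OF continuous_inverse_Jsum[OF z(1) p]])
    show "AE t in leb01. (\<lambda>n. 1 / Jsum (z n) t p) \<longlonglongrightarrow> 1 / Jsum v t p"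
    proof (rule AE_I2)
      fix t assume "t \<in> space leb01"
      then have t: "t \<in> {0..1}" by simp
      have "(\<lambda>n. Jsum (z n) t p) \<longlonglongrightarrow> Jsum v t p"
        unfolding Jsum_def using p by (intro tendsto_sum tendsto_mult tendsto_const J_tendsto lim[OF _ t]) auto
      then show "(\<lambda>n. 1 / Jsum (z n) t p) \<longlonglongrightarrow> 1 / Jsum v t p"
        using Jsum_pos[OF v t p] by (intro tendsto_divide tendsto_const) auto
    qed
    show "AE t in leb01. norm (1 / Jsum (z n) t p) \<le> 1 / j" for n
    proof (rule AE_I2)
      fix t assume "t \<in> space leb01"
      then have "j \<le> Jsum (z n) t p" using j(2) by simp
      then show "norm (1 / Jsum (z n) t p) \<le> 1 / j"
        using j(1) by (simp add: frac_le)
    qed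
  qed simp
qed

text \<open>The bound may depend on \<open>v\<close> and \<open>a\<close> but not on
  \<open>w\<close>, so the supremum in \<open>mismatch\<close> is that of a bounded set.\<close>

lemma residual_bound:
  assumes "v \<in> bochner_L2 UNIV norm" "norm w \<le> 1"
  shows "residual v a w \<le> (\<Sum>i<N. \<bar>r i * J v 1 i * (1 + 1 / 2 * a (x i))\<^sup>2\<bar> * CW) + CW * measure \<mu>tar (space \<mu>tar)"
proof -
  have le: "\<bar>eW w p\<bar> \<le> CW" if "p \<in> UNIV \<times> Gr d" for p
    using eW_bound[OF that, of w] mult_left_mono[OF assms(2) CW_nonneg] by simp
  have sp: "space \<mu>tar = UNIV \<times> Gr d"
    using sets_eq_imp_space_eq[OF sets_\<mu>tar] by (simp add: space_varifold_space)
  have m: "eW w \<in> borel_measurable \<mu>tar"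
    using eW_measurable by (simp add: measurable_cong_sets[OF sets_\<mu>tar refl])
  have ci: "integrable \<mu>tar (\<lambda>_. CW)" by (rule finite_measure.integrable_const[OF finite_\<mu>tar])
  have i: "integrable \<mu>tar (eW w)"
    by (rule Bochner_Integration.integrable_bound[OF ci m]) (use le CW_nonneg in \<open>auto simp: sp\<close>)
  have "- (LINT p|\<mu>tar. eW w p) = (LINT p|\<mu>tar. - eW w p)" by simp
  also have "\<dots> \<le> (LINT p|\<mu>tar. CW)"
  proof (rule Bochner_Integration.integral_mono)
    fix p assume "p \<in> space \<mu>tar"
    then show "- eW w p \<le> CW" using le[of p] by (simp add: sp abs_le_iff)
  qed (use i ci in auto)
  also have "\<dots> = CW * measure \<mu>tar (space \<mu>tar)" by simp
  finally have 1: "- (LINT p|\<mu>tar. eW w p) \<le> CW * measure \<mu>tar (space \<mu>tar)" .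
  have "(\<Sum>i<N. r i * J v 1 i * (1 + 1 / 2 * a (x i))\<^sup>2 * eW w (endpoint v i))
      \<le> (\<Sum>i<N. \<bar>r i * J v 1 i * (1 + 1 / 2 * a (x i))\<^sup>2\<bar> * CW)"
  proof (rule sum_mono)
    fix i assume "i \<in> {..<N}"
    then have "\<bar>eW w (endpoint v i)\<bar> \<le> CW" using endpoint_Gr[OF assms(1)] by (intro le) simp
    then have "\<bar>r i * J v 1 i * (1 + 1 / 2 * a (x i))\<^sup>2\<bar> * \<bar>eW w (endpoint v i)\<bar> \<le> \<bar>r i * J v 1 i * (1 + 1 / 2 * a (x i))\<^sup>2\<bar> * CW"
      by (rule mult_left_mono) simp
    then show "r i * J v 1 i * (1 + 1 / 2 * a (x i))\<^sup>2 * eW w (endpoint v i) \<le> \<bar>r i * J v 1 i * (1 + 1 / 2 * a (x i))\<^sup>2\<bar> * CW"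
      using abs_ge_self[of "r i * J v 1 i * (1 + 1 / 2 * a (x i))\<^sup>2 * eW w (endpoint v i)"]
      unfolding abs_mult[of "r i * J v 1 i * (1 + 1 / 2 * a (x i))\<^sup>2" "eW w (endpoint v i)"] by (rule order_trans[rotated])
  qed
  then show ?thesis using 1 unfolding residual_def by linarith
qed

lemma residual_le_mismatch:
  assumes "v \<in> bochner_L2 UNIV norm" "norm w \<le> 1"
  shows "residual v a w \<le> mismatch v a"
  unfolding mismatch_def
  by (rule cSUP_upper) (use assms residual_bound[OF assms(1)] in \<open>auto intro!: bdd_aboveI2\<close>)

text \<open>The vector 0 lies in the unit ball and has residual 0.\<close>

lemma mismatch_nonneg:
  assumes v: "v \<in> bochner_L2 UNIV norm"
  shows "0 \<le> mismatch v a"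
proof -
  have 0: "eW 0 p = 0" if "p \<in> UNIV \<times> Gr d" for p using eW_bound[OF that, of 0] by simp
  have sp: "space \<mu>tar = UNIV \<times> Gr d"
    using sets_eq_imp_space_eq[OF sets_\<mu>tar] by (simp add: space_varifold_space)
  have "(LINT p|\<mu>tar. eW 0 p) = (LINT p|\<mu>tar. 0)"
    by (rule Bochner_Integration.integral_cong[OF refl]) (simp add: 0 sp)
  moreover have "eW 0 (endpoint v i) = 0" if "i < N" for i by (rule 0[OF endpoint_Gr[OF v that]])
  ultimately have "residual v a 0 = 0" by (simp add: residual_def)
  then show ?thesis using residual_le_mismatch[OF v, of 0 a] by simp
qed

lemma reduced_ge:
  assumes v: "v \<in> bochner_L2 UNIV norm"
  shows "energy v \<le> 2 * reduced v a"
    and "p \<in> x ` {..<N} \<Longrightarrow> (a p)\<^sup>2 / Jint v p \<le> 2 / \<gamma> * reduced v a"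
    and "0 \<le> reduced v a"
proof -
  have nn: "0 \<le> (a p)\<^sup>2 / Jint v p" if "p \<in> x ` {..<N}" for p
    using Jint_pos[OF v that] by simp
  have s: "0 \<le> (\<Sum>p\<in>x ` {..<N}. (a p)\<^sup>2 / Jint v p)" by (rule sum_nonneg[OF nn])
  have m: "0 \<le> \<Lambda> / 2 * (mismatch v a)\<^sup>2" using \<Lambda>_pos by simp
  have g: "0 \<le> \<gamma> / 2 * (\<Sum>p\<in>x ` {..<N}. (a p)\<^sup>2 / Jint v p)" using s \<gamma>_pos by simp
  have "1 / 2 * energy v \<le> reduced v a" unfolding reduced_def using m g by linarith
  from mult_left_mono[OF this, of 2] show "energy v \<le> 2 * reduced v a" by simp
  show "0 \<le> reduced v a" unfolding reduced_def using m g energy_nonneg[of v] by linarith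
  assume p: "p \<in> x ` {..<N}"
  have "(a p)\<^sup>2 / Jint v p \<le> (\<Sum>p\<in>x ` {..<N}. (a p)\<^sup>2 / Jint v p)"
    by (rule member_le_sum[OF p]) (use nn in auto)
  then have "\<gamma> / 2 * ((a p)\<^sup>2 / Jint v p) \<le> \<gamma> / 2 * (\<Sum>p\<in>x ` {..<N}. (a p)\<^sup>2 / Jint v p)"
    using \<gamma>_pos by (intro mult_left_mono) auto
  also have "\<dots> \<le> reduced v a" unfolding reduced_def using m energy_nonneg[of v] by linarith
  finally show "(a p)\<^sup>2 / Jint v p \<le> 2 / \<gamma> * reduced v a" using \<gamma>_pos by (simp add: field_simps)
qed

lemma residual_tendsto:
  assumes z: "\<And>n. z n \<in> bochner_L2 UNIV norm" and v: "v \<in> bochner_L2 UNIV norm"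
    and lim: "\<And>q. q \<in> x ` {..<N} \<Longrightarrow> (\<lambda>n. traj (z n) 1 q) \<longlonglongrightarrow> traj v 1 q"
      "\<And>q. q \<in> x ` {..<N} \<Longrightarrow> (\<lambda>n. dtraj (z n) 1 q) \<longlonglongrightarrow> dtraj v 1 q"
    and a: "\<And>q. q \<in> x ` {..<N} \<Longrightarrow> (\<lambda>n. b n q) \<longlonglongrightarrow> a q"
  shows "(\<lambda>n. residual (z n) (b n) w) \<longlonglongrightarrow> residual v a w"
  unfolding residual_def
proof (intro tendsto_diff tendsto_const tendsto_sum tendsto_mult tendsto_power tendsto_add)
  fix i assume "i \<in> {..<N}"
  then have i: "i < N" "x i \<in> x ` {..<N}" by auto
  show "(\<lambda>n. J (z n) 1 i) \<longlonglongrightarrow> J v 1 i" by (rule J_tendsto[OF lim(2)[OF i(2)]])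
  show "(\<lambda>n. b n (x i)) \<longlonglongrightarrow> a (x i)" by (rule a[OF i(2)])
  have "(\<lambda>n. endpoint (z n) i) \<longlonglongrightarrow> endpoint v i"
    unfolding endpoint_def
    by (intro tendsto_Pair tendsto_oriented_image lim[OF i(2)] inj_dtraj[OF v]) simp
  then show "(\<lambda>n. eW w (endpoint (z n) i)) \<longlonglongrightarrow> eW w (endpoint v i)"
    by (rule continuous_on_tendsto_compose[OF eW_continuous]) (use endpoint_Gr z v i in auto)
qed

text \<open>A supremum of continuous functionals is lower semicontinuous: one \<open>w\<close> that
  nearly attains it serves for all late \<open>n\<close>. The norm convergence of the varifolds is
  thereby avoided.\<close>

lemma mismatch_lsc:
  assumes z: "\<And>n. z n \<in> bochner_L2 UNIV norm" and v: "v \<in> bochner_L2 UNIV norm"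
    and lim: "\<And>w. (\<lambda>n. residual (z n) (b n) w) \<longlonglongrightarrow> residual v a w" and \<delta>: "0 < \<delta>"
  shows "\<forall>\<^sub>F n in sequentially. (mismatch v a)\<^sup>2 - \<delta> \<le> (mismatch (z n) (b n))\<^sup>2"
proof (cases "mismatch v a = 0")
  case True
  then show ?thesis using \<delta> by (intro always_eventually allI) (auto intro: order_trans[of _ 0])
next
  case False
  let ?m = "mismatch v a"
  have m: "0 < ?m" using mismatch_nonneg[OF v, of a] False by simp
  \<comment> \<open>The first entry of the minimum keeps \<open>c\<close> positive, so squaring
    preserves order; the second makes the loss in the square at most \<delta>.\<close>
  define c where "c = ?m - min (?m / 2) (\<delta> / (2 * ?m))"
  have c: "0 < c" "c < ?m" using m \<delta> by (auto simp: c_def min_def)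
  have "?m\<^sup>2 - \<delta> \<le> c\<^sup>2"
  proof -
    have "2 * ?m * min (?m / 2) (\<delta> / (2 * ?m)) \<le> 2 * ?m * (\<delta> / (2 * ?m))"
      using m by (intro mult_left_mono) auto
    also have "\<dots> = \<delta>" using m by simp
    finally show ?thesis
      unfolding c_def power2_diff using zero_le_power2[of "min (?m / 2) (\<delta> / (2 * ?m))"] by linarith
  qed
  have "\<exists>y\<in>residual v a ` {w. norm w \<le> 1}. c < y"
    using c(2) unfolding mismatch_def by (intro less_cSupD) (auto intro!: exI[of _ 0])
  then obtain w where w: "norm w \<le> 1" "c < residual v a w" by auto
  have "\<forall>\<^sub>F n in sequentially. c < residual (z n) (b n) w" by (rule order_tendstoD(1)[OF lim w(2)])
  then show ?thesis
  proof eventually_elim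
    fix n assume "c < residual (z n) (b n) w"
    then have "c \<le> mismatch (z n) (b n)" using residual_le_mismatch[OF z w(1), of n "b n"] by simp
    then have "c\<^sup>2 \<le> (mismatch (z n) (b n))\<^sup>2" using c(1) by (intro power_mono) auto
    then show "?m\<^sup>2 - \<delta> \<le> (mismatch (z n) (b n))\<^sup>2" using \<open>?m\<^sup>2 - \<delta> \<le> c\<^sup>2\<close> by simp
  qed
qed

lemma reduced_minimizer:
  "\<exists>v\<in>bochner_L2 UNIV norm. \<exists>a. \<forall>v'\<in>bochner_L2 UNIV norm. \<forall>a'. reduced v a \<le> reduced v' a'"
proof -
  let ?L2 = "bochner_L2 UNIV norm :: (real \<Rightarrow> 'v) set"
  let ?S = "{reduced v a |v a. v \<in> ?L2}"
  define m where "m = Inf ?S"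
  have bdd: "bdd_below ?S" by (rule bdd_belowI[of _ 0]) (auto simp: reduced_ge(3))
  have m_le: "m \<le> reduced v a" if "v \<in> ?L2" for v a
    unfolding m_def using that by (intro cInf_lower bdd) auto
  have "(\<lambda>_. 0) \<in> ?L2"
    unfolding bochner_L2_UNIV strongly_measurable_def by (auto intro!: exI[of _ "\<lambda>_ _. 0"])
  then have ne: "?S \<noteq> {}" by auto
  have "\<exists>q. fst q \<in> ?L2 \<and> reduced (fst q) (snd q) < m + 1 / real (Suc n)" for n
  proof -
    have "Inf ?S < m + 1 / real (Suc n)" by (simp add: m_def)
    from cInf_lessD[OF ne this] show ?thesis by force
  qed
  then have "\<exists>q. \<forall>n. fst (q n) \<in> ?L2 \<and> reduced (fst (q n)) (snd (q n)) < m + 1 / real (Suc n)"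
    by (intro choice allI)
  then obtain q where q: "\<And>n. fst (q n) \<in> ?L2" "\<And>n. reduced (fst (q n)) (snd (q n)) < m + 1 / real (Suc n)"
    by blast
  have q1: "reduced (fst (q n)) (snd (q n)) \<le> m + 1" for n
    using q(2)[of n] by (rule less_imp_le[OF less_le_trans]) simp
  have qM: "energy (fst (q n)) \<le> 2 * (m + 1)" for n
    by (rule order_trans[OF reduced_ge(1)[OF q(1)] mult_left_mono[OF q1]]) simp
  have "\<exists>B. \<forall>n. \<bar>snd (q n) p\<bar> \<le> B" if p: "p \<in> x ` {..<N}" for p
  proof -
    obtain j where j: "0 < j" "\<And>n. Jint (fst (q n)) p \<le> 1 / j"
      using Jint_upper_bound[OF p, of "2 * (m + 1)"] q(1) qM by blast
    have "\<bar>snd (q n) p\<bar> \<le> sqrt (2 / \<gamma> * (m + 1) * (1 / j))" for n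
    proof -
      let ?v = "fst (q n)" and ?a = "snd (q n)"
      have Ip: "0 < Jint ?v p" by (rule Jint_pos[OF q(1) p])
      have "(?a p)\<^sup>2 / Jint ?v p \<le> 2 / \<gamma> * reduced ?v ?a" by (rule reduced_ge(2)[OF q(1) p])
      also have "\<dots> \<le> 2 / \<gamma> * (m + 1)" using q1 \<gamma>_pos by (intro mult_left_mono) auto
      finally have le: "(?a p)\<^sup>2 / Jint ?v p \<le> 2 / \<gamma> * (m + 1)" .
      then have "(?a p)\<^sup>2 \<le> 2 / \<gamma> * (m + 1) * Jint ?v p" using Ip by (simp only: pos_divide_le_eq)
      also have "\<dots> \<le> 2 / \<gamma> * (m + 1) * (1 / j)"
      proof (rule mult_left_mono[OF j(2)])
        have "0 \<le> (?a p)\<^sup>2 / Jint ?v p" using Ip by simp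
        then show "0 \<le> 2 / \<gamma> * (m + 1)" using le by (rule order_trans)
      qed
      finally have "sqrt ((?a p)\<^sup>2) \<le> sqrt (2 / \<gamma> * (m + 1) * (1 / j))" by (rule real_sqrt_le_mono)
      then show ?thesis by simp
    qed
    then show ?thesis by blast
  qed
  then have "\<forall>p. \<exists>B. p \<in> x ` {..<N} \<longrightarrow> (\<forall>n. \<bar>snd (q n) p\<bar> \<le> B)" by blast
  from choice[OF this] obtain B where B: "\<And>p n. p \<in> x ` {..<N} \<Longrightarrow> \<bar>snd (q n) p\<bar> \<le> B p" by blast
  \<comment> \<open>Bolzano--Weierstrass for finitely many bounded sequences, read as paths constant
    in time with Hoelder constant 0; the limit numbers are the values at time 0.\<close>
  have "\<exists>(g :: 'a \<Rightarrow> real \<Rightarrow> real) (k :: nat \<Rightarrow> nat). strict_mono k \<and> (\<forall>p\<in>x ` {..<N}. continuous_on {0..1} (g p) \<and>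
     uniform_limit {0..1} (\<lambda>n _. snd (q (k n)) p) (g p) sequentially)"
    by (rule Arzela_Ascoli_finite_family[where Z = "\<lambda>n p _. snd (q n) p" and B = B and H = 0]) (use B in auto)
  then obtain g :: "'a \<Rightarrow> real \<Rightarrow> real" and k :: "nat \<Rightarrow> nat" where k: "strict_mono k"
    and g: "\<And>p. p \<in> x ` {..<N} \<Longrightarrow> uniform_limit {0..1} (\<lambda>n _. snd (q (k n)) p) (g p) sequentially"
    by blast
  have finP: "finite (x ` {..<N})" by simp
  obtain k' :: "nat \<Rightarrow> nat" and v where k': "strict_mono k'" and v: "v \<in> ?L2"
    and vB: "\<And>B. eventually (\<lambda>j. energy (fst (q (k (k' j)))) \<le> B) sequentially \<Longrightarrow> energy v \<le> B"
    and tr: "\<And>p t. p \<in> x ` {..<N} \<Longrightarrow> t \<in> {0..1} \<Longrightarrow> (\<lambda>j. traj (fst (q (k (k' j)))) t p) \<longlonglongrightarrow> traj v t p"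
    and dt: "\<And>p t. p \<in> x ` {..<N} \<Longrightarrow> t \<in> {0..1} \<Longrightarrow> (\<lambda>j. dtraj (fst (q (k (k' j)))) t p) \<longlonglongrightarrow> dtraj v t p"
    by (rule traj_compactness[of "x ` {..<N}" "\<lambda>n. fst (q (k n))" "2 * (m + 1)", OF finP q(1) qM]) (rule that, assumption+)
  define a where "a p = g p 0" for p
  define z where "z n = fst (q (k (k' n)))" for n
  define b where "b n = snd (q (k (k' n)))" for n
  have z: "z n \<in> ?L2" "energy (z n) \<le> 2 * (m + 1)" for n by (simp_all only: z_def q(1) qM)
  have b: "(\<lambda>n. b n p) \<longlonglongrightarrow> a p" if "p \<in> x ` {..<N}" for p
  proof -
    have "(\<lambda>n. snd (q (k n)) p) \<longlonglongrightarrow> g p 0" by (rule tendsto_uniform_limitI[OF g[OF that]]) simp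
    from LIMSEQ_subseq_LIMSEQ[OF this k'] show ?thesis by (simp add: a_def b_def o_def)
  qed
  have tr': "(\<lambda>n. traj (z n) t p) \<longlonglongrightarrow> traj v t p" and dt': "(\<lambda>n. dtraj (z n) t p) \<longlonglongrightarrow> dtraj v t p"
    if "p \<in> x ` {..<N}" "t \<in> {0..1}" for p t
    unfolding z_def by (rule tr[OF that], rule dt[OF that])
  have res: "(\<lambda>n. residual (z n) (b n) w) \<longlonglongrightarrow> residual v a w" for w
    by (rule residual_tendsto[OF z(1) v]) (use tr' dt' b in auto)
  let ?G = "\<lambda>v a. \<Sum>p\<in>x ` {..<N}. (a p)\<^sup>2 / Jint v p"
  have G: "(\<lambda>n. ?G (z n) (b n)) \<longlonglongrightarrow> ?G v a"
  proof (intro tendsto_sum tendsto_divide tendsto_power b)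
    fix p assume p: "p \<in> x ` {..<N}"
    show "(\<lambda>n. Jint (z n) p) \<longlonglongrightarrow> Jint v p"
      by (rule Jint_tendsto[OF z v dt' p])
    show "Jint v p \<noteq> 0" using Jint_pos[OF v p] by simp
  qed
  have kk: "strict_mono (\<lambda>n. k (k' n))" using strict_mono_o[OF k k'] by (simp add: o_def)
  have red: "(\<lambda>n. m + 1 / real (Suc (k (k' n)))) \<longlonglongrightarrow> m + 0"
    using LIMSEQ_subseq_LIMSEQ[OF LIMSEQ_Suc[OF lim_const_over_n[of 1]] kk]
    by (intro tendsto_add tendsto_const) (simp add: o_def)
  have "reduced v a \<le> m + \<epsilon>" if \<epsilon>: "0 < \<epsilon>" for \<epsilon>
  proof -
    \<comment> \<open>Each of the two other terms loses at most \<open>\<epsilon> / 6\<close> and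
      the infimum is missed by less than \<open>\<epsilon> / 3\<close>; doubling the total stays
      below \<open>2 * \<epsilon>\<close>.\<close>
    have arith: "e \<le> 2 * (m - (X + Y) + \<epsilon>)"
      if "X - \<epsilon> / 6 \<le> X'" "Y - \<epsilon> / 6 \<le> Y'" "1 / 2 * e + X' + Y' < m + \<epsilon> / 3" for e X X' Y Y' :: real
      using that \<epsilon> unfolding right_diff_distrib distrib_left by linarith
    \<comment> \<open>The energy of \<open>v\<close> is only lower semicontinuous, so the terms with
      known limits or lower limits are moved to the other side, and \<open>vB\<close> is applied to
      the resulting upper bound.\<close>
    define R where "R = \<gamma> / 2 * ?G v a + \<Lambda> / 2 * (mismatch v a)\<^sup>2"
    have e1: "\<forall>\<^sub>F n in sequentially. ?G v a - \<epsilon> / (3 * \<gamma>) < ?G (z n) (b n)"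
      by (rule order_tendstoD(1)[OF G]) (use \<epsilon> \<gamma>_pos in simp)
    have e2: "\<forall>\<^sub>F n in sequentially. (mismatch v a)\<^sup>2 - \<epsilon> / (3 * \<Lambda>) \<le> (mismatch (z n) (b n))\<^sup>2"
      by (rule mismatch_lsc[OF z(1) v res]) (use \<epsilon> \<Lambda>_pos in simp)
    have e3: "\<forall>\<^sub>F n in sequentially. m + 1 / real (Suc (k (k' n))) < m + \<epsilon> / 3"
      by (rule order_tendstoD(2)[OF red]) (use \<epsilon> in simp)
    have ev: "\<forall>\<^sub>F n in sequentially. energy (z n) \<le> 2 * (m - R + \<epsilon>)"
      using e1 e2 e3
    proof eventually_elim
      fix n
      assume 1: "?G v a - \<epsilon> / (3 * \<gamma>) < ?G (z n) (b n)"
        and 2: "(mismatch v a)\<^sup>2 - \<epsilon> / (3 * \<Lambda>) \<le> (mismatch (z n) (b n))\<^sup>2"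
        and 3: "m + 1 / real (Suc (k (k' n))) < m + \<epsilon> / 3"
      have "\<gamma> / 2 * (?G v a - \<epsilon> / (3 * \<gamma>)) \<le> \<gamma> / 2 * ?G (z n) (b n)"
        using 1 \<gamma>_pos by (intro mult_left_mono) auto
      then have "\<gamma> / 2 * ?G v a - \<epsilon> / 6 \<le> \<gamma> / 2 * ?G (z n) (b n)"
        using \<gamma>_pos by (simp add: right_diff_distrib)
      moreover have "\<Lambda> / 2 * ((mismatch v a)\<^sup>2 - \<epsilon> / (3 * \<Lambda>)) \<le> \<Lambda> / 2 * (mismatch (z n) (b n))\<^sup>2"
        using 2 \<Lambda>_pos by (intro mult_left_mono) auto
      then have "\<Lambda> / 2 * (mismatch v a)\<^sup>2 - \<epsilon> / 6 \<le> \<Lambda> / 2 * (mismatch (z n) (b n))\<^sup>2"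
        using \<Lambda>_pos by (simp add: right_diff_distrib)
      moreover have "reduced (z n) (b n) < m + \<epsilon> / 3"
        using q(2)[of "k (k' n)"] 3 by (simp add: z_def b_def)
      ultimately show "energy (z n) \<le> 2 * (m - R + \<epsilon>)"
        unfolding reduced_def R_def by (rule arith)
    qed
    then have "energy v \<le> 2 * (m - R + \<epsilon>)" unfolding z_def by (rule vB)
    moreover have "1 / 2 * e + X + Y \<le> m + \<epsilon>" if "e \<le> 2 * (m - (X + Y) + \<epsilon>)" for e X Y
      using that unfolding right_diff_distrib distrib_left by linarith
    ultimately show ?thesis unfolding reduced_def R_def by blast
  qed
  then have "reduced v a \<le> m" by (rule field_le_epsilon)
  then have "\<forall>v'\<in>?L2. \<forall>a'. reduced v a \<le> reduced v' a'" using m_le by (meson order_trans)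
  then show ?thesis using v by blast
qed

end

theorem theorem4:
  fixes d N :: nat
    and \<gamma> \<Lambda> :: real
    and eV :: "'v::{real_inner, complete_space} \<Rightarrow> real ^ 'n \<Rightarrow> real ^ 'n"
    and eW :: "'w::{real_inner, complete_space} \<Rightarrow>
                 (real ^ 'n) \<times> (real ^ 'n) oriented_subspace \<Rightarrow> real"
    and kpos :: "real ^ 'n \<Rightarrow> real ^ 'n \<Rightarrow> real"
    and kG :: "(real ^ 'n) oriented_subspace \<Rightarrow> (real ^ 'n) oriented_subspace \<Rightarrow> real"
    and r :: "nat \<Rightarrow> real"
    and x :: "nat \<Rightarrow> real ^ 'n"
    and U :: "nat \<Rightarrow> (real ^ 'n) oriented_subspace"
    and \<mu> \<mu>tar :: "((real ^ 'n) \<times> (real ^ 'n) oriented_subspace) measure"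
  assumes dims: "2 \<le> CARD('n)" "d \<le> CARD('n)"
    and params: "0 < \<gamma>" "0 < \<Lambda>"
    and V: "function_space UNIV eV" "continuously_embedded eV C2_0 C2_norm"
    and kpos: "pos_def_kernel UNIV kpos" "continuous_on UNIV (\<lambda>(y, y'). kpos y y')"
      "\<forall>y. kpos y \<in> C0 UNIV"
    and kG: "pos_def_kernel (Gr d) kG" "continuous_on (Gr d \<times> Gr d) (\<lambda>(S, S'). kG S S')"
    and W: "is_rkhs (UNIV \<times> Gr d) (tensor_kernel kpos kG) eW"
    and k_nonneg: "\<forall>p\<in>UNIV \<times> Gr d. \<forall>q\<in>UNIV \<times> Gr d. 0 \<le> tensor_kernel kpos kG p q"
    and k_diag_pos: "\<forall>p\<in>UNIV \<times> Gr d. 0 < tensor_kernel kpos kG p p"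
    and W_C1: "continuously_embedded eW (C1_0_Gr d) (C1_norm_Gr d)"
    and \<mu>: "\<forall>i<N. 0 < r i" "\<forall>i<N. U i \<in> Gr d" "\<mu> = discrete_varifold d N r x U"
    and \<mu>tar: "\<mu>tar \<in> varifolds d"
  shows "\<exists>v\<in>bochner_L2 UNIV norm. \<exists>\<eta>\<in>bochner_L2 (L2_space (weight \<mu>)) (L2_norm (weight \<mu>)).
    \<forall>v'\<in>bochner_L2 UNIV norm. \<forall>\<eta>'\<in>bochner_L2 (L2_space (weight \<mu>)) (L2_norm (weight \<mu>)).
      relaxed_energy eV eW \<gamma> \<Lambda> \<mu> \<mu>tar v \<eta> \<le> relaxed_energy eV eW \<gamma> \<Lambda> \<mu> \<mu>tar v' \<eta>'"
proof -
  obtain C where C: "vector_fields eV C" using vector_fields_exists[OF V] ..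
  have eW: "eW w \<in> C1_0_Gr d" for w using W_C1 by (auto simp: continuously_embedded_def)
  obtain CW where CW: "\<And>w. C1_norm_Gr d (eW w) \<le> CW * norm w"
    using W_C1 by (auto simp: continuously_embedded_def)
  \<comment> \<open>The derivative part of the C1 norm is nonnegative, so the norm dominates the
    supremum of the function.\<close>
  have eW_bound: "\<bar>eW w p\<bar> \<le> \<bar>CW\<bar> * norm w" if p: "p \<in> UNIV \<times> Gr d" for w p
  proof -
    have "norm (eW w p) \<le> sup_norm (UNIV \<times> Gr d) (eW w)"
      "norm (Deriv_Gr (eW w) p) \<le> sup_norm (UNIV \<times> Gr d) (Deriv_Gr (eW w))"
      using eW[of w] unfolding C1_0_Gr_def mem_Collect_eq by (blast intro: C0_norm_le_sup_norm[OF _ p])+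
    moreover have "CW * norm w \<le> \<bar>CW\<bar> * norm w" by (rule mult_right_mono) auto
    ultimately show ?thesis
      using CW[of w] norm_ge_zero[of "Deriv_Gr (eW w) p"] unfolding C1_norm_Gr_def real_norm_def by linarith
  qed
  interpret vector_fields eV C by (rule C)
  interpret matching eV C d N r x U eW "\<bar>CW\<bar>" \<mu>tar \<gamma> \<Lambda>
  proof (intro matching.intro discrete_data.intro matching_axioms.intro C)
    show "continuous_on (UNIV \<times> Gr d) (eW w)" for w
      using eW[of w] by (simp add: C1_0_Gr_def C0_def)
    show "0 < r i" if "i < N" for i using \<mu>(1) that by blast
    show "U i \<in> Gr d" if "i < N" for i using \<mu>(2) that by blast
    show "sets \<mu>tar = sets (varifold_space d)" "finite_measure \<mu>tar"
      using \<mu>tar by (simp_all add: varifolds_def)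
    show "\<bar>eW w p\<bar> \<le> \<bar>CW\<bar> * norm w" if "p \<in> UNIV \<times> Gr d" for p w by (rule eW_bound[OF that])
    show "0 < \<gamma>" "0 < \<Lambda>" "0 \<le> \<bar>CW\<bar>" by (simp_all add: params)
  qed
  obtain v a where v: "v \<in> bochner_L2 UNIV norm"
    and min: "\<And>v' a'. v' \<in> bochner_L2 UNIV norm \<Longrightarrow> reduced v a \<le> reduced v' a'"
    using reduced_minimizer by blast
  obtain \<eta> where \<eta>: "\<eta> \<in> bochner_L2 (L2_space (weight \<mu>)) (L2_norm (weight \<mu>))"
    "relaxed_energy eV eW \<gamma> \<Lambda> \<mu> \<mu>tar v \<eta> = reduced v a"
    using relaxed_energy_attains_reduced[OF v, of a] unfolding \<mu>(3) by blast
  \<comment> \<open>The minimum of the reduced functional is attained by \<open>(v, \<eta>)\<close>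
    and lies below every relaxed energy.\<close>
  have "relaxed_energy eV eW \<gamma> \<Lambda> \<mu> \<mu>tar v \<eta> \<le> relaxed_energy eV eW \<gamma> \<Lambda> \<mu> \<mu>tar v' \<eta>'"
    if "v' \<in> bochner_L2 UNIV norm" "\<eta>' \<in> bochner_L2 (L2_space (weight \<mu>)) (L2_norm (weight \<mu>))" for v' \<eta>'
    using order_trans[OF min[OF that(1)] reduced_le_relaxed_energy[OF that(1), of \<eta>']] that(2)
    unfolding \<eta>(2) unfolding \<mu>(3) by blast
  then show ?thesis using v \<eta>(1) by blast
qed

end
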